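(* Let $\mathcal U$ be a univalent universe and let $\mathcal V:\mathcal U$ be a type of codes with an embedding $\mathrm{El}:\mathcal V\to\mathcal U$, closed under dependent sums and finite coproducts and containing the terminal type. Then the triple $(!,\mu,\eta)$ is a monad on (the wild category of types in) $\mathcal U$.
   Context: We work in homotopy type theory (as in the HoTT book). The wild category $\mathcal U$ has types in $\mathcal U$ as objects and functions as morphisms. A monad on it is an endofunctor $T$ (maps on objects and morphisms, with identifications witnessing preservation of identities and composition) with natural transformations $\mu:T\circ T\Rightarrow T$ and $\eta:\mathrm{id}\Rightarrow T$ (families of functions with identifications witnessing naturality) and identifications witnessing, for every $A$, $\mu_A\circ T\mu_A=\mu_A\circ\mu_{TA}$, $\mu_A\circ T\eta_A=\mathrm{id}_{TA}$ and $\mu_A\circ\eta_{TA}=\mathrm{id}_{TA}$; no higher coherence is required. For $E:\mathcal V$ one writes $E$ also for the type $\mathrm{El}(E)$. For $A:\mathcal U$, $!A:=\sum_{E:\mathcal V}(E\to A)$; for $f:A\to B$, $!f:{!A}\to{!B}$ is $!f(E,p):=(E,f\circ p)$. The unit is $\eta_A:A\to{!A}$, $\eta_A(a):=(\mathbf 1,\mathrm{cst}_a)$, where $\mathbf 1$ is the terminal type and $\mathrm{cst}_a$ the constant function at $a$. The multiplication is $\mu_A:{!!A}\to{!A}$, $\mu_A(E,p):=\bigl(\sum_{e:E}\mathrm{fst}(p(e)),\,(e,e')\mapsto\mathrm{snd}(p(e))(e')\bigr)$. *)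

theory Defs
  imports Main
begin

text \<open>
  The object theory is the type theory of the HoTT book (Appendix A.2), deeply embedded: raw terms
  with de Bruijn indices, and inductively generated judgements. A shallow embedding is not an
  option: identity types must not be read as HOL equality, and a logical-framework-style encoding of
  binders by HOL functions would be inconsistent with univalence.

  The fragment used here has cumulative Russell universes, dependent functions and pairs, binary
  sums, the empty and unit types, identity types and the function extensionality axiom.
  Natural numbers and higher inductive types are left out, and univalence is not an axiom:
  it is assumed, inside the theory, of the one universe that is required to be univalent. What is
  inhabited in this fragment is inhabited in the full theory of the book.
\<close>

section \<open>Raw terms\<close>

text \<open>
  Binding structure: the second arguments of \<open>Pi\<close>, \<open>Lam\<close>, \<open>Sig\<close> bind one variable. Every motive
  (first argument of an eliminator) binds the eliminated element; the motive of \<open>IndId\<close> binds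
  \<open>x, y, p\<close> (indices 2, 1, 0). The branch of \<open>IndSig\<close> binds the two components (indices 1, 0), the
  branches of \<open>IndSum\<close> and \<open>IndId\<close> bind one variable. The type subscripts which the book attaches
  to eliminators are not recorded.
\<close>

datatype tm =
    Var nat
  | Univ nat
  | Pi tm tm | Lam tm tm | App tm tm
  | Sig tm tm | Pair tm tm | IndSig tm tm tm
  | Sum tm tm | Inl tm | Inr tm | IndSum tm tm tm tm
  | Empty | IndEmpty tm tm
  | One | Star | IndOne tm tm tm
  | Id tm tm tm | Refl tm | IndId tm tm tm tm tm
  | Funext nat

definition upr :: "(nat \<Rightarrow> nat) \<Rightarrow> nat \<Rightarrow> nat" where
  "upr r = case_nat 0 (\<lambda>i. Suc (r i))"

primrec ren :: "tm \<Rightarrow> (nat \<Rightarrow> nat) \<Rightarrow> tm" where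
  "ren (Var i) r = Var (r i)"
| "ren (Univ i) r = Univ i"
| "ren (Pi A B) r = Pi (ren A r) (ren B (upr r))"
| "ren (Lam A b) r = Lam (ren A r) (ren b (upr r))"
| "ren (App f a) r = App (ren f r) (ren a r)"
| "ren (Sig A B) r = Sig (ren A r) (ren B (upr r))"
| "ren (Pair a b) r = Pair (ren a r) (ren b r)"
| "ren (IndSig C g p) r = IndSig (ren C (upr r)) (ren g (upr (upr r))) (ren p r)"
| "ren (Sum A B) r = Sum (ren A r) (ren B r)"
| "ren (Inl a) r = Inl (ren a r)"
| "ren (Inr b) r = Inr (ren b r)"
| "ren (IndSum C c d e) r = IndSum (ren C (upr r)) (ren c (upr r)) (ren d (upr r)) (ren e r)"
| "ren Empty r = Empty"
| "ren (IndEmpty C a) r = IndEmpty (ren C (upr r)) (ren a r)"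
| "ren One r = One"
| "ren Star r = Star"
| "ren (IndOne C c a) r = IndOne (ren C (upr r)) (ren c r) (ren a r)"
| "ren (Id A a b) r = Id (ren A r) (ren a r) (ren b r)"
| "ren (Refl a) r = Refl (ren a r)"
| "ren (IndId C c a b p) r =
     IndId (ren C (upr (upr (upr r)))) (ren c (upr r)) (ren a r) (ren b r) (ren p r)"
| "ren (Funext i) r = Funext i"

abbreviation shift :: "tm \<Rightarrow> tm" where
  "shift t \<equiv> ren t Suc"

definition ups :: "(nat \<Rightarrow> tm) \<Rightarrow> nat \<Rightarrow> tm" where
  "ups s = case_nat (Var 0) (\<lambda>i. shift (s i))"

primrec sub :: "tm \<Rightarrow> (nat \<Rightarrow> tm) \<Rightarrow> tm" where
  "sub (Var i) s = s i"
| "sub (Univ i) s = Univ i"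
| "sub (Pi A B) s = Pi (sub A s) (sub B (ups s))"
| "sub (Lam A b) s = Lam (sub A s) (sub b (ups s))"
| "sub (App f a) s = App (sub f s) (sub a s)"
| "sub (Sig A B) s = Sig (sub A s) (sub B (ups s))"
| "sub (Pair a b) s = Pair (sub a s) (sub b s)"
| "sub (IndSig C g p) s = IndSig (sub C (ups s)) (sub g (ups (ups s))) (sub p s)"
| "sub (Sum A B) s = Sum (sub A s) (sub B s)"
| "sub (Inl a) s = Inl (sub a s)"
| "sub (Inr b) s = Inr (sub b s)"
| "sub (IndSum C c d e) s = IndSum (sub C (ups s)) (sub c (ups s)) (sub d (ups s)) (sub e s)"
| "sub Empty s = Empty"
| "sub (IndEmpty C a) s = IndEmpty (sub C (ups s)) (sub a s)"
| "sub One s = One"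
| "sub Star s = Star"
| "sub (IndOne C c a) s = IndOne (sub C (ups s)) (sub c s) (sub a s)"
| "sub (Id A a b) s = Id (sub A s) (sub a s) (sub b s)"
| "sub (Refl a) s = Refl (sub a s)"
| "sub (IndId C c a b p) s =
     IndId (sub C (ups (ups (ups s)))) (sub c (ups s)) (sub a s) (sub b s) (sub p s)"
| "sub (Funext i) s = Funext i"

text \<open>\<open>inst b a\<close> is $b[a/x]$, and \<open>inst2 g a b\<close>, \<open>inst3 C a b p\<close> substitute for two and three variables,
  the last argument for index 0.\<close>

abbreviation inst :: "tm \<Rightarrow> tm \<Rightarrow> tm" where
  "inst b a \<equiv> sub b (case_nat a Var)"

abbreviation inst2 :: "tm \<Rightarrow> tm \<Rightarrow> tm \<Rightarrow> tm" where
  "inst2 g a b \<equiv> sub g (case_nat b (case_nat a Var))"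

abbreviation inst3 :: "tm \<Rightarrow> tm \<Rightarrow> tm \<Rightarrow> tm \<Rightarrow> tm" where
  "inst3 C a b p \<equiv> sub C (case_nat p (case_nat b (case_nat a Var)))"


section \<open>Named notation for terms\<close>

text \<open>
  Concrete object-level terms are written with HOL lambdas for bound variables. A term is represented
  by the function sending a number \<open>d\<close> of enclosing binders to the raw term under these binders, and
  a bound variable by its de Bruijn level \<open>k\<close>, that is, by index \<open>d - Suc k\<close> under \<open>d\<close> binders.
  For a closed term \<open>t\<close> the raw term is \<open>t 0\<close>. This is notation only; the judgements
  below are about raw terms.
\<close>

type_synonym hterm = "nat \<Rightarrow> tm"

definition level :: "nat \<Rightarrow> hterm" where
  "level k = (\<lambda>d. Var (d - Suc k))"

definition bind1 :: "(hterm \<Rightarrow> hterm) \<Rightarrow> hterm" where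
  "bind1 f = (\<lambda>d. f (level d) (Suc d))"

definition bind2 :: "(hterm \<Rightarrow> hterm \<Rightarrow> hterm) \<Rightarrow> hterm" where
  "bind2 f = (\<lambda>d. f (level d) (level (Suc d)) (Suc (Suc d)))"

definition bind3 :: "(hterm \<Rightarrow> hterm \<Rightarrow> hterm \<Rightarrow> hterm) \<Rightarrow> hterm" where
  "bind3 f = (\<lambda>d. f (level d) (level (Suc d)) (level (Suc (Suc d))) (Suc (Suc (Suc d))))"

definition \<U> :: "nat \<Rightarrow> hterm" where
  "\<U> i = (\<lambda>d. Univ i)"

definition pi :: "hterm \<Rightarrow> (hterm \<Rightarrow> hterm) \<Rightarrow> hterm" where
  "pi A B = (\<lambda>d. Pi (A d) (bind1 B d))"

definition lam :: "hterm \<Rightarrow> (hterm \<Rightarrow> hterm) \<Rightarrow> hterm" where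
  "lam A b = (\<lambda>d. Lam (A d) (bind1 b d))"

definition app :: "hterm \<Rightarrow> hterm \<Rightarrow> hterm"  (infixl "\<cdot>" 90) where
  "f \<cdot> a = (\<lambda>d. App (f d) (a d))"

definition sig :: "hterm \<Rightarrow> (hterm \<Rightarrow> hterm) \<Rightarrow> hterm" where
  "sig A B = (\<lambda>d. Sig (A d) (bind1 B d))"

definition pair :: "hterm \<Rightarrow> hterm \<Rightarrow> hterm" where
  "pair a b = (\<lambda>d. Pair (a d) (b d))"

definition ind_sig :: "(hterm \<Rightarrow> hterm) \<Rightarrow> (hterm \<Rightarrow> hterm \<Rightarrow> hterm) \<Rightarrow> hterm \<Rightarrow> hterm" where
  "ind_sig C g p = (\<lambda>d. IndSig (bind1 C d) (bind2 g d) (p d))"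

definition coprod :: "hterm \<Rightarrow> hterm \<Rightarrow> hterm"  (infixr "\<oplus>" 65) where
  "A \<oplus> B = (\<lambda>d. Sum (A d) (B d))"

definition empty_type :: hterm where
  "empty_type = (\<lambda>d. Empty)"

definition unit_type :: hterm where
  "unit_type = (\<lambda>d. One)"

definition ident :: "hterm \<Rightarrow> hterm \<Rightarrow> hterm \<Rightarrow> hterm" where
  "ident A a b = (\<lambda>d. Id (A d) (a d) (b d))"

definition rfl :: "hterm \<Rightarrow> hterm" where
  "rfl a = (\<lambda>d. Refl (a d))"

definition ind_id :: "(hterm \<Rightarrow> hterm \<Rightarrow> hterm \<Rightarrow> hterm) \<Rightarrow> (hterm \<Rightarrow> hterm)
    \<Rightarrow> hterm \<Rightarrow> hterm \<Rightarrow> hterm \<Rightarrow> hterm" where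
  "ind_id C c a b p = (\<lambda>d. IndId (bind3 C d) (bind1 c d) (a d) (b d) (p d))"

definition arr :: "hterm \<Rightarrow> hterm \<Rightarrow> hterm"  (infixr "\<rightarrow>" 60) where
  "A \<rightarrow> B = pi A (\<lambda>_. B)"

definition prod_type :: "hterm \<Rightarrow> hterm \<Rightarrow> hterm"  (infixr "\<otimes>" 70) where
  "A \<otimes> B = sig A (\<lambda>_. B)"


section \<open>Basic notions of the HoTT book\<close>

definition idfun :: "hterm \<Rightarrow> hterm" where
  "idfun A = lam A (\<lambda>x. x)"

text \<open>\<open>compose A g f\<close> is $g \circ f$, where \<open>A\<close> is the domain of \<open>f\<close>.\<close>

definition compose :: "hterm \<Rightarrow> hterm \<Rightarrow> hterm \<Rightarrow> hterm" where
  "compose A g f = lam A (\<lambda>x. g \<cdot> (f \<cdot> x))"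

definition pr1 :: "hterm \<Rightarrow> hterm \<Rightarrow> hterm" where
  "pr1 A p = ind_sig (\<lambda>_. A) (\<lambda>x y. x) p"

definition pr2 :: "hterm \<Rightarrow> (hterm \<Rightarrow> hterm) \<Rightarrow> hterm \<Rightarrow> hterm" where
  "pr2 A B p = ind_sig (\<lambda>z. B (pr1 A z)) (\<lambda>x y. y) p"

definition ap :: "hterm \<Rightarrow> hterm \<Rightarrow> hterm \<Rightarrow> hterm \<Rightarrow> hterm \<Rightarrow> hterm" where
  "ap B f x y p = ind_id (\<lambda>x y _. ident B (f \<cdot> x) (f \<cdot> y)) (\<lambda>x. rfl (f \<cdot> x)) x y p"

text \<open>The function $A \to B$ given by transport along $p : A =_{\mathcal U} B$.\<close>

definition coe :: "hterm \<Rightarrow> hterm \<Rightarrow> hterm \<Rightarrow> hterm" where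
  "coe A B p = ind_id (\<lambda>X Y _. X \<rightarrow> Y) (\<lambda>X. idfun X) A B p"

definition is_equiv :: "hterm \<Rightarrow> hterm \<Rightarrow> hterm \<Rightarrow> hterm" where
  "is_equiv A B f =
     sig (B \<rightarrow> A) (\<lambda>g. pi B (\<lambda>y. ident B (f \<cdot> (g \<cdot> y)) y)) \<otimes>
     sig (B \<rightarrow> A) (\<lambda>h. pi A (\<lambda>x. ident A (h \<cdot> (f \<cdot> x)) x))"

definition equiv :: "hterm \<Rightarrow> hterm \<Rightarrow> hterm" where
  "equiv A B = sig (A \<rightarrow> B) (\<lambda>f. is_equiv A B f)"

definition id_equiv :: "hterm \<Rightarrow> hterm" where
  "id_equiv A =
     pair (idfun A) (pair (pair (idfun A) (lam A (\<lambda>x. rfl x))) (pair (idfun A) (lam A (\<lambda>x. rfl x))))"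

definition id_to_equiv :: "hterm \<Rightarrow> hterm \<Rightarrow> hterm \<Rightarrow> hterm" where
  "id_to_equiv A B p = ind_id (\<lambda>X Y _. equiv X Y) (\<lambda>X. id_equiv X) A B p"

definition univalent :: "nat \<Rightarrow> hterm" where
  "univalent n = pi (\<U> n) (\<lambda>A. pi (\<U> n) (\<lambda>B.
     is_equiv (ident (\<U> n) A B) (equiv A B)
       (lam (ident (\<U> n) A B) (\<lambda>p. id_to_equiv A B p))))"

definition is_embedding :: "hterm \<Rightarrow> hterm \<Rightarrow> hterm \<Rightarrow> hterm" where
  "is_embedding A B f = pi A (\<lambda>x. pi A (\<lambda>y.
     is_equiv (ident A x y) (ident B (f \<cdot> x) (f \<cdot> y))
       (lam (ident A x y) (\<lambda>p. ap B f x y p))))"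

definition fib :: "hterm \<Rightarrow> hterm \<Rightarrow> hterm \<Rightarrow> hterm \<Rightarrow> hterm" where
  "fib A B f b = sig A (\<lambda>a. ident B (f \<cdot> a) b)"

definition happly :: "hterm \<Rightarrow> (hterm \<Rightarrow> hterm) \<Rightarrow> hterm \<Rightarrow> hterm \<Rightarrow> hterm \<Rightarrow> hterm" where
  "happly A B f g p = ind_id (\<lambda>f g _. pi A (\<lambda>x. ident (B x) (f \<cdot> x) (g \<cdot> x)))
     (\<lambda>f. lam A (\<lambda>x. rfl (f \<cdot> x))) f g p"

definition funext_type :: "nat \<Rightarrow> hterm" where
  "funext_type i = pi (\<U> i) (\<lambda>A. pi (A \<rightarrow> \<U> i) (\<lambda>B.
     pi (pi A (\<lambda>x. B \<cdot> x)) (\<lambda>f. pi (pi A (\<lambda>x. B \<cdot> x)) (\<lambda>g.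
       is_equiv (ident (pi A (\<lambda>x. B \<cdot> x)) f g) (pi A (\<lambda>x. ident (B \<cdot> x) (f \<cdot> x) (g \<cdot> x)))
         (lam (ident (pi A (\<lambda>x. B \<cdot> x)) f g) (\<lambda>p. happly A (\<lambda>x. B \<cdot> x) f g p))))))"


section \<open>Judgements\<close>

text \<open>
  Contexts list the types of the variables, most recent first; the type of variable \<open>i\<close> lives in
  the context of the later entries of the list. The rules are those of Appendix A.2 of the book,
  including the congruence rules omitted there. Weakening and substitution are
  admissible; they are nevertheless listed, for the last variable of the context.
\<close>

inductive
  ctx :: "tm list \<Rightarrow> bool" and
  hastype :: "tm list \<Rightarrow> tm \<Rightarrow> tm \<Rightarrow> bool"  ("_ \<turnstile> _ \<Colon> _" [50, 50, 50] 50) and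
  jeq :: "tm list \<Rightarrow> tm \<Rightarrow> tm \<Rightarrow> tm \<Rightarrow> bool"  ("_ \<turnstile> _ \<equiv> _ \<Colon> _" [50, 50, 50, 50] 50)
where
  ctx_emp: "ctx []"
| ctx_ext: "\<Gamma> \<turnstile> A \<Colon> Univ i \<Longrightarrow> ctx (A # \<Gamma>)"

| vble: "ctx \<Gamma> \<Longrightarrow> k < length \<Gamma> \<Longrightarrow> \<Gamma> \<turnstile> Var k \<Colon> ren (\<Gamma> ! k) (\<lambda>i. i + Suc k)"
| wkg: "\<Gamma> \<turnstile> A \<Colon> Univ i \<Longrightarrow> \<Gamma> \<turnstile> b \<Colon> B \<Longrightarrow> A # \<Gamma> \<turnstile> shift b \<Colon> shift B"
| wkg_eq: "\<Gamma> \<turnstile> A \<Colon> Univ i \<Longrightarrow> \<Gamma> \<turnstile> b \<equiv> c \<Colon> B \<Longrightarrow> A # \<Gamma> \<turnstile> shift b \<equiv> shift c \<Colon> shift B"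
| subst: "\<Gamma> \<turnstile> a \<Colon> A \<Longrightarrow> A # \<Gamma> \<turnstile> b \<Colon> B \<Longrightarrow> \<Gamma> \<turnstile> inst b a \<Colon> inst B a"
| subst_eq: "\<Gamma> \<turnstile> a \<Colon> A \<Longrightarrow> A # \<Gamma> \<turnstile> b \<equiv> c \<Colon> B \<Longrightarrow> \<Gamma> \<turnstile> inst b a \<equiv> inst c a \<Colon> inst B a"

| eq_refl: "\<Gamma> \<turnstile> a \<Colon> A \<Longrightarrow> \<Gamma> \<turnstile> a \<equiv> a \<Colon> A"
| eq_sym: "\<Gamma> \<turnstile> a \<equiv> b \<Colon> A \<Longrightarrow> \<Gamma> \<turnstile> b \<equiv> a \<Colon> A"
| eq_trans: "\<Gamma> \<turnstile> a \<equiv> b \<Colon> A \<Longrightarrow> \<Gamma> \<turnstile> b \<equiv> c \<Colon> A \<Longrightarrow> \<Gamma> \<turnstile> a \<equiv> c \<Colon> A"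
| conv: "\<Gamma> \<turnstile> a \<Colon> A \<Longrightarrow> \<Gamma> \<turnstile> A \<equiv> B \<Colon> Univ i \<Longrightarrow> \<Gamma> \<turnstile> a \<Colon> B"
| conv_eq: "\<Gamma> \<turnstile> a \<equiv> b \<Colon> A \<Longrightarrow> \<Gamma> \<turnstile> A \<equiv> B \<Colon> Univ i \<Longrightarrow> \<Gamma> \<turnstile> a \<equiv> b \<Colon> B"

| U_intro: "ctx \<Gamma> \<Longrightarrow> \<Gamma> \<turnstile> Univ i \<Colon> Univ (Suc i)"
| U_cumul: "\<Gamma> \<turnstile> A \<Colon> Univ i \<Longrightarrow> \<Gamma> \<turnstile> A \<Colon> Univ (Suc i)"
| U_cumul_eq: "\<Gamma> \<turnstile> A \<equiv> B \<Colon> Univ i \<Longrightarrow> \<Gamma> \<turnstile> A \<equiv> B \<Colon> Univ (Suc i)"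

| Pi_form: "\<Gamma> \<turnstile> A \<Colon> Univ i \<Longrightarrow> A # \<Gamma> \<turnstile> B \<Colon> Univ i \<Longrightarrow> \<Gamma> \<turnstile> Pi A B \<Colon> Univ i"
| Pi_form_eq: "\<Gamma> \<turnstile> A \<equiv> A' \<Colon> Univ i \<Longrightarrow> A # \<Gamma> \<turnstile> B \<equiv> B' \<Colon> Univ i \<Longrightarrow>
    \<Gamma> \<turnstile> Pi A B \<equiv> Pi A' B' \<Colon> Univ i"
| Pi_intro: "\<Gamma> \<turnstile> A \<Colon> Univ i \<Longrightarrow> A # \<Gamma> \<turnstile> b \<Colon> B \<Longrightarrow> \<Gamma> \<turnstile> Lam A b \<Colon> Pi A B"
| Pi_intro_eq: "\<Gamma> \<turnstile> A \<equiv> A' \<Colon> Univ i \<Longrightarrow> A # \<Gamma> \<turnstile> b \<equiv> b' \<Colon> B \<Longrightarrow>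
    \<Gamma> \<turnstile> Lam A b \<equiv> Lam A' b' \<Colon> Pi A B"
| Pi_elim: "\<Gamma> \<turnstile> f \<Colon> Pi A B \<Longrightarrow> \<Gamma> \<turnstile> a \<Colon> A \<Longrightarrow> \<Gamma> \<turnstile> App f a \<Colon> inst B a"
| Pi_elim_eq: "\<Gamma> \<turnstile> f \<equiv> f' \<Colon> Pi A B \<Longrightarrow> \<Gamma> \<turnstile> a \<equiv> a' \<Colon> A \<Longrightarrow>
    \<Gamma> \<turnstile> App f a \<equiv> App f' a' \<Colon> inst B a"
| Pi_comp: "A # \<Gamma> \<turnstile> b \<Colon> B \<Longrightarrow> \<Gamma> \<turnstile> a \<Colon> A \<Longrightarrow> \<Gamma> \<turnstile> App (Lam A b) a \<equiv> inst b a \<Colon> inst B a"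
| Pi_uniq: "\<Gamma> \<turnstile> f \<Colon> Pi A B \<Longrightarrow> \<Gamma> \<turnstile> f \<equiv> Lam A (App (shift f) (Var 0)) \<Colon> Pi A B"

| Sig_form: "\<Gamma> \<turnstile> A \<Colon> Univ i \<Longrightarrow> A # \<Gamma> \<turnstile> B \<Colon> Univ i \<Longrightarrow> \<Gamma> \<turnstile> Sig A B \<Colon> Univ i"
| Sig_form_eq: "\<Gamma> \<turnstile> A \<equiv> A' \<Colon> Univ i \<Longrightarrow> A # \<Gamma> \<turnstile> B \<equiv> B' \<Colon> Univ i \<Longrightarrow>
    \<Gamma> \<turnstile> Sig A B \<equiv> Sig A' B' \<Colon> Univ i"
| Sig_intro: "A # \<Gamma> \<turnstile> B \<Colon> Univ i \<Longrightarrow> \<Gamma> \<turnstile> a \<Colon> A \<Longrightarrow> \<Gamma> \<turnstile> b \<Colon> inst B a \<Longrightarrow>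
    \<Gamma> \<turnstile> Pair a b \<Colon> Sig A B"
| Sig_intro_eq: "A # \<Gamma> \<turnstile> B \<Colon> Univ i \<Longrightarrow> \<Gamma> \<turnstile> a \<equiv> a' \<Colon> A \<Longrightarrow> \<Gamma> \<turnstile> b \<equiv> b' \<Colon> inst B a \<Longrightarrow>
    \<Gamma> \<turnstile> Pair a b \<equiv> Pair a' b' \<Colon> Sig A B"
| Sig_elim: "Sig A B # \<Gamma> \<turnstile> C \<Colon> Univ i \<Longrightarrow>
    B # A # \<Gamma> \<turnstile> g \<Colon> sub C (case_nat (Pair (Var 1) (Var 0)) (\<lambda>j. Var (j + 2))) \<Longrightarrow>
    \<Gamma> \<turnstile> p \<Colon> Sig A B \<Longrightarrow> \<Gamma> \<turnstile> IndSig C g p \<Colon> inst C p"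
| Sig_elim_eq: "Sig A B # \<Gamma> \<turnstile> C \<equiv> C' \<Colon> Univ i \<Longrightarrow>
    B # A # \<Gamma> \<turnstile> g \<equiv> g' \<Colon> sub C (case_nat (Pair (Var 1) (Var 0)) (\<lambda>j. Var (j + 2))) \<Longrightarrow>
    \<Gamma> \<turnstile> p \<equiv> p' \<Colon> Sig A B \<Longrightarrow> \<Gamma> \<turnstile> IndSig C g p \<equiv> IndSig C' g' p' \<Colon> inst C p"
| Sig_comp: "Sig A B # \<Gamma> \<turnstile> C \<Colon> Univ i \<Longrightarrow>
    B # A # \<Gamma> \<turnstile> g \<Colon> sub C (case_nat (Pair (Var 1) (Var 0)) (\<lambda>j. Var (j + 2))) \<Longrightarrow>
    \<Gamma> \<turnstile> a \<Colon> A \<Longrightarrow> \<Gamma> \<turnstile> b \<Colon> inst B a \<Longrightarrow>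
    \<Gamma> \<turnstile> IndSig C g (Pair a b) \<equiv> inst2 g a b \<Colon> inst C (Pair a b)"

| Sum_form: "\<Gamma> \<turnstile> A \<Colon> Univ i \<Longrightarrow> \<Gamma> \<turnstile> B \<Colon> Univ i \<Longrightarrow> \<Gamma> \<turnstile> Sum A B \<Colon> Univ i"
| Sum_form_eq: "\<Gamma> \<turnstile> A \<equiv> A' \<Colon> Univ i \<Longrightarrow> \<Gamma> \<turnstile> B \<equiv> B' \<Colon> Univ i \<Longrightarrow>
    \<Gamma> \<turnstile> Sum A B \<equiv> Sum A' B' \<Colon> Univ i"
| Sum_intro1: "\<Gamma> \<turnstile> A \<Colon> Univ i \<Longrightarrow> \<Gamma> \<turnstile> B \<Colon> Univ i \<Longrightarrow> \<Gamma> \<turnstile> a \<Colon> A \<Longrightarrow> \<Gamma> \<turnstile> Inl a \<Colon> Sum A B"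
| Sum_intro1_eq: "\<Gamma> \<turnstile> A \<Colon> Univ i \<Longrightarrow> \<Gamma> \<turnstile> B \<Colon> Univ i \<Longrightarrow> \<Gamma> \<turnstile> a \<equiv> a' \<Colon> A \<Longrightarrow>
    \<Gamma> \<turnstile> Inl a \<equiv> Inl a' \<Colon> Sum A B"
| Sum_intro2: "\<Gamma> \<turnstile> A \<Colon> Univ i \<Longrightarrow> \<Gamma> \<turnstile> B \<Colon> Univ i \<Longrightarrow> \<Gamma> \<turnstile> b \<Colon> B \<Longrightarrow> \<Gamma> \<turnstile> Inr b \<Colon> Sum A B"
| Sum_intro2_eq: "\<Gamma> \<turnstile> A \<Colon> Univ i \<Longrightarrow> \<Gamma> \<turnstile> B \<Colon> Univ i \<Longrightarrow> \<Gamma> \<turnstile> b \<equiv> b' \<Colon> B \<Longrightarrow>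
    \<Gamma> \<turnstile> Inr b \<equiv> Inr b' \<Colon> Sum A B"
| Sum_elim: "Sum A B # \<Gamma> \<turnstile> C \<Colon> Univ i \<Longrightarrow>
    A # \<Gamma> \<turnstile> c \<Colon> sub C (case_nat (Inl (Var 0)) (\<lambda>j. Var (j + 1))) \<Longrightarrow>
    B # \<Gamma> \<turnstile> d \<Colon> sub C (case_nat (Inr (Var 0)) (\<lambda>j. Var (j + 1))) \<Longrightarrow>
    \<Gamma> \<turnstile> e \<Colon> Sum A B \<Longrightarrow> \<Gamma> \<turnstile> IndSum C c d e \<Colon> inst C e"
| Sum_elim_eq: "Sum A B # \<Gamma> \<turnstile> C \<equiv> C' \<Colon> Univ i \<Longrightarrow>
    A # \<Gamma> \<turnstile> c \<equiv> c' \<Colon> sub C (case_nat (Inl (Var 0)) (\<lambda>j. Var (j + 1))) \<Longrightarrow>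
    B # \<Gamma> \<turnstile> d \<equiv> d' \<Colon> sub C (case_nat (Inr (Var 0)) (\<lambda>j. Var (j + 1))) \<Longrightarrow>
    \<Gamma> \<turnstile> e \<equiv> e' \<Colon> Sum A B \<Longrightarrow> \<Gamma> \<turnstile> IndSum C c d e \<equiv> IndSum C' c' d' e' \<Colon> inst C e"
| Sum_comp1: "Sum A B # \<Gamma> \<turnstile> C \<Colon> Univ i \<Longrightarrow>
    A # \<Gamma> \<turnstile> c \<Colon> sub C (case_nat (Inl (Var 0)) (\<lambda>j. Var (j + 1))) \<Longrightarrow>
    B # \<Gamma> \<turnstile> d \<Colon> sub C (case_nat (Inr (Var 0)) (\<lambda>j. Var (j + 1))) \<Longrightarrow>
    \<Gamma> \<turnstile> a \<Colon> A \<Longrightarrow> \<Gamma> \<turnstile> IndSum C c d (Inl a) \<equiv> inst c a \<Colon> inst C (Inl a)"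
| Sum_comp2: "Sum A B # \<Gamma> \<turnstile> C \<Colon> Univ i \<Longrightarrow>
    A # \<Gamma> \<turnstile> c \<Colon> sub C (case_nat (Inl (Var 0)) (\<lambda>j. Var (j + 1))) \<Longrightarrow>
    B # \<Gamma> \<turnstile> d \<Colon> sub C (case_nat (Inr (Var 0)) (\<lambda>j. Var (j + 1))) \<Longrightarrow>
    \<Gamma> \<turnstile> b \<Colon> B \<Longrightarrow> \<Gamma> \<turnstile> IndSum C c d (Inr b) \<equiv> inst d b \<Colon> inst C (Inr b)"

| Empty_form: "ctx \<Gamma> \<Longrightarrow> \<Gamma> \<turnstile> Empty \<Colon> Univ i"
| Empty_elim: "Empty # \<Gamma> \<turnstile> C \<Colon> Univ i \<Longrightarrow> \<Gamma> \<turnstile> a \<Colon> Empty \<Longrightarrow> \<Gamma> \<turnstile> IndEmpty C a \<Colon> inst C a"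
| Empty_elim_eq: "Empty # \<Gamma> \<turnstile> C \<equiv> C' \<Colon> Univ i \<Longrightarrow> \<Gamma> \<turnstile> a \<equiv> a' \<Colon> Empty \<Longrightarrow>
    \<Gamma> \<turnstile> IndEmpty C a \<equiv> IndEmpty C' a' \<Colon> inst C a"

| One_form: "ctx \<Gamma> \<Longrightarrow> \<Gamma> \<turnstile> One \<Colon> Univ i"
| One_intro: "ctx \<Gamma> \<Longrightarrow> \<Gamma> \<turnstile> Star \<Colon> One"
| One_elim: "One # \<Gamma> \<turnstile> C \<Colon> Univ i \<Longrightarrow> \<Gamma> \<turnstile> c \<Colon> inst C Star \<Longrightarrow> \<Gamma> \<turnstile> a \<Colon> One \<Longrightarrow>
    \<Gamma> \<turnstile> IndOne C c a \<Colon> inst C a"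
| One_elim_eq: "One # \<Gamma> \<turnstile> C \<equiv> C' \<Colon> Univ i \<Longrightarrow> \<Gamma> \<turnstile> c \<equiv> c' \<Colon> inst C Star \<Longrightarrow>
    \<Gamma> \<turnstile> a \<equiv> a' \<Colon> One \<Longrightarrow> \<Gamma> \<turnstile> IndOne C c a \<equiv> IndOne C' c' a' \<Colon> inst C a"
| One_comp: "One # \<Gamma> \<turnstile> C \<Colon> Univ i \<Longrightarrow> \<Gamma> \<turnstile> c \<Colon> inst C Star \<Longrightarrow>
    \<Gamma> \<turnstile> IndOne C c Star \<equiv> c \<Colon> inst C Star"

| Id_form: "\<Gamma> \<turnstile> A \<Colon> Univ i \<Longrightarrow> \<Gamma> \<turnstile> a \<Colon> A \<Longrightarrow> \<Gamma> \<turnstile> b \<Colon> A \<Longrightarrow> \<Gamma> \<turnstile> Id A a b \<Colon> Univ i"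
| Id_form_eq: "\<Gamma> \<turnstile> A \<equiv> A' \<Colon> Univ i \<Longrightarrow> \<Gamma> \<turnstile> a \<equiv> a' \<Colon> A \<Longrightarrow> \<Gamma> \<turnstile> b \<equiv> b' \<Colon> A \<Longrightarrow>
    \<Gamma> \<turnstile> Id A a b \<equiv> Id A' a' b' \<Colon> Univ i"
| Id_intro: "\<Gamma> \<turnstile> a \<Colon> A \<Longrightarrow> \<Gamma> \<turnstile> Refl a \<Colon> Id A a a"
| Id_intro_eq: "\<Gamma> \<turnstile> a \<equiv> a' \<Colon> A \<Longrightarrow> \<Gamma> \<turnstile> Refl a \<equiv> Refl a' \<Colon> Id A a a"
| Id_elim: "Id (shift (shift A)) (Var 1) (Var 0) # shift A # A # \<Gamma> \<turnstile> C \<Colon> Univ i \<Longrightarrow>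
    A # \<Gamma> \<turnstile> c \<Colon> sub C (case_nat (Refl (Var 0)) (case_nat (Var 0) (case_nat (Var 0) (\<lambda>j. Var (j + 1))))) \<Longrightarrow>
    \<Gamma> \<turnstile> a \<Colon> A \<Longrightarrow> \<Gamma> \<turnstile> b \<Colon> A \<Longrightarrow> \<Gamma> \<turnstile> p \<Colon> Id A a b \<Longrightarrow>
    \<Gamma> \<turnstile> IndId C c a b p \<Colon> inst3 C a b p"
| Id_elim_eq: "Id (shift (shift A)) (Var 1) (Var 0) # shift A # A # \<Gamma> \<turnstile> C \<equiv> C' \<Colon> Univ i \<Longrightarrow>
    A # \<Gamma> \<turnstile> c \<equiv> c' \<Colon> sub C (case_nat (Refl (Var 0)) (case_nat (Var 0) (case_nat (Var 0) (\<lambda>j. Var (j + 1))))) \<Longrightarrow>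
    \<Gamma> \<turnstile> a \<equiv> a' \<Colon> A \<Longrightarrow> \<Gamma> \<turnstile> b \<equiv> b' \<Colon> A \<Longrightarrow> \<Gamma> \<turnstile> p \<equiv> p' \<Colon> Id A a b \<Longrightarrow>
    \<Gamma> \<turnstile> IndId C c a b p \<equiv> IndId C' c' a' b' p' \<Colon> inst3 C a b p"
| Id_comp: "Id (shift (shift A)) (Var 1) (Var 0) # shift A # A # \<Gamma> \<turnstile> C \<Colon> Univ i \<Longrightarrow>
    A # \<Gamma> \<turnstile> c \<Colon> sub C (case_nat (Refl (Var 0)) (case_nat (Var 0) (case_nat (Var 0) (\<lambda>j. Var (j + 1))))) \<Longrightarrow>
    \<Gamma> \<turnstile> a \<Colon> A \<Longrightarrow> \<Gamma> \<turnstile> IndId C c a a (Refl a) \<equiv> inst c a \<Colon> inst3 C a a (Refl a)"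

\<comment> \<open>The type is closed, so it needs no shifting in a nonempty context.\<close>
| funext: "ctx \<Gamma> \<Longrightarrow> \<Gamma> \<turnstile> Funext i \<Colon> funext_type i 0"


section \<open>Monads on the wild category of types\<close>

text \<open>
  \<open>is_monad n \<cdot> T \<cdot> map \<cdot> mu \<cdot> eta\<close> is the type of all identifications that make the data a monad on
  the wild category of types in \<open>\<U> n\<close>: functoriality of \<open>T\<close>, naturality of \<open>mu\<close> and of
  \<open>eta\<close>, associativity and the two unit laws. Arguments which the informal notation leaves implicit
  are passed explicitly, as in \<open>map \<cdot> A \<cdot> B \<cdot> f\<close> and \<open>mu \<cdot> A\<close>.
\<close>

definition is_monad :: "nat \<Rightarrow> hterm" where
  "is_monad n =
     lam (\<U> n \<rightarrow> \<U> n) (\<lambda>T.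
     lam (pi (\<U> n) (\<lambda>A. pi (\<U> n) (\<lambda>B. (A \<rightarrow> B) \<rightarrow> (T \<cdot> A \<rightarrow> T \<cdot> B)))) (\<lambda>map.
     lam (pi (\<U> n) (\<lambda>A. T \<cdot> (T \<cdot> A) \<rightarrow> T \<cdot> A)) (\<lambda>mu.
     lam (pi (\<U> n) (\<lambda>A. A \<rightarrow> T \<cdot> A)) (\<lambda>eta.
       pi (\<U> n) (\<lambda>A. ident (T \<cdot> A \<rightarrow> T \<cdot> A) (map \<cdot> A \<cdot> A \<cdot> idfun A) (idfun (T \<cdot> A)))
     \<otimes> pi (\<U> n) (\<lambda>A. pi (\<U> n) (\<lambda>B. pi (\<U> n) (\<lambda>C. pi (A \<rightarrow> B) (\<lambda>f. pi (B \<rightarrow> C) (\<lambda>g.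
         ident (T \<cdot> A \<rightarrow> T \<cdot> C)
           (map \<cdot> A \<cdot> C \<cdot> compose A g f)
           (compose (T \<cdot> A) (map \<cdot> B \<cdot> C \<cdot> g) (map \<cdot> A \<cdot> B \<cdot> f)))))))
     \<otimes> pi (\<U> n) (\<lambda>A. pi (\<U> n) (\<lambda>B. pi (A \<rightarrow> B) (\<lambda>f.
         ident (T \<cdot> (T \<cdot> A) \<rightarrow> T \<cdot> B)
           (compose (T \<cdot> (T \<cdot> A)) (mu \<cdot> B) (map \<cdot> (T \<cdot> A) \<cdot> (T \<cdot> B) \<cdot> (map \<cdot> A \<cdot> B \<cdot> f)))
           (compose (T \<cdot> (T \<cdot> A)) (map \<cdot> A \<cdot> B \<cdot> f) (mu \<cdot> A)))))
     \<otimes> pi (\<U> n) (\<lambda>A. pi (\<U> n) (\<lambda>B. pi (A \<rightarrow> B) (\<lambda>f.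
         ident (A \<rightarrow> T \<cdot> B)
           (compose A (eta \<cdot> B) f)
           (compose A (map \<cdot> A \<cdot> B \<cdot> f) (eta \<cdot> A)))))
     \<otimes> pi (\<U> n) (\<lambda>A.
         ident (T \<cdot> (T \<cdot> (T \<cdot> A)) \<rightarrow> T \<cdot> A)
           (compose (T \<cdot> (T \<cdot> (T \<cdot> A))) (mu \<cdot> A) (map \<cdot> (T \<cdot> (T \<cdot> A)) \<cdot> (T \<cdot> A) \<cdot> (mu \<cdot> A)))
           (compose (T \<cdot> (T \<cdot> (T \<cdot> A))) (mu \<cdot> A) (mu \<cdot> (T \<cdot> A))))
     \<otimes> pi (\<U> n) (\<lambda>A.
         ident (T \<cdot> A \<rightarrow> T \<cdot> A)
           (compose (T \<cdot> A) (mu \<cdot> A) (map \<cdot> A \<cdot> (T \<cdot> A) \<cdot> (eta \<cdot> A)))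
           (idfun (T \<cdot> A)))
     \<otimes> pi (\<U> n) (\<lambda>A.
         ident (T \<cdot> A \<rightarrow> T \<cdot> A)
           (compose (T \<cdot> A) (mu \<cdot> A) (eta \<cdot> (T \<cdot> A)))
           (idfun (T \<cdot> A)))))))"


section \<open>Subuniverses and the triple (!, mu, eta)\<close>

text \<open>
  A type in the universe belongs to \<open>V\<close> when the fibre of \<open>El\<close> over it has an element: a code
  together with an identification of its decoding with the given type. As \<open>El\<close> is an
  embedding, this is a mere proposition.
\<close>

definition closed_sig :: "nat \<Rightarrow> hterm \<Rightarrow> hterm \<Rightarrow> hterm" where
  "closed_sig n V El = pi V (\<lambda>E. pi (El \<cdot> E \<rightarrow> V) (\<lambda>F.
     fib V (\<U> n) El (sig (El \<cdot> E) (\<lambda>e. El \<cdot> (F \<cdot> e)))))"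

definition contains_unit :: "nat \<Rightarrow> hterm \<Rightarrow> hterm \<Rightarrow> hterm" where
  "contains_unit n V El = fib V (\<U> n) El unit_type"

text \<open>Finite coproducts are the empty type and binary sums.\<close>

definition closed_coprod :: "nat \<Rightarrow> hterm \<Rightarrow> hterm \<Rightarrow> hterm" where
  "closed_coprod n V El = fib V (\<U> n) El empty_type \<otimes>
     pi V (\<lambda>E. pi V (\<lambda>F. fib V (\<U> n) El (El \<cdot> E \<oplus> El \<cdot> F)))"

definition bang :: "hterm \<Rightarrow> hterm \<Rightarrow> hterm \<Rightarrow> hterm" where
  "bang V El A = sig V (\<lambda>E. El \<cdot> E \<rightarrow> A)"

definition bang_obj :: "nat \<Rightarrow> hterm \<Rightarrow> hterm \<Rightarrow> hterm" where
  "bang_obj n V El = lam (\<U> n) (\<lambda>A. bang V El A)"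

definition bang_map :: "nat \<Rightarrow> hterm \<Rightarrow> hterm \<Rightarrow> hterm" where
  "bang_map n V El =
     lam (\<U> n) (\<lambda>A. lam (\<U> n) (\<lambda>B. lam (A \<rightarrow> B) (\<lambda>f. lam (bang V El A) (\<lambda>w.
       ind_sig (\<lambda>_. bang V El B) (\<lambda>E p. pair E (compose (El \<cdot> E) f p)) w))))"

text \<open>\<open>unit_in_V\<close> and \<open>sig_in_V\<close> stand for elements of \<open>contains_unit\<close> and \<open>closed_sig\<close>.\<close>

definition unit_code :: "hterm \<Rightarrow> hterm \<Rightarrow> hterm" where
  "unit_code V unit_in_V = pr1 V unit_in_V"

definition bang_eta :: "nat \<Rightarrow> hterm \<Rightarrow> hterm \<Rightarrow> hterm \<Rightarrow> hterm" where
  "bang_eta n V El unit_in_V =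
     lam (\<U> n) (\<lambda>A. lam A (\<lambda>a.
       pair (unit_code V unit_in_V) (lam (El \<cdot> unit_code V unit_in_V) (\<lambda>_. a))))"

definition sig_code :: "hterm \<Rightarrow> hterm \<Rightarrow> hterm \<Rightarrow> hterm \<Rightarrow> hterm" where
  "sig_code V sig_in_V E F = pr1 V (sig_in_V \<cdot> E \<cdot> F)"

text \<open>The canonical function from the decoding of the code of a dependent sum to the dependent sum.\<close>

definition sig_decode :: "nat \<Rightarrow> hterm \<Rightarrow> hterm \<Rightarrow> hterm \<Rightarrow> hterm \<Rightarrow> hterm \<Rightarrow> hterm" where
  "sig_decode n V El sig_in_V E F =
     coe (El \<cdot> sig_code V sig_in_V E F) (sig (El \<cdot> E) (\<lambda>e. El \<cdot> (F \<cdot> e)))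
       (pr2 V (\<lambda>S. ident (\<U> n) (El \<cdot> S) (sig (El \<cdot> E) (\<lambda>e. El \<cdot> (F \<cdot> e)))) (sig_in_V \<cdot> E \<cdot> F))"

text \<open>
  $\mu_A(E,p)$ consists of the code \<open>S\<close> of $\sum_{e:E}\mathrm{fst}(p(e))$ and of the map
  $(e,e') \mapsto \mathrm{snd}(p(e))(e')$, defined by the eliminator of the dependent sum and
  precomposed with \<open>sig_decode\<close>.
\<close>

definition bang_mu :: "nat \<Rightarrow> hterm \<Rightarrow> hterm \<Rightarrow> hterm \<Rightarrow> hterm" where
  "bang_mu n V El sig_in_V =
     lam (\<U> n) (\<lambda>A. lam (bang V El (bang V El A)) (\<lambda>w.
       ind_sig (\<lambda>_. bang V El A)
         (\<lambda>E p.
            let F = lam (El \<cdot> E) (\<lambda>e. pr1 V (p \<cdot> e));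
                S = sig_code V sig_in_V E F
            in pair S (lam (El \<cdot> S) (\<lambda>s.
                 ind_sig (\<lambda>_. A)
                   (\<lambda>e e'. pr2 V (\<lambda>E'. El \<cdot> E' \<rightarrow> A) (p \<cdot> e) \<cdot> e')
                   (sig_decode n V El sig_in_V E F \<cdot> s))))
         w))"

end

theory Submission
  imports Defs
begin

text \<open>
  An element $w$ of $!A$ is represented by a map $r : X \to A$ if there are a code $S$ and an
  identification $i : \mathrm{El}(S) = X$ with $w = (S, r \circ i_*)$. Every element is represented,
  by its own decoding. Since $\mathrm{El}$ is an embedding and $\mathcal U$ is univalent, two
  elements with representations $X \to A$ and $X' \to A$ that differ by an equivalence $X \simeq X'$
  over $A$ are equal. The map $!f$ sends a representation $r$ to $f \circ r$, the unit is represented by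
  a map from $\mathbf 1$, and if $W$ is represented by $P : X \to {!A}$ and each $P(x)$ by
  $q_x : Y_x \to A$, then $\mu(W)$ is represented by the map $(x, y) \mapsto q_x(y)$ on $\sum_{x:X} Y_x$.
  With these facts each monad law reduces to a canonical equivalence of types, such as the
  associativity of dependent sums.

  The derivations are terms of the object theory. They are verified by a type checker
  that is proved sound with respect to the judgements and evaluated by rewriting. Its soundness
  needs no metatheory (no injectivity of \<open>Pi\<close>, no subject reduction), because a type is normalised
  by single steps, and the type checker is run again on the result of each step.
\<close>

text \<open>A code of a dependent sum decodes to that sum only up to an identification. Written out,
  a law for ! would therefore compare codes chosen independently of each other, and transports along
  the identifications that come with them. The relation \<open>rep\<close> hides code and
  identification together. Its uniqueness then needs both hypotheses: the embedding identifies codes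
  whose decodings are identified, and univalence identifies decodings that differ by an equivalence.
  The laws are derived for an arbitrary structure carrying such a relation, where nothing about
  codes remains.

  The second obstacle is evaluation: types that mention the concrete operations become large when
  they are normalised. So the operations, and even the predicate of being a monad, enter as bound
  variables with their characteristic properties as hypotheses; the concrete terms are put in
  afterwards by substitution, which normalises nothing. The universe level stays out of the
  computation as well: levels are relative to n, and one run of the checker yields a derivation for
  every n.\<close>

section \<open>Annotated terms\<close>

text \<open>Pairs carry their type, so that every term has an inferable type. \<open>AUniv k\<close> stands for the
  universe \<open>n + k\<close>, where \<open>n\<close> is the level in the theorem.\<close>

datatype atm =
    AVar nat | AUniv nat
  | APi atm atm | ALam atm atm | AApp atm atm
  | ASig atm atm | APair atm atm atm atm | AIndSig atm atm atm
  | ASum atm atm | AEmpty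
  | AOne | AStar | AIndOne atm atm atm
  | AId atm atm atm | ARefl atm | AIndId atm atm atm atm atm
  | AFunext nat

section \<open>Weakening and substitution on annotated terms\<close>

fun lift_var :: "nat \<Rightarrow> nat \<Rightarrow> nat \<Rightarrow> nat" where
  "lift_var 0 k i = i + k"
| "lift_var (Suc c) k 0 = 0"
| "lift_var (Suc c) k (Suc i) = Suc (lift_var c k i)"

primrec lift :: "nat \<Rightarrow> nat \<Rightarrow> atm \<Rightarrow> atm" where
  "lift c k (AVar i) = AVar (lift_var c k i)"
| "lift c k (AUniv i) = AUniv i"
| "lift c k (APi A B) = APi (lift c k A) (lift (Suc c) k B)"
| "lift c k (ALam A b) = ALam (lift c k A) (lift (Suc c) k b)"
| "lift c k (AApp f a) = AApp (lift c k f) (lift c k a)"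
| "lift c k (ASig A B) = ASig (lift c k A) (lift (Suc c) k B)"
| "lift c k (APair A B a b) = APair (lift c k A) (lift (Suc c) k B) (lift c k a) (lift c k b)"
| "lift c k (AIndSig C g p) = AIndSig (lift (Suc c) k C) (lift (Suc (Suc c)) k g) (lift c k p)"
| "lift c k (ASum A B) = ASum (lift c k A) (lift c k B)"
| "lift c k AEmpty = AEmpty"
| "lift c k AOne = AOne"
| "lift c k AStar = AStar"
| "lift c k (AIndOne C g a) = AIndOne (lift (Suc c) k C) (lift c k g) (lift c k a)"
| "lift c k (AId A a b) = AId (lift c k A) (lift c k a) (lift c k b)"
| "lift c k (ARefl a) = ARefl (lift c k a)"
| "lift c k (AIndId C g a b p) =
     AIndId (lift (Suc (Suc (Suc c))) k C) (lift (Suc c) k g) (lift c k a) (lift c k b) (lift c k p)"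
| "lift c k (AFunext i) = AFunext i"

text \<open>\<open>asub c us k\<close> fixes the variables below \<open>c\<close>, replaces the next \<open>length us\<close> ones by \<open>us\<close>, and
  moves the remaining ones to start at \<open>c + k\<close>. The functions of the checker avoid \<open>if\<close> and \<open>case\<close> in
  favour of pattern matching: evaluation by rewriting would traverse the whole context and term again
  after each of them.\<close>

fun sub_lookup :: "nat \<Rightarrow> atm list \<Rightarrow> nat \<Rightarrow> nat \<Rightarrow> atm" where
  "sub_lookup c [] k i = AVar (c + (k + i))"
| "sub_lookup c (u # us) k 0 = lift 0 c u"
| "sub_lookup c (u # us) k (Suc i) = sub_lookup c us k i"

text \<open>The index \<open>i\<close> and the cutoff \<open>c\<close> are counted down together.
  \<open>i0\<close> keeps the original index, returned if the variable turns out to be bound, and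
  \<open>c0\<close> the original cutoff, by which an inserted term must be lifted.\<close>

fun asub_var :: "nat \<Rightarrow> nat \<Rightarrow> nat \<Rightarrow> atm list \<Rightarrow> nat \<Rightarrow> nat \<Rightarrow> atm" where
  "asub_var i0 c0 0 us k i = sub_lookup c0 us k i"
| "asub_var i0 c0 (Suc c) us k 0 = AVar i0"
| "asub_var i0 c0 (Suc c) us k (Suc i) = asub_var i0 c0 c us k i"

primrec asub :: "nat \<Rightarrow> atm list \<Rightarrow> nat \<Rightarrow> atm \<Rightarrow> atm" where
  "asub c us k (AVar i) = asub_var i c c us k i"
| "asub c us k (AUniv i) = AUniv i"
| "asub c us k (APi A B) = APi (asub c us k A) (asub (Suc c) us k B)"
| "asub c us k (ALam A b) = ALam (asub c us k A) (asub (Suc c) us k b)"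
| "asub c us k (AApp f a) = AApp (asub c us k f) (asub c us k a)"
| "asub c us k (ASig A B) = ASig (asub c us k A) (asub (Suc c) us k B)"
| "asub c us k (APair A B a b) = APair (asub c us k A) (asub (Suc c) us k B) (asub c us k a)
  (asub c us k b)"
| "asub c us k (AIndSig C g p) = AIndSig (asub (Suc c) us k C) (asub (Suc (Suc c)) us k g)
  (asub c us k p)"
| "asub c us k (ASum A B) = ASum (asub c us k A) (asub c us k B)"
| "asub c us k AEmpty = AEmpty"
| "asub c us k AOne = AOne"
| "asub c us k AStar = AStar"
| "asub c us k (AIndOne C g a) = AIndOne (asub (Suc c) us k C) (asub c us k g) (asub c us k a)"
| "asub c us k (AId A a b) = AId (asub c us k A) (asub c us k a) (asub c us k b)"
| "asub c us k (ARefl a) = ARefl (asub c us k a)"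
| "asub c us k (AIndId C g a b p) =
     AIndId (asub (Suc (Suc (Suc c))) us k C) (asub (Suc c) us k g) (asub c us k a) (asub c us k b)
       (asub c us k p)"
| "asub c us k (AFunext i) = AFunext i"

section \<open>Reduction and normal forms\<close>

fun is_lam :: "atm \<Rightarrow> bool" where
  "is_lam (ALam A b) = True" | "is_lam _ = False"

fun is_pair :: "atm \<Rightarrow> bool" where
  "is_pair (APair A B a b) = True" | "is_pair _ = False"

fun is_refl :: "atm \<Rightarrow> bool" where
  "is_refl (ARefl a) = True" | "is_refl _ = False"

fun is_star :: "atm \<Rightarrow> bool" where
  "is_star AStar = True" | "is_star _ = False"

fun contract_app :: "atm \<Rightarrow> atm \<Rightarrow> atm \<Rightarrow> atm" where
  "contract_app (ALam A b) a t = asub 0 [a] 0 b" | "contract_app _ a t = t"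

fun contract_sig :: "atm \<Rightarrow> atm \<Rightarrow> atm \<Rightarrow> atm" where
  "contract_sig (APair A B a b) g t = asub 0 [b, a] 0 g" | "contract_sig _ g t = t"

fun contract_if :: "bool \<Rightarrow> atm \<Rightarrow> atm \<Rightarrow> atm" where
  "contract_if True s t = s" | "contract_if False s t = t"

text \<open>All outermost redexes are contracted simultaneously; redexes inside a redex are not.\<close>

primrec step :: "atm \<Rightarrow> atm" where
  "step (AVar i) = AVar i"
| "step (AUniv i) = AUniv i"
| "step (APi A B) = APi (step A) (step B)"
| "step (ALam A b) = ALam (step A) (step b)"
| "step (AApp f a) = contract_app f a (AApp (step f) (step a))"
| "step (ASig A B) = ASig (step A) (step B)"
| "step (APair A B a b) = APair (step A) (step B) (step a) (step b)"
| "step (AIndSig C g p) = contract_sig p g (AIndSig (step C) (step g) (step p))"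
| "step (ASum A B) = ASum (step A) (step B)"
| "step AEmpty = AEmpty"
| "step AOne = AOne"
| "step AStar = AStar"
| "step (AIndOne C g a) = contract_if (is_star a) g (AIndOne (step C) (step g) (step a))"
| "step (AId A a b) = AId (step A) (step a) (step b)"
| "step (ARefl a) = ARefl (step a)"
| "step (AIndId C g a b p) = contract_if (p = ARefl a \<and> b = a) (asub 0 [a] 0 g)
     (AIndId (step C) (step g) (step a) (step b) (step p))"
| "step (AFunext i) = AFunext i"

text \<open>The clause for \<open>AIndId\<close> asks for more than the absence of a redex of
  \<open>step\<close>: an eliminator at a reflexivity whose endpoints do not yet agree syntactically
  is not normal. Stepping then continues inside it until it has the form \<open>a\<close>,
  \<open>a\<close>, \<open>ARefl a\<close> for which the computation rule is stated.\<close>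

primrec normal :: "atm \<Rightarrow> bool" where
  "normal (AVar i) = True"
| "normal (AUniv i) = True"
| "normal (APi A B) = (normal A \<and> normal B)"
| "normal (ALam A b) = (normal A \<and> normal b)"
| "normal (AApp f a) = (\<not> is_lam f \<and> normal f \<and> normal a)"
| "normal (ASig A B) = (normal A \<and> normal B)"
| "normal (APair A B a b) = (normal A \<and> normal B \<and> normal a \<and> normal b)"
| "normal (AIndSig C g p) = (\<not> is_pair p \<and> normal C \<and> normal g \<and> normal p)"
| "normal (ASum A B) = (normal A \<and> normal B)"
| "normal AEmpty = True"
| "normal AOne = True"
| "normal AStar = True"
| "normal (AIndOne C g a) = (\<not> is_star a \<and> normal C \<and> normal g \<and> normal a)"
| "normal (AId A a b) = (normal A \<and> normal a \<and> normal b)"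
| "normal (ARefl a) = normal a"
| "normal (AIndId C g a b p) = (\<not> is_refl p \<and> normal C \<and> normal g \<and> normal a \<and> normal b \<and> normal p)"
| "normal (AFunext i) = True"

section \<open>Shapes and comparison of inferred types\<close>

fun level_of :: "atm option \<Rightarrow> nat option" where
  "level_of (Some (AUniv i)) = Some i" | "level_of _ = None"

fun is_univ :: "atm option \<Rightarrow> bool" where
  "is_univ (Some (AUniv i)) = True" | "is_univ _ = False"

fun pi_of :: "atm option \<Rightarrow> (atm \<times> atm) option" where
  "pi_of (Some (APi A B)) = Some (A, B)" | "pi_of _ = None"

fun sig_of :: "atm option \<Rightarrow> (atm \<times> atm) option" where
  "sig_of (Some (ASig A B)) = Some (A, B)" | "sig_of _ = None"

text \<open>The whole identity type is returned as well, because it is compared with the endpoints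
  recorded in the eliminator, and these have to be normalised first.\<close>

fun id_of :: "atm option \<Rightarrow> (atm \<times> atm) option" where
  "id_of (Some (AId A a b)) = Some (A, AId A a b)" | "id_of _ = None"

fun level_le :: "nat \<Rightarrow> atm \<Rightarrow> bool" where
  "level_le i (AUniv j) = (i \<le> j)" | "level_le i _ = False"

text \<open>Cumulativity is used between universes only, never below \<open>APi\<close> or
  \<open>ASig\<close>. Syntactic equality is enough for other types since both sides are in normal
  form when they are compared.\<close>

fun type_le :: "atm \<Rightarrow> atm \<Rightarrow> bool" where
  "type_le (AUniv i) T = level_le i T"
| "type_le S T = (S = T)"

fun opt_le :: "atm option \<Rightarrow> atm option \<Rightarrow> bool" where
  "opt_le (Some S) (Some T) = type_le S T" | "opt_le _ _ = False"

fun guard :: "bool \<Rightarrow> atm \<Rightarrow> atm option" where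
  "guard True t = Some t" | "guard False t = None"

fun lookup :: "atm list \<Rightarrow> nat \<Rightarrow> atm option" where
  "lookup [] k = None"
| "lookup (T # G) 0 = Some T"
| "lookup (T # G) (Suc k) = lookup G k"

fun lift_opt :: "nat \<Rightarrow> atm option \<Rightarrow> atm option" where
  "lift_opt k (Some T) = Some (lift 0 k T)" | "lift_opt k None = None"

fun max_univ :: "nat option \<Rightarrow> nat option \<Rightarrow> atm option" where
  "max_univ (Some i) (Some j) = Some (AUniv (max i j))" | "max_univ _ _ = None"

fun pi_type :: "atm option \<Rightarrow> atm \<Rightarrow> bool \<Rightarrow> atm option" where
  "pi_type (Some A) B True = Some (APi A B)" | "pi_type _ _ _ = None"

fun sig_type :: "bool \<Rightarrow> atm option \<Rightarrow> atm option \<Rightarrow> atm option \<Rightarrow> atm option" where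
  "sig_type True S (Some A) (Some B) = guard (opt_le S (Some A)) (ASig A B)" | "sig_type _ _ _ _ = None"

fun id_univ :: "nat option \<Rightarrow> bool \<Rightarrow> atm option" where
  "id_univ (Some i) True = Some (AUniv i)" | "id_univ _ _ = None"

fun refl_type :: "atm \<Rightarrow> atm option \<Rightarrow> atm option" where
  "refl_type a (Some A) = Some (AId A a a)" | "refl_type a None = None"

section \<open>Named notation for annotated terms\<close>

type_synonym ahterm = "nat \<Rightarrow> atm"
definition alevel :: "nat \<Rightarrow> ahterm" where "alevel k = (\<lambda>d. AVar (d - Suc k))"
definition abind1 :: "(ahterm \<Rightarrow> ahterm) \<Rightarrow> ahterm" where "abind1 f = (\<lambda>d. f (alevel d) (Suc d))"
definition abind2 :: "(ahterm \<Rightarrow> ahterm \<Rightarrow> ahterm) \<Rightarrow> ahterm" where "abind2 f =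
  (\<lambda>d. f (alevel d) (alevel (Suc d)) (Suc (Suc d)))"
definition abind3 :: "(ahterm \<Rightarrow> ahterm \<Rightarrow> ahterm \<Rightarrow> ahterm) \<Rightarrow> ahterm" where
  "abind3 f = (\<lambda>d. f (alevel d) (alevel (Suc d)) (alevel (Suc (Suc d))) (Suc (Suc (Suc d))))"
definition "a_univ i = (\<lambda>d::nat. AUniv i)"
definition "a_pi A B = (\<lambda>d. APi (A d) (abind1 B d))"
definition "a_lam A B = (\<lambda>d. ALam (A d) (abind1 B d))"
definition a_app (infixl "\<bullet>" 90) where "f \<bullet> a = (\<lambda>d::nat. AApp (f d) (a d))"
definition "a_sig A B = (\<lambda>d. ASig (A d) (abind1 B d))"
definition "a_pair A B a b = (\<lambda>d. APair (A d) (abind1 B d) (a d) (b d))"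
definition "a_ind_sig C g p = (\<lambda>d. AIndSig (abind1 C d) (abind2 g d) (p d))"
definition "a_one = (\<lambda>d::nat. AOne)"
definition "a_star = (\<lambda>d::nat. AStar)"
definition "a_ind_one C g p = (\<lambda>d::nat. AIndOne (abind1 C d) (g d) (p d))"
definition "a_id A a b = (\<lambda>d::nat. AId (A d) (a d) (b d))"
definition "a_refl a = (\<lambda>d::nat. ARefl (a d))"
definition "a_ind_id C c a b p = (\<lambda>d. AIndId (abind3 C d) (abind1 c d) (a d) (b d) (p d))"
definition "a_funext i = (\<lambda>d::nat. AFunext i)"
definition a_arr  (infixr "\<mapsto>" 60) where
  "A \<mapsto> B = a_pi A (\<lambda>_. B)"
definition a_prod (infixr "\<odot>" 70) where
  "A \<odot> B = a_sig A (\<lambda>_. B)"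

definition "a_is_equiv A B f =
     a_sig (B \<mapsto> A) (\<lambda>g. a_pi B (\<lambda>y. a_id B (f \<bullet> (g \<bullet> y)) y)) \<odot>
     a_sig (B \<mapsto> A) (\<lambda>h. a_pi A (\<lambda>x. a_id A (h \<bullet> (f \<bullet> x)) x))"
definition "a_happly A B f g p = a_ind_id (\<lambda>f g _. a_pi A (\<lambda>x. a_id (B x) (f \<bullet> x) (g \<bullet> x)))
     (\<lambda>f. a_lam A (\<lambda>x. a_refl (f \<bullet> x))) f g p"
definition "a_funext_type i = a_pi (a_univ i) (\<lambda>A. a_pi (A \<mapsto> a_univ i) (\<lambda>B.
     a_pi (a_pi A (\<lambda>x. B \<bullet> x)) (\<lambda>f. a_pi (a_pi A (\<lambda>x. B \<bullet> x)) (\<lambda>g.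
       a_is_equiv (a_id (a_pi A (\<lambda>x. B \<bullet> x)) f g) (a_pi A (\<lambda>x. a_id (B \<bullet> x) (f \<bullet> x) (g \<bullet> x)))
         (a_lam (a_id (a_pi A (\<lambda>x. B \<bullet> x)) f g) (\<lambda>p. a_happly A (\<lambda>x. B \<bullet> x) f g p))))))"

section \<open>The type checker\<close>

text \<open>Inferred types are normal. \<open>ty\<close> and \<open>nf\<close> are inference and normalisation with less fuel.\<close>

type_synonym typer = "atm list \<Rightarrow> atm \<Rightarrow> atm option"
type_synonym normer = "atm list \<Rightarrow> atm option \<Rightarrow> atm option"

text \<open>A domain in normal form can stay in the product type as it is. Otherwise it is replaced
  by its normal form, and the congruence rule that justifies this asks for a universe containing the
  codomain.\<close>

fun infer_lam :: "typer \<Rightarrow> normer \<Rightarrow> atm list \<Rightarrow> atm \<Rightarrow> bool \<Rightarrow> atm option \<Rightarrow> bool \<Rightarrow> atm option" where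
  "infer_lam ty nf G A u None n = None"
| "infer_lam ty nf G A False (Some B) n = None"
| "infer_lam ty nf G A True (Some B) True = Some (APi A B)"
| "infer_lam ty nf G A True (Some B) False = pi_type (nf G (Some A)) B (is_univ (ty (A # G) B))"

fun infer_app :: "typer \<Rightarrow> normer \<Rightarrow> atm list \<Rightarrow> atm \<Rightarrow> (atm \<times> atm) option \<Rightarrow> atm option" where
  "infer_app ty nf G a None = None"
| "infer_app ty nf G a (Some (A, B)) = nf G (guard (opt_le (ty G a) (Some A)) (asub 0 [a] 0 B))"

fun infer_ind_sig :: "typer \<Rightarrow> normer \<Rightarrow> atm list \<Rightarrow> atm \<Rightarrow> atm \<Rightarrow> atm \<Rightarrow> (atm \<times> atm) option \<Rightarrow> atm option"
  where
  "infer_ind_sig ty nf G C g p None = None"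
| "infer_ind_sig ty nf G C g p (Some (A, B)) = nf G (guard
     (is_univ (ty G A) \<and> is_univ (ty (A # G) B) \<and> is_univ (ty (ASig A B # G) C) \<and>
       opt_le (ty (B # A # G) g)
         (nf (B # A # G) (Some (asub 0 [APair (lift 0 2 A) (lift 1 2 B) (AVar 1) (AVar 0)] 2 C))))
     (asub 0 [p] 0 C))"

fun infer_ind_id :: "typer \<Rightarrow> normer \<Rightarrow> atm list \<Rightarrow> atm \<Rightarrow> atm \<Rightarrow> atm \<Rightarrow> atm \<Rightarrow> atm \<Rightarrow> (atm \<times> atm) option \<Rightarrow>
  atm option" where
  "infer_ind_id ty nf G C c a b p None = None"
| "infer_ind_id ty nf G C c a b p (Some (A, P)) = nf G (guard
     (is_univ (ty G A) \<and> opt_le (ty G a) (Some A) \<and> opt_le (ty G b) (Some A) \<and>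
       opt_le (Some P) (nf G (Some (AId A a b))) \<and>
       is_univ (ty (AId (lift 0 2 A) (AVar 1) (AVar 0) # lift 0 1 A # A # G) C) \<and>
       opt_le (ty (A # G) c) (nf (A # G) (Some (asub 0 [ARefl (AVar 0), AVar 0, AVar 0] 1 C))))
     (asub 0 [p, b, a] 0 C))"

primrec infer_with :: "typer \<Rightarrow> normer \<Rightarrow> atm list \<Rightarrow> atm \<Rightarrow> atm option" where
  "infer_with ty nf G (AVar k) = nf G (lift_opt (Suc k) (lookup G k))"
| "infer_with ty nf G (AUniv i) = Some (AUniv (Suc i))"
| "infer_with ty nf G (APi A B) = max_univ (level_of (ty G A)) (level_of (ty (A # G) B))"
| "infer_with ty nf G (ALam A b) = infer_lam ty nf G A (is_univ (ty G A)) (ty (A # G) b) (normal A)"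
| "infer_with ty nf G (AApp f a) = infer_app ty nf G a (pi_of (ty G f))"
| "infer_with ty nf G (ASig A B) = max_univ (level_of (ty G A)) (level_of (ty (A # G) B))"
| "infer_with ty nf G (APair A B a b) = sig_type
     (is_univ (ty G A) \<and> is_univ (ty (A # G) B) \<and>
       opt_le (ty G b) (nf G (Some (asub 0 [a] 0 B))))
     (ty G a) (nf G (Some A)) (nf (A # G) (Some B))"
| "infer_with ty nf G (AIndSig C g p) = infer_ind_sig ty nf G C g p (sig_of (ty G p))"
| "infer_with ty nf G (ASum A B) = max_univ (level_of (ty G A)) (level_of (ty G B))"
| "infer_with ty nf G AEmpty = Some (AUniv 0)"
| "infer_with ty nf G AOne = Some (AUniv 0)"
| "infer_with ty nf G AStar = Some AOne"
| "infer_with ty nf G (AIndOne C g a) = nf G (guard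
     (opt_le (ty G a) (Some AOne) \<and> is_univ (ty (AOne # G) C) \<and>
       opt_le (ty G g) (nf G (Some (asub 0 [AStar] 0 C))))
     (asub 0 [a] 0 C))"
| "infer_with ty nf G (AId A a b) = id_univ (level_of (ty G A))
     (opt_le (ty G a) (nf G (Some A)) \<and> opt_le (ty G b) (nf G (Some A)))"
| "infer_with ty nf G (ARefl a) = nf G (refl_type a (ty G a))"
| "infer_with ty nf G (AIndId C c a b p) = infer_ind_id ty nf G C c a b p (id_of (ty G p))"
| "infer_with ty nf G (AFunext i) = nf G (Some (a_funext_type i 0))"

fun norm_step :: "typer \<Rightarrow> normer \<Rightarrow> atm list \<Rightarrow> atm \<Rightarrow> bool \<Rightarrow> atm option" where
  "norm_step ty nf G T True = Some T"
| "norm_step ty nf G T False = nf G (guard (is_univ (ty G T)) (step T))"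

fun norm_with :: "typer \<Rightarrow> normer \<Rightarrow> atm list \<Rightarrow> atm option \<Rightarrow> atm option" where
  "norm_with ty nf G None = None"
| "norm_with ty nf G (Some T) = norm_step ty nf G T (normal T)"

text \<open>Inference normalises types and normalisation infers them again, so termination would be
  a theorem about the object theory. Fuel takes its place; running out of it yields
  \<open>None\<close>, which cannot harm soundness.\<close>

fun infer :: "nat \<Rightarrow> typer" and norm :: "nat \<Rightarrow> normer" where
  "infer 0 G t = None"
| "infer (Suc m) G t = infer_with (infer m) (norm m) G t"
| "norm 0 G T = None"
| "norm (Suc m) G T = norm_with (infer m) (norm m) G T"

definition check :: "nat \<Rightarrow> atm list \<Rightarrow> atm \<Rightarrow> atm \<Rightarrow> bool" where
  "check m G t T = (is_univ (infer m G T) \<and> opt_le (infer m G t) (norm m G (Some T)))"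

section \<open>Soundness of the checker\<close>

text \<open>The base level \<open>n\<close> enters only here, so a run of the checker does not
  depend on it.\<close>

primrec erase :: "nat \<Rightarrow> atm \<Rightarrow> tm" where
  "erase n (AVar i) = Var i"
| "erase n (AUniv i) = Univ (n + i)"
| "erase n (APi A B) = Pi (erase n A) (erase n B)"
| "erase n (ALam A b) = Lam (erase n A) (erase n b)"
| "erase n (AApp f a) = App (erase n f) (erase n a)"
| "erase n (ASig A B) = Sig (erase n A) (erase n B)"
| "erase n (APair A B a b) = Pair (erase n a) (erase n b)"
| "erase n (AIndSig C g p) = IndSig (erase n C) (erase n g) (erase n p)"
| "erase n (ASum A B) = Sum (erase n A) (erase n B)"
| "erase n AEmpty = Empty"
| "erase n AOne = One"
| "erase n AStar = Star"
| "erase n (AIndOne C g a) = IndOne (erase n C) (erase n g) (erase n a)"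
| "erase n (AId A a b) = Id (erase n A) (erase n a) (erase n b)"
| "erase n (ARefl a) = Refl (erase n a)"
| "erase n (AIndId C g a b p) = IndId (erase n C) (erase n g) (erase n a) (erase n b) (erase n p)"
| "erase n (AFunext i) = Funext (n + i)"

section \<open>Erasure commutes with weakening and substitution\<close>

lemma upr_comp: "upr (\<lambda>i. s (r i)) = (\<lambda>i. upr s (upr r i))"
  by (auto simp: upr_def fun_eq_iff split: nat.splits)

lemma upr_id: "upr (\<lambda>i. i) = (\<lambda>i. i)"
  by (auto simp: upr_def fun_eq_iff split: nat.splits)

lemma ren_ren: "ren (ren t r) s = ren t (\<lambda>i. s (r i))"
  by (induction t arbitrary: r s) (simp_all add: upr_comp)

lemma ren_id: "ren t (\<lambda>i. i) = t"
  by (induction t) (simp_all add: upr_id)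

lemma upr_lift_var: "upr (lift_var c k) = lift_var (Suc c) k"
  by (auto simp: upr_def fun_eq_iff split: nat.splits)

lemma erase_lift: "erase n (lift c k t) = ren (erase n t) (lift_var c k)"
  by (induction t arbitrary: c) (simp_all add: upr_lift_var)

lemma lift_var_0: "lift_var 0 k = (\<lambda>i. i + k)"
  by (simp add: fun_eq_iff)

lemma erase_lift_0: "erase n (lift 0 k t) = ren (erase n t) (\<lambda>i. i + k)"
  by (simp add: erase_lift lift_var_0)

lemma erase_sub_lookup_Suc: "erase n (sub_lookup (Suc c) us k i) = shift (erase n (sub_lookup c us k i))"
  by (induction c us k i rule: sub_lookup.induct) (simp_all add: erase_lift_0 ren_ren)

lemma erase_asub_var_Suc: "erase n (asub_var (Suc i0) (Suc c0) c us k i) = shift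
  (erase n (asub_var i0 c0 c us k i))"
  by (induction i0 c0 c us k i rule: asub_var.induct) (simp_all add: erase_sub_lookup_Suc)

text \<open>The raw substitution that \<open>asub\<close> performs. With this description, passing a
  binder amounts to replacing \<open>c\<close> by \<open>Suc c\<close>.\<close>

definition asub_map :: "nat \<Rightarrow> nat \<Rightarrow> atm list \<Rightarrow> nat \<Rightarrow> nat \<Rightarrow> tm" where
  "asub_map n c us k i = erase n (asub_var i c c us k i)"

lemma ups_asub_map: "ups (asub_map n c us k) = asub_map n (Suc c) us k"
  by (auto simp: ups_def asub_map_def fun_eq_iff erase_asub_var_Suc split: nat.splits)

lemma erase_asub: "erase n (asub c us k t) = sub (erase n t) (asub_map n c us k)"
  by (induction t arbitrary: c) (simp_all add: ups_asub_map, simp add: asub_map_def)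

lemma asub_map_Nil: "asub_map n 0 [] k = (\<lambda>i. Var (i + k))"
  by (simp add: asub_map_def fun_eq_iff)

lemma asub_map_Cons: "asub_map n 0 (u # us) k = case_nat (erase n u) (asub_map n 0 us k)"
  by (auto simp: asub_map_def fun_eq_iff erase_lift_0 ren_id split: nat.splits)

lemmas erase_subst = erase_asub asub_map_Nil asub_map_Cons

section \<open>Type equality and typed reduction\<close>

lemma Univ_cumul:
  assumes "\<Gamma> \<turnstile> A \<Colon> Univ i" "i \<le> j"
  shows "\<Gamma> \<turnstile> A \<Colon> Univ j"
  using assms(2,1) by (induction rule: dec_induct) (auto intro: U_cumul)

lemma Univ_cumul_eq:
  assumes "\<Gamma> \<turnstile> A \<equiv> B \<Colon> Univ i" "i \<le> j"
  shows "\<Gamma> \<turnstile> A \<equiv> B \<Colon> Univ j"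
  using assms(2,1) by (induction rule: dec_induct) (auto intro: U_cumul_eq)

text \<open>The first alternative covers types which the checker returns without inferring their universe.\<close>

definition tyeq :: "tm list \<Rightarrow> tm \<Rightarrow> tm \<Rightarrow> bool" where
  "tyeq \<Gamma> A B \<longleftrightarrow> A = B \<or> (\<exists>i. \<Gamma> \<turnstile> A \<equiv> B \<Colon> Univ i)"

lemma tyeq_refl: "tyeq \<Gamma> A A"
  by (simp add: tyeq_def)

lemma tyeq_sym: "tyeq \<Gamma> A B \<Longrightarrow> tyeq \<Gamma> B A"
  by (auto simp: tyeq_def intro: eq_sym)

text \<open>The two equalities may hold in different universes; cumulativity raises the lower
  one.\<close>

lemma tyeq_trans: "tyeq \<Gamma> A B \<Longrightarrow> tyeq \<Gamma> B C \<Longrightarrow> tyeq \<Gamma> A C"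
  unfolding tyeq_def by (metis Univ_cumul_eq eq_trans nat_le_linear)

definition typed_step :: "tm list \<Rightarrow> tm \<Rightarrow> tm \<Rightarrow> tm \<Rightarrow> bool" where
  "typed_step \<Gamma> t t' T \<longleftrightarrow> \<Gamma> \<turnstile> t \<Colon> T \<and> \<Gamma> \<turnstile> t \<equiv> t' \<Colon> T"

lemma typed_step_type: "typed_step \<Gamma> t t' T \<Longrightarrow> \<Gamma> \<turnstile> t \<Colon> T"
  and typed_step_eq: "typed_step \<Gamma> t t' T \<Longrightarrow> \<Gamma> \<turnstile> t \<equiv> t' \<Colon> T"
  by (simp_all add: typed_step_def)

lemma typed_step_conv:
  assumes "typed_step \<Gamma> t t' S" "tyeq \<Gamma> S T"
  shows "typed_step \<Gamma> t t' T"
  using assms unfolding typed_step_def tyeq_def by (metis conv conv_eq)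

lemma typed_step_cumul: "typed_step \<Gamma> t t' (Univ i) \<Longrightarrow> i \<le> j \<Longrightarrow> typed_step \<Gamma> t t' (Univ j)"
  unfolding typed_step_def by (metis Univ_cumul Univ_cumul_eq)

lemma typed_step_refl: "\<Gamma> \<turnstile> t \<Colon> T \<Longrightarrow> typed_step \<Gamma> t t T"
  by (simp add: typed_step_def eq_refl)

abbreviation erase_ctx :: "nat \<Rightarrow> atm list \<Rightarrow> tm list" where
  "erase_ctx n G \<equiv> map (erase n) G"

text \<open>What is needed to contract a redex: the types of the components of a canonical form.\<close>

definition comp_type :: "nat \<Rightarrow> atm list \<Rightarrow> atm \<Rightarrow> atm \<Rightarrow> bool" where
  "comp_type n G t T \<longleftrightarrow>
     (\<forall>A b. t = ALam A b \<longrightarrow> (\<exists>A' B. T = APi A' B \<and> tyeq (erase_ctx n G) (erase n A) (erase n A') \<and>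
        erase n A # erase_ctx n G \<turnstile> erase n b \<Colon> erase n B)) \<and>
     (\<forall>A B a b. t = APair A B a b \<longrightarrow> (\<exists>A' B'. T = ASig A' B' \<and> erase_ctx n G \<turnstile> erase n a \<Colon> erase n A' \<and>
        erase_ctx n G \<turnstile> erase n b \<Colon> inst (erase n B') (erase n a)))"

text \<open>Typing and conversion to the reduct are established in one induction: the premises of a
  computation rule are the typings of the parts of the redex, and these are at hand only during
  inference.\<close>

definition typer_sound :: "nat \<Rightarrow> typer \<Rightarrow> bool" where
  "typer_sound n ty \<longleftrightarrow> (\<forall>G t T. ctx (erase_ctx n G) \<longrightarrow> ty G t = Some T \<longrightarrow>
     typed_step (erase_ctx n G) (erase n t) (erase n (step t)) (erase n T) \<and> comp_type n G t T)"

definition normer_sound :: "nat \<Rightarrow> normer \<Rightarrow> bool" where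
  "normer_sound n nf \<longleftrightarrow> (\<forall>G. nf G None = None) \<and>
     (\<forall>G T T'. ctx (erase_ctx n G) \<longrightarrow> nf G (Some T) = Some T' \<longrightarrow> tyeq (erase_ctx n G) (erase n T)
       (erase n T'))"

lemma type_le_typed_step:
  assumes "typed_step \<Gamma> t t' (erase n S)" "type_le S T"
  shows "typed_step \<Gamma> t t' (erase n T)"
proof (cases "S = T")
  case False
  then obtain i where S: "S = AUniv i" using assms(2) by (cases S) auto
  moreover from this assms(2) obtain j where "T = AUniv j" "i \<le> j" by (cases T) auto
  ultimately show ?thesis using assms(1) by (auto intro: typed_step_cumul)
qed (use assms in simp)

section \<open>Inversion of the auxiliary functions\<close>

lemma is_univ_iff: "is_univ S \<longleftrightarrow> (\<exists>i. S = Some (AUniv i))"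
  by (cases S rule: is_univ.cases) auto

lemma level_of_eq: "level_of S = Some i \<longleftrightarrow> S = Some (AUniv i)"
  by (cases S rule: level_of.cases) auto

lemma pi_of_eq: "pi_of S = Some (A, B) \<longleftrightarrow> S = Some (APi A B)"
  by (cases S rule: pi_of.cases) auto

lemma sig_of_eq: "sig_of S = Some (A, B) \<longleftrightarrow> S = Some (ASig A B)"
  by (cases S rule: sig_of.cases) auto

lemma id_of_eq: "id_of S = Some (A, P) \<longleftrightarrow> (\<exists>a b. P = AId A a b \<and> S = Some P)"
  by (cases S rule: id_of.cases) auto

lemma opt_le_eq: "opt_le S T \<longleftrightarrow> (\<exists>S' T'. S = Some S' \<and> T = Some T' \<and> type_le S' T')"
  by (cases "(S, T)" rule: opt_le.cases) auto

lemma guard_eq: "guard b t = Some T \<longleftrightarrow> b \<and> T = t"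
  by (cases b) auto

lemma max_univ_eq: "max_univ i j = Some T \<longleftrightarrow> (\<exists>i' j'. i = Some i' \<and> j = Some j' \<and> T = AUniv (max i' j'))"
  by (cases "(i, j)" rule: max_univ.cases) auto

lemma id_univ_eq: "id_univ i b = Some T \<longleftrightarrow> (\<exists>i'. i = Some i' \<and> b \<and> T = AUniv i')"
  by (cases "(i, b)" rule: id_univ.cases) auto

lemma pi_type_eq: "pi_type S B b = Some T \<longleftrightarrow> (\<exists>A. S = Some A \<and> b \<and> T = APi A B)"
  by (cases "(S, B, b)" rule: pi_type.cases) auto

lemma sig_type_eq: "sig_type b S A B = Some T \<longleftrightarrow>
    (\<exists>A' B'. b \<and> A = Some A' \<and> B = Some B' \<and> opt_le S (Some A') \<and> T = ASig A' B')"
  by (cases "(b, S, A, B)" rule: sig_type.cases) (auto simp: guard_eq)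

lemma refl_type_eq: "refl_type a S = Some T \<longleftrightarrow> (\<exists>A. S = Some A \<and> T = AId A a a)"
  by (cases S) auto

lemma lookup_eq: "lookup G k = Some T \<longleftrightarrow> k < length G \<and> T = G ! k"
  by (induction G k rule: lookup.induct) auto

lemma lift_opt_eq: "lift_opt k S = Some T \<longleftrightarrow> (\<exists>S'. S = Some S' \<and> T = lift 0 k S')"
  by (cases S) auto

lemma contract_if_eq: "contract_if b s t = (if b then s else t)"
  by simp

lemma is_star_iff: "is_star a \<longleftrightarrow> a = AStar"
  by (cases a) auto

lemma typer_soundD:
  assumes "typer_sound n ty" "ctx (erase_ctx n G)" "ty G t = Some T"
  shows "typed_step (erase_ctx n G) (erase n t) (erase n (step t)) (erase n T)" "comp_type n G t T"
  using assms by (auto simp: typer_sound_def)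

lemma typer_sound_univ:
  assumes "typer_sound n ty" "ctx (erase_ctx n G)" "is_univ (ty G A)"
  obtains i where "typed_step (erase_ctx n G) (erase n A) (erase n (step A)) (Univ i)" "ctx
    (erase_ctx n (A # G))"
  using assms typer_soundD(1)[OF assms(1,2)] unfolding is_univ_iff
  by (metis ctx_ext erase.simps(2) list.simps(9) typed_step_type)

lemma typer_sound_opt_le:
  assumes "typer_sound n ty" "ctx (erase_ctx n G)" "opt_le (ty G t) (Some T)"
  shows "typed_step (erase_ctx n G) (erase n t) (erase n (step t)) (erase n T)"
  using assms unfolding opt_le_eq by (auto intro: type_le_typed_step typer_soundD(1))

lemma normer_soundD:
  assumes "normer_sound n nf" "ctx (erase_ctx n G)" "nf G S = Some T'"
  obtains T where "S = Some T" "tyeq (erase_ctx n G) (erase n T) (erase n T')"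
  using assms by (cases S) (auto simp: normer_sound_def)

text \<open>The expected type is normalised only for the comparison; symmetry of \<open>tyeq\<close>
  leads back from the normal form to \<open>T\<close> itself.\<close>

lemma typer_normer_sound_opt_le:
  assumes "typer_sound n ty" "normer_sound n nf" "ctx (erase_ctx n G)" "opt_le (ty G t) (nf G (Some T))"
  shows "typed_step (erase_ctx n G) (erase n t) (erase n (step t)) (erase n T)"
proof -
  from assms(4) obtain T' where T': "nf G (Some T) = Some T'"
    unfolding opt_le_eq by auto
  with assms(4) have "typed_step (erase_ctx n G) (erase n t) (erase n (step t)) (erase n T')"
    by (intro typer_sound_opt_le[OF assms(1,3)]) simp
  moreover have "tyeq (erase_ctx n G) (erase n T) (erase n T')"
    using normer_soundD[OF assms(2,3) T'] by simp
  ultimately show ?thesis by (blast intro: typed_step_conv tyeq_sym)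
qed

lemma comp_type_trivial: "(\<forall>A b. t \<noteq> ALam A b) \<Longrightarrow> (\<forall>A B a b. t \<noteq> APair A B a b) \<Longrightarrow> comp_type n G t T"
  by (simp add: comp_type_def)

text \<open>Ties the annotated copy of the type of the axiom, which the checker returns, to the rule
  \<open>funext\<close>.\<close>

lemma erase_funext: "erase n (a_funext_type i 0) = funext_type (n + i) 0"
  by (simp add: a_funext_type_def a_pi_def abind1_def alevel_def a_univ_def a_arr_def a_app_def
    a_is_equiv_def a_prod_def a_sig_def a_id_def a_lam_def a_happly_def a_ind_id_def abind3_def
    a_refl_def funext_type_def pi_def bind1_def level_def \<U>_def arr_def app_def is_equiv_def
    prod_type_def sig_def ident_def lam_def happly_def ind_id_def bind3_def rfl_def)

section \<open>Congruences at differing universe levels\<close>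

lemma typed_step_Pi:
  assumes "typed_step \<Gamma> A A' (Univ i)" "typed_step (A # \<Gamma>) B B' (Univ j)"
  shows "typed_step \<Gamma> (Pi A B) (Pi A' B') (Univ (max i j))"
  using typed_step_cumul[OF assms(1), of "max i j"] typed_step_cumul[OF assms(2), of "max i j"]
  by (auto simp: typed_step_def intro: Pi_form Pi_form_eq)

lemma typed_step_Sig:
  assumes "typed_step \<Gamma> A A' (Univ i)" "typed_step (A # \<Gamma>) B B' (Univ j)"
  shows "typed_step \<Gamma> (Sig A B) (Sig A' B') (Univ (max i j))"
  using typed_step_cumul[OF assms(1), of "max i j"] typed_step_cumul[OF assms(2), of "max i j"]
  by (auto simp: typed_step_def intro: Sig_form Sig_form_eq)

lemma typed_step_Sum:
  assumes "typed_step \<Gamma> A A' (Univ i)" "typed_step \<Gamma> B B' (Univ j)"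
  shows "typed_step \<Gamma> (Sum A B) (Sum A' B') (Univ (max i j))"
  using typed_step_cumul[OF assms(1), of "max i j"] typed_step_cumul[OF assms(2), of "max i j"]
  by (auto simp: typed_step_def intro: Sum_form Sum_form_eq)

lemma tyeq_type:
  assumes "tyeq \<Gamma> A B" "\<Gamma> \<turnstile> A \<Colon> Univ i"
  obtains j where "\<Gamma> \<turnstile> A \<equiv> B \<Colon> Univ j"
  using assms unfolding tyeq_def by (metis eq_refl)

lemma tyeq_Pi:
  assumes "tyeq \<Gamma> A A'" "\<Gamma> \<turnstile> A \<Colon> Univ i" "A # \<Gamma> \<turnstile> B \<Colon> Univ j"
  shows "tyeq \<Gamma> (Pi A B) (Pi A' B)"
proof -
  obtain k where "\<Gamma> \<turnstile> A \<equiv> A' \<Colon> Univ k" using tyeq_type[OF assms(1,2)] .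
  then have "\<Gamma> \<turnstile> Pi A B \<equiv> Pi A' B \<Colon> Univ (max k j)"
    using assms(3) by (intro Pi_form_eq) (auto intro: Univ_cumul_eq eq_refl)
  then show ?thesis by (auto simp: tyeq_def)
qed

lemma tyeq_Sig:
  assumes "tyeq \<Gamma> A A'" "\<Gamma> \<turnstile> A \<Colon> Univ i" "tyeq (A # \<Gamma>) B B'" "A # \<Gamma> \<turnstile> B \<Colon> Univ j"
  shows "tyeq \<Gamma> (Sig A B) (Sig A' B')"
proof -
  obtain k where k: "\<Gamma> \<turnstile> A \<equiv> A' \<Colon> Univ k" using tyeq_type[OF assms(1,2)] .
  obtain l where l: "A # \<Gamma> \<turnstile> B \<equiv> B' \<Colon> Univ l" using tyeq_type[OF assms(3,4)] .
  have "\<Gamma> \<turnstile> Sig A B \<equiv> Sig A' B' \<Colon> Univ (max k l)"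
    using k l by (intro Sig_form_eq) (auto intro: Univ_cumul_eq)
  then show ?thesis by (auto simp: tyeq_def)
qed

lemma tyeq_inst:
  assumes "tyeq (A # \<Gamma>) B B'" "\<Gamma> \<turnstile> a \<Colon> A"
  shows "tyeq \<Gamma> (inst B a) (inst B' a)"
  using assms unfolding tyeq_def by (metis subst_eq sub.simps(2))

lemmas infer_eqs = max_univ_eq level_of_eq pi_of_eq sig_of_eq id_of_eq guard_eq id_univ_eq pi_type_eq
  sig_type_eq refl_type_eq

section \<open>Soundness of the inference rules\<close>

lemma infer_var_sound:
  assumes "normer_sound n nf" "ctx (erase_ctx n G)" "nf G (lift_opt (Suc k) (lookup G k)) = Some T"
  shows "typed_step (erase_ctx n G) (Var k) (Var k) (erase n T)"
proof -
  obtain S where S: "lift_opt (Suc k) (lookup G k) = Some S" "tyeq (erase_ctx n G) (erase n S)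
    (erase n T)"
    using normer_soundD[OF assms] .
  then have k: "k < length G" "S = lift 0 (Suc k) (G ! k)"
    by (auto simp: lift_opt_eq lookup_eq)
  have "erase_ctx n G \<turnstile> Var k \<Colon> ren (erase_ctx n G ! k) (\<lambda>i. i + Suc k)"
    using assms(2) k(1) by (intro vble) auto
  then have "erase_ctx n G \<turnstile> Var k \<Colon> erase n S"
    using k by (simp only: erase_lift_0 nth_map)
  then show ?thesis using S(2) by (blast intro: typed_step_refl typed_step_conv)
qed

lemma infer_lam_sound:
  assumes "typer_sound n ty" "normer_sound n nf" "ctx (erase_ctx n G)"
    and "infer_lam ty nf G A (is_univ (ty G A)) (ty (A # G) b) (normal A) = Some T"
  shows "typed_step (erase_ctx n G) (Lam (erase n A) (erase n b))
    (Lam (erase n (step A)) (erase n (step b))) (erase n T) \<and> comp_type n G (ALam A b) T"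
proof -
  obtain B where u: "is_univ (ty G A)" and B: "ty (A # G) b = Some B"
    using assms(4) by (cases "is_univ (ty G A)"; cases "ty (A # G) b") auto
  obtain i where A: "typed_step (erase_ctx n G) (erase n A) (erase n (step A)) (Univ i)" and c: "ctx
    (erase_ctx n (A # G))"
    using typer_sound_univ[OF assms(1,3) u] .
  have b: "typed_step (erase n A # erase_ctx n G) (erase n b) (erase n (step b)) (erase n B)"
    using typer_soundD(1)[OF assms(1) c B] by simp
  have l: "typed_step (erase_ctx n G) (Lam (erase n A) (erase n b))
    (Lam (erase n (step A)) (erase n (step b))) (Pi (erase n A) (erase n B))"
    using A b by (auto simp: typed_step_def intro: Pi_intro Pi_intro_eq)
  show ?thesis
  proof (cases "normal A")
    case True
    then have "T = APi A B" using assms(4) u B by simp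
    then show ?thesis using l b by (auto simp: comp_type_def tyeq_refl typed_step_def)
  next
    case False
    then obtain A' where A': "nf G (Some A) = Some A'" and v: "is_univ (ty (A # G) B)" and T: "T = APi
      A' B"
      using assms(4) u B by (auto simp: infer_eqs)
    have e: "tyeq (erase_ctx n G) (erase n A) (erase n A')"
      using normer_soundD[OF assms(2,3) A'] by auto
    obtain j where "typed_step (erase_ctx n (A # G)) (erase n B) (erase n (step B)) (Univ j)"
      using typer_sound_univ[OF assms(1) c v] .
    then have "tyeq (erase_ctx n G) (Pi (erase n A) (erase n B)) (Pi (erase n A') (erase n B))"
      using A by (intro tyeq_Pi[OF e]) (auto dest: typed_step_type)
    then show ?thesis using l b e T by (auto simp: comp_type_def typed_step_def[of "erase n A # _"]
      intro: typed_step_conv)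
  qed
qed

lemma infer_app_sound:
  assumes "typer_sound n ty" "normer_sound n nf" "ctx (erase_ctx n G)"
    and "infer_app ty nf G a (pi_of (ty G f)) = Some T"
  shows "typed_step (erase_ctx n G) (App (erase n f) (erase n a)) (erase n (step (AApp f a)))
    (erase n T)"
proof -
  obtain A B where AB: "pi_of (ty G f) = Some (A, B)"
    using assms(4) by (cases "pi_of (ty G f)") auto
  then have P: "ty G f = Some (APi A B)" by (simp add: pi_of_eq)
  have nf: "nf G (guard (opt_le (ty G a) (Some A)) (asub 0 [a] 0 B)) = Some T"
    using assms(4) AB by simp
  obtain S where S: "guard (opt_le (ty G a) (Some A)) (asub 0 [a] 0 B) = Some S"
      "tyeq (erase_ctx n G) (erase n S) (erase n T)"
    using normer_soundD[OF assms(2,3) nf] .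
  have a: "typed_step (erase_ctx n G) (erase n a) (erase n (step a)) (erase n A)"
    using S by (intro typer_sound_opt_le[OF assms(1,3)]) (simp add: guard_eq)
  have f: "typed_step (erase_ctx n G) (erase n f) (erase n (step f)) (Pi (erase n A) (erase n B))"
    and ct: "comp_type n G f (APi A B)"
    using typer_soundD[OF assms(1,3) P] by simp_all
  have e: "tyeq (erase_ctx n G) (inst (erase n B) (erase n a)) (erase n T)"
    using S by (auto simp: guard_eq erase_subst)
  have app: "erase_ctx n G \<turnstile> App (erase n f) (erase n a) \<Colon> inst (erase n B) (erase n a)"
    using f a by (auto simp: typed_step_def intro: Pi_elim)
  have "typed_step (erase_ctx n G) (App (erase n f) (erase n a)) (erase n (step (AApp f a)))
    (inst (erase n B) (erase n a))"
  proof (cases "\<exists>A0 b. f = ALam A0 b")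
    case True
    then obtain A0 b where fl: "f = ALam A0 b" by blast
    with ct have b: "erase n A0 # erase_ctx n G \<turnstile> erase n b \<Colon> erase n B" and A0: "tyeq (erase_ctx n G)
      (erase n A0) (erase n A)"
      by (auto simp: comp_type_def)
    \<comment> \<open>The computation rule takes the domain from the context of the body. That is
      the annotation \<open>A0\<close>, whereas the argument was checked against its normal form
      \<open>A\<close>.\<close>
    have "erase_ctx n G \<turnstile> erase n a \<Colon> erase n A0"
      using typed_step_conv[OF a tyeq_sym[OF A0]] by (rule typed_step_type)
    from Pi_comp[OF b this] show ?thesis
      using app fl by (simp add: typed_step_def erase_subst)
  next
    case False
    then have "step (AApp f a) = AApp (step f) (step a)" by (cases f) auto
    then show ?thesis using f a app by (auto simp: typed_step_def intro: Pi_elim_eq)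
  qed
  then show ?thesis using e by (rule typed_step_conv)
qed

lemma infer_pair_sound:
  assumes "typer_sound n ty" "normer_sound n nf" "ctx (erase_ctx n G)"
    and "infer_with ty nf G (APair A B a b) = Some T"
  shows "typed_step (erase_ctx n G) (Pair (erase n a) (erase n b))
    (Pair (erase n (step a)) (erase n (step b))) (erase n T) \<and> comp_type n G (APair A B a b) T"
proof -
  obtain A' B' where u: "is_univ (ty G A)" and v: "is_univ (ty (A # G) B)"
    and A': "nf G (Some A) = Some A'" and B': "nf (A # G) (Some B) = Some B'"
    and oa: "opt_le (ty G a) (Some A')" and ob: "opt_le (ty G b) (nf G (Some (asub 0 [a] 0 B)))"
    and T: "T = ASig A' B'"
    using assms(4) by (auto simp: infer_eqs)
  obtain i where A: "typed_step (erase_ctx n G) (erase n A) (erase n (step A)) (Univ i)" and c: "ctx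
    (erase_ctx n (A # G))"
    using typer_sound_univ[OF assms(1,3) u] .
  obtain j where B: "typed_step (erase_ctx n (A # G)) (erase n B) (erase n (step B)) (Univ j)"
    using typer_sound_univ[OF assms(1) c v] .
  have eA: "tyeq (erase_ctx n G) (erase n A) (erase n A')"
    using normer_soundD[OF assms(2,3) A'] by auto
  have eB: "tyeq (erase n A # erase_ctx n G) (erase n B) (erase n B')"
    using normer_soundD[OF assms(2) c B'] by auto
  have a': "typed_step (erase_ctx n G) (erase n a) (erase n (step a)) (erase n A')"
    using typer_sound_opt_le[OF assms(1,3) oa] .
  then have a: "typed_step (erase_ctx n G) (erase n a) (erase n (step a)) (erase n A)"
    using eA by (blast intro: typed_step_conv tyeq_sym)
  have b: "typed_step (erase_ctx n G) (erase n b) (erase n (step b)) (inst (erase n B) (erase n a))"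
    using typer_normer_sound_opt_le[OF assms(1-3) ob] by (simp add: erase_subst)
  have "typed_step (erase_ctx n G) (Pair (erase n a) (erase n b))
    (Pair (erase n (step a)) (erase n (step b))) (Sig (erase n A) (erase n B))"
    using a b B by (auto simp: typed_step_def intro: Sig_intro Sig_intro_eq)
  moreover have "tyeq (erase_ctx n G) (Sig (erase n A) (erase n B)) (erase n T)"
    using T tyeq_Sig[OF eA typed_step_type[OF A] eB] typed_step_type[OF B] by simp
  \<comment> \<open>Stated for the normalised family \<open>B'\<close>, because the type that
    inference passes on is made of normal forms.\<close>
  moreover have "erase_ctx n G \<turnstile> erase n b \<Colon> inst (erase n B') (erase n a)"
    using typed_step_conv[OF b tyeq_inst[OF eB typed_step_type[OF a]]] by (rule typed_step_type)
  ultimately show ?thesis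
    using T a' by (auto simp: comp_type_def intro: typed_step_conv typed_step_type)
qed

lemma infer_ind_sig_sound:
  assumes "typer_sound n ty" "normer_sound n nf" "ctx (erase_ctx n G)"
    and "infer_ind_sig ty nf G C g p (sig_of (ty G p)) = Some T"
  shows "typed_step (erase_ctx n G) (IndSig (erase n C) (erase n g) (erase n p))
    (erase n (step (AIndSig C g p))) (erase n T)"
proof -
  obtain A B where AB: "sig_of (ty G p) = Some (A, B)"
    using assms(4) by (cases "sig_of (ty G p)") auto
  then have P: "ty G p = Some (ASig A B)" by (simp add: sig_of_eq)
  obtain S where S: "guard (is_univ (ty G A) \<and> is_univ (ty (A # G) B) \<and> is_univ (ty (ASig A B # G) C) \<and>
       opt_le (ty (B # A # G) g)
         (nf (B # A # G) (Some (asub 0 [APair (lift 0 2 A) (lift 1 2 B) (AVar 1) (AVar 0)] 2 C))))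
     (asub 0 [p] 0 C) = Some S" "tyeq (erase_ctx n G) (erase n S) (erase n T)"
    using assms(4) AB by (auto elim!: normer_soundD[OF assms(2,3)])
  then have u: "is_univ (ty G A)" and v: "is_univ (ty (A # G) B)" and w: "is_univ (ty (ASig A B # G) C)"
    and og: "opt_le (ty (B # A # G) g)
         (nf (B # A # G) (Some (asub 0 [APair (lift 0 2 A) (lift 1 2 B) (AVar 1) (AVar 0)] 2 C)))"
    and e: "tyeq (erase_ctx n G) (inst (erase n C) (erase n p)) (erase n T)"
    by (auto simp: guard_eq erase_subst)
  obtain i where A: "typed_step (erase_ctx n G) (erase n A) (erase n (step A)) (Univ i)" and c: "ctx
    (erase_ctx n (A # G))"
    using typer_sound_univ[OF assms(1,3) u] .
  obtain j where B: "typed_step (erase_ctx n (A # G)) (erase n B) (erase n (step B)) (Univ j)" and c2: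
    "ctx (erase_ctx n (B # A # G))"
    using typer_sound_univ[OF assms(1) c v] .
  have "ctx (erase_ctx n (ASig A B # G))"
    using typed_step_Sig[of "erase_ctx n G", OF A, of "erase n B"] B by
      (auto intro: ctx_ext dest: typed_step_type)
  then obtain k where C: "typed_step (erase_ctx n (ASig A B # G)) (erase n C) (erase n (step C))
    (Univ k)"
    using typer_sound_univ[OF assms(1) _ w] by blast
  have g: "typed_step (erase n B # erase n A # erase_ctx n G) (erase n g) (erase n (step g))
      (sub (erase n C) (case_nat (Pair (Var 1) (Var 0)) (\<lambda>j. Var (j + 2))))"
    using typer_normer_sound_opt_le[OF assms(1,2) c2 og] by (simp add: erase_subst)
  have p: "typed_step (erase_ctx n G) (erase n p) (erase n (step p)) (Sig (erase n A) (erase n B))"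
    and ct: "comp_type n G p (ASig A B)"
    using typer_soundD[OF assms(1,3) P] by simp_all
  have ind: "erase_ctx n G \<turnstile> IndSig (erase n C) (erase n g) (erase n p) \<Colon> inst (erase n C) (erase n p)"
    using C g p by (auto simp: typed_step_def intro: Sig_elim)
  have "typed_step (erase_ctx n G) (IndSig (erase n C) (erase n g) (erase n p))
    (erase n (step (AIndSig C g p))) (inst (erase n C) (erase n p))"
  proof (cases "\<exists>A0 B0 a b. p = APair A0 B0 a b")
    case True
    then obtain A0 B0 a b where pp: "p = APair A0 B0 a b" by blast
    with ct have "erase_ctx n G \<turnstile> erase n a \<Colon> erase n A" "erase_ctx n G \<turnstile> erase n b \<Colon> inst (erase n B)
      (erase n a)"
      by (auto simp: comp_type_def)
    then have "erase_ctx n G \<turnstile> IndSig (erase n C) (erase n g) (Pair (erase n a) (erase n b)) \<equiv> inst2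
      (erase n g) (erase n a) (erase n b)
        \<Colon> inst (erase n C) (Pair (erase n a) (erase n b))"
      using C g by (intro Sig_comp) (auto simp: typed_step_def)
    then show ?thesis using ind pp by (simp add: typed_step_def erase_subst)
  next
    case False
    then have "step (AIndSig C g p) = AIndSig (step C) (step g) (step p)" by (cases p) auto
    then show ?thesis using C g p ind by (auto simp: typed_step_def intro: Sig_elim_eq)
  qed
  then show ?thesis using e by (rule typed_step_conv)
qed

lemma infer_ind_one_sound:
  assumes "typer_sound n ty" "normer_sound n nf" "ctx (erase_ctx n G)"
    and "infer_with ty nf G (AIndOne C g a) = Some T"
  shows "typed_step (erase_ctx n G) (IndOne (erase n C) (erase n g) (erase n a))
    (erase n (step (AIndOne C g a))) (erase n T)"
proof -
  have "nf G (guard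
     (opt_le (ty G a) (Some AOne) \<and> is_univ (ty (AOne # G) C) \<and> opt_le (ty G g)
       (nf G (Some (asub 0 [AStar] 0 C))))
     (asub 0 [a] 0 C)) = Some T"
    using assms(4) by simp
  from normer_soundD[OF assms(2,3) this] obtain S where S: "guard
     (opt_le (ty G a) (Some AOne) \<and> is_univ (ty (AOne # G) C) \<and> opt_le (ty G g)
       (nf G (Some (asub 0 [AStar] 0 C))))
     (asub 0 [a] 0 C) = Some S" "tyeq (erase_ctx n G) (erase n S) (erase n T)" .
  then have oa: "opt_le (ty G a) (Some AOne)" and w: "is_univ (ty (AOne # G) C)"
    and og: "opt_le (ty G g) (nf G (Some (asub 0 [AStar] 0 C)))"
    and e: "tyeq (erase_ctx n G) (inst (erase n C) (erase n a)) (erase n T)"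
    by (auto simp: guard_eq erase_subst)
  have "ctx (erase_ctx n (AOne # G))"
    using One_form[OF assms(3)] by (auto intro: ctx_ext)
  then obtain k where C: "typed_step (erase_ctx n (AOne # G)) (erase n C) (erase n (step C)) (Univ k)"
    using typer_sound_univ[OF assms(1) _ w] by blast
  have g: "typed_step (erase_ctx n G) (erase n g) (erase n (step g)) (inst (erase n C) Star)"
    using typer_normer_sound_opt_le[OF assms(1-3) og] by (simp add: erase_subst)
  have a: "typed_step (erase_ctx n G) (erase n a) (erase n (step a)) One"
    using typer_sound_opt_le[OF assms(1,3) oa] by simp
  have io: "erase_ctx n G \<turnstile> IndOne (erase n C) (erase n g) (erase n a) \<Colon> inst (erase n C) (erase n a)"
    using C g a by (auto simp: typed_step_def intro: One_elim)
  have "typed_step (erase_ctx n G) (IndOne (erase n C) (erase n g) (erase n a))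
    (erase n (step (AIndOne C g a))) (inst (erase n C) (erase n a))"
  proof (cases "a = AStar")
    case True
    moreover have "erase_ctx n G \<turnstile> IndOne (erase n C) (erase n g) Star \<equiv> erase n g \<Colon> inst (erase n C)
      Star"
      using C g by (intro One_comp) (auto simp: typed_step_def)
    ultimately show ?thesis using io by (simp add: typed_step_def)
  next
    case False
    then have "step (AIndOne C g a) = AIndOne (step C) (step g) (step a)" by
      (simp add: is_star_iff contract_if_eq)
    then show ?thesis using C g a io by (auto simp: typed_step_def intro: One_elim_eq)
  qed
  then show ?thesis using e by (rule typed_step_conv)
qed

lemma infer_ind_id_sound:
  assumes "typer_sound n ty" "normer_sound n nf" "ctx (erase_ctx n G)"
    and "infer_ind_id ty nf G C c a b p (id_of (ty G p)) = Some T"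
  shows "typed_step (erase_ctx n G) (IndId (erase n C) (erase n c) (erase n a) (erase n b)
    (erase n p)) (erase n (step (AIndId C c a b p))) (erase n T)"
proof -
  obtain A P where AApp: "id_of (ty G p) = Some (A, P)"
    using assms(4) by (cases "id_of (ty G p)") auto
  then have P: "ty G p = Some P" by (auto simp: id_of_eq)
  let ?H = "AId (lift 0 2 A) (AVar 1) (AVar 0) # lift 0 1 A # A # G"
  obtain S where S: "guard
     (is_univ (ty G A) \<and> opt_le (ty G a) (Some A) \<and> opt_le (ty G b) (Some A) \<and>
       opt_le (Some P) (nf G (Some (AId A a b))) \<and> is_univ (ty ?H C) \<and>
       opt_le (ty (A # G) c) (nf (A # G) (Some (asub 0 [ARefl (AVar 0), AVar 0, AVar 0] 1 C))))
     (asub 0 [p, b, a] 0 C) = Some S" "tyeq (erase_ctx n G) (erase n S) (erase n T)"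
    using assms(4) AApp by (auto elim!: normer_soundD[OF assms(2,3)])
  then have u: "is_univ (ty G A)" and oa: "opt_le (ty G a) (Some A)" and ob: "opt_le (ty G b) (Some A)"
    and op: "opt_le (Some P) (nf G (Some (AId A a b)))" and w: "is_univ (ty ?H C)"
    and oc: "opt_le (ty (A # G) c) (nf (A # G) (Some (asub 0 [ARefl (AVar 0), AVar 0, AVar 0] 1 C)))"
    and e: "tyeq (erase_ctx n G) (inst3 (erase n C) (erase n a) (erase n b) (erase n p)) (erase n T)"
    by (auto simp: guard_eq erase_subst)
  obtain i where A: "typed_step (erase_ctx n G) (erase n A) (erase n (step A)) (Univ i)" and c1: "ctx
    (erase_ctx n (A # G))"
    using typer_sound_univ[OF assms(1,3) u] .
  \<comment> \<open>Soundness applies to the motive only in a context known to be well formed, so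
    the entries of that context are typed here by weakening.\<close>
  have A1: "erase n A # erase_ctx n G \<turnstile> shift (erase n A) \<Colon> Univ i"
    using wkg[OF typed_step_type[OF A] typed_step_type[OF A]] by simp
  then have c2: "ctx (shift (erase n A) # erase n A # erase_ctx n G)" by (rule ctx_ext)
  have A2: "shift (erase n A) # erase n A # erase_ctx n G \<turnstile> shift (shift (erase n A)) \<Colon> Univ i"
    using wkg[OF A1 A1] by simp
  have v0: "shift (erase n A) # erase n A # erase_ctx n G \<turnstile> Var 0 \<Colon> shift (shift (erase n A))"
    using vble[OF c2, of 0] by (simp add: ren_ren)
  have v1: "shift (erase n A) # erase n A # erase_ctx n G \<turnstile> Var 1 \<Colon> shift (shift (erase n A))"
    using vble[OF c2, of 1] by (simp add: ren_ren)
  have H: "erase_ctx n ?H = Id (shift (shift (erase n A))) (Var 1) (Var 0) # shift (erase n A) # erase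
    n A # erase_ctx n G"
    by (simp add: erase_lift_0 ren_ren)
  have "ctx (erase_ctx n ?H)"
    unfolding H using Id_form[OF A2 v1 v0] by (rule ctx_ext)
  then obtain k where "typed_step (erase_ctx n ?H) (erase n C) (erase n (step C)) (Univ k)"
    using typer_sound_univ[OF assms(1) _ w] by blast
  then have C: "typed_step (Id (shift (shift (erase n A))) (Var 1) (Var 0) # shift (erase n A) # erase
    n A # erase_ctx n G)
      (erase n C) (erase n (step C)) (Univ k)"
    unfolding H .
  have c: "typed_step (erase n A # erase_ctx n G) (erase n c) (erase n (step c))
     (sub (erase n C) (case_nat (Refl (Var 0)) (case_nat (Var 0) (case_nat (Var 0) (\<lambda>j. Var (j + 1))))))"
    using typer_normer_sound_opt_le[OF assms(1,2) c1 oc] by (simp add: erase_subst)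
  have a: "typed_step (erase_ctx n G) (erase n a) (erase n (step a)) (erase n A)"
    using typer_sound_opt_le[OF assms(1,3) oa] .
  have b: "typed_step (erase_ctx n G) (erase n b) (erase n (step b)) (erase n A)"
    using typer_sound_opt_le[OF assms(1,3) ob] .
  \<comment> \<open>The inferred type \<open>P\<close> may have endpoints other than
    \<open>a\<close> and \<open>b\<close>; \<open>op\<close> compares it with the normal form of the
    identity type at the recorded ones.\<close>
  have p: "typed_step (erase_ctx n G) (erase n p) (erase n (step p))
    (Id (erase n A) (erase n a) (erase n b))"
    using typer_normer_sound_opt_le[OF assms(1-3), of p "AId A a b"] P op by simp
  have ii: "erase_ctx n G \<turnstile> IndId (erase n C) (erase n c) (erase n a) (erase n b) (erase n p) \<Colon> inst3
    (erase n C) (erase n a) (erase n b) (erase n p)"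
    using C c a b p by (auto simp: typed_step_def intro: Id_elim)
  have "typed_step (erase_ctx n G) (IndId (erase n C) (erase n c) (erase n a) (erase n b) (erase n p))
    (erase n (step (AIndId C c a b p)))
     (inst3 (erase n C) (erase n a) (erase n b) (erase n p))"
  proof (cases "p = ARefl a \<and> b = a")
    case True
    moreover have "erase_ctx n G \<turnstile> IndId (erase n C) (erase n c) (erase n a) (erase n a)
      (Refl (erase n a)) \<equiv> inst (erase n c) (erase n a)
        \<Colon> inst3 (erase n C) (erase n a) (erase n a) (Refl (erase n a))"
      using C c a by (intro Id_comp) (auto simp: typed_step_def)
    ultimately show ?thesis using ii by (simp add: typed_step_def erase_subst)
  next
    case False
    then have "step (AIndId C c a b p) = AIndId (step C) (step c) (step a) (step b) (step p)" by
      (auto simp: contract_if_eq)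
    then show ?thesis using C c a b p ii by (auto simp: typed_step_def intro: Id_elim_eq)
  qed
  then show ?thesis using e by (rule typed_step_conv)
qed

lemma infer_with_sound:
  assumes ty: "typer_sound n ty" and nf: "normer_sound n nf"
  shows "typer_sound n (infer_with ty nf)"
  unfolding typer_sound_def
proof (intro allI impI)
  fix G t T
  assume c: "ctx (erase_ctx n G)" and T: "infer_with ty nf G t = Some T"
  note univ = typer_soundD(1)[OF ty, of G _ "AUniv _", simplified]
  show "typed_step (erase_ctx n G) (erase n t) (erase n (step t)) (erase n T) \<and> comp_type n G t T"
  proof (cases t)
    case (AVar k)
    then show ?thesis
      using infer_var_sound[OF nf c] T by (auto intro: comp_type_trivial)
  next
    case (AUniv i)
    then show ?thesis
      using T c by (auto intro!: comp_type_trivial typed_step_refl U_intro)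
  next
    case (APi A B)
    with T obtain i j where "ty G A = Some (AUniv i)" "ty (A # G) B = Some (AUniv j)" "T = AUniv
      (max i j)"
      by (auto simp: infer_eqs)
    moreover from this have "typed_step (erase_ctx n G) (erase n A) (erase n (step A)) (Univ (n + i))"
      using typer_soundD(1)[OF ty c] by fastforce
    moreover from this have "ctx (erase_ctx n (A # G))"
      by (auto intro: ctx_ext dest: typed_step_type)
    ultimately have "typed_step (erase_ctx n G) (Pi (erase n A) (erase n B))
      (Pi (erase n (step A)) (erase n (step B))) (Univ (max (n + i) (n + j)))"
      using typer_soundD(1)[OF ty, of "A # G" B "AUniv j"] by (intro typed_step_Pi) auto
    \<comment> \<open>The rule yields the level \<open>max (n + i) (n + j)\<close>, the checker
      \<open>n + max i j\<close>. Their equality is what makes relative levels work.\<close>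
    then show ?thesis
      using APi \<open>T = _\<close> by (auto simp: nat_add_max_right intro: comp_type_trivial)
  next
    case (ASig A B)
    with T obtain i j where "ty G A = Some (AUniv i)" "ty (A # G) B = Some (AUniv j)" "T = AUniv
      (max i j)"
      by (auto simp: infer_eqs)
    moreover from this have "typed_step (erase_ctx n G) (erase n A) (erase n (step A)) (Univ (n + i))"
      using typer_soundD(1)[OF ty c] by fastforce
    moreover from this have "ctx (erase_ctx n (A # G))"
      by (auto intro: ctx_ext dest: typed_step_type)
    ultimately have "typed_step (erase_ctx n G) (Sig (erase n A) (erase n B))
      (Sig (erase n (step A)) (erase n (step B))) (Univ (max (n + i) (n + j)))"
      using typer_soundD(1)[OF ty, of "A # G" B "AUniv j"] by (intro typed_step_Sig) auto
    then show ?thesis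
      using ASig \<open>T = _\<close> by (auto simp: nat_add_max_right intro: comp_type_trivial)
  next
    case (ASum A B)
    with T obtain i j where "ty G A = Some (AUniv i)" "ty G B = Some (AUniv j)" "T = AUniv (max i j)"
      by (auto simp: infer_eqs)
    then have "typed_step (erase_ctx n G) (Sum (erase n A) (erase n B))
      (Sum (erase n (step A)) (erase n (step B))) (Univ (max (n + i) (n + j)))"
      using typer_soundD(1)[OF ty c, of A "AUniv i"] typer_soundD(1)[OF ty c, of B "AUniv j"] by
        (intro typed_step_Sum) auto
    then show ?thesis
      using ASum \<open>T = _\<close> by (auto simp: nat_add_max_right intro: comp_type_trivial)
  next
    case (ALam A b)
    then show ?thesis using infer_lam_sound[OF ty nf c] T by simp
  next
    case (AApp f a)
    then show ?thesis using infer_app_sound[OF ty nf c] T by (auto intro: comp_type_trivial)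
  next
    case (APair A B a b)
    then show ?thesis using infer_pair_sound[OF ty nf c] T by (auto simp del: infer_with.simps)
  next
    case (AIndSig C g p)
    then show ?thesis using infer_ind_sig_sound[OF ty nf c] T by (auto intro: comp_type_trivial)
  next
    case AEmpty
    then show ?thesis using T c by (auto intro!: comp_type_trivial typed_step_refl Empty_form)
  next
    case AOne
    then show ?thesis using T c by (auto intro!: comp_type_trivial typed_step_refl One_form)
  next
    case AStar
    then show ?thesis using T c by (auto intro!: comp_type_trivial typed_step_refl One_intro)
  next
    case (AIndOne C g a)
    then show ?thesis using infer_ind_one_sound[OF ty nf c, of C g a T] T
      by (auto simp del: infer_with.simps step.simps intro: comp_type_trivial)
  next
    case (AId A a b)
    with T obtain i where A: "ty G A = Some (AUniv i)" and oa: "opt_le (ty G a) (nf G (Some A))"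
      and ob: "opt_le (ty G b) (nf G (Some A))" and "T = AUniv i"
      by (auto simp: infer_eqs)
    moreover have "typed_step (erase_ctx n G) (erase n A) (erase n (step A)) (Univ (n + i))"
      using typer_soundD(1)[OF ty c A] by simp
    ultimately show ?thesis
      using AId typer_normer_sound_opt_le[OF ty nf c oa] typer_normer_sound_opt_le[OF ty nf c ob]
      by (auto simp: typed_step_def intro: comp_type_trivial Id_form Id_form_eq)
  next
    case (ARefl a)
    then have "nf G (refl_type a (ty G a)) = Some T" using T by simp
    from normer_soundD[OF nf c this] obtain S where S: "refl_type a (ty G a) = Some S"
      "tyeq (erase_ctx n G) (erase n S) (erase n T)" .
    then obtain A where A: "ty G a = Some A"
      and e: "tyeq (erase_ctx n G) (Id (erase n A) (erase n a) (erase n a)) (erase n T)"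
      by (auto simp: refl_type_eq)
    have "typed_step (erase_ctx n G) (Refl (erase n a)) (Refl (erase n (step a)))
      (Id (erase n A) (erase n a) (erase n a))"
      using typer_soundD(1)[OF ty c A] by (auto simp: typed_step_def intro: Id_intro Id_intro_eq)
    from typed_step_conv[OF this e] show ?thesis using ARefl by (auto intro: comp_type_trivial)
  next
    case (AIndId C c a b p)
    then show ?thesis using infer_ind_id_sound[OF ty nf \<open>ctx _\<close>, of C c a b p T] T
      by (auto simp del: step.simps intro: comp_type_trivial)
  next
    case (AFunext i)
    then have "nf G (Some (a_funext_type i 0)) = Some T" using T by simp
    from normer_soundD[OF nf c this] have e: "tyeq (erase_ctx n G) (funext_type (n + i) 0) (erase n T)"
      by (metis erase_funext option.inject)
    from typed_step_conv[OF typed_step_refl[OF funext[OF c]] e] show ?thesis using AFunext by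
      (auto intro: comp_type_trivial)
  qed
qed

lemma norm_with_sound:
  assumes ty: "typer_sound n ty" and nf: "normer_sound n nf"
  shows "normer_sound n (norm_with ty nf)"
  unfolding normer_sound_def
proof (intro conjI allI impI)
  fix G show "norm_with ty nf G None = None" by simp
next
  fix G T T'
  assume c: "ctx (erase_ctx n G)" and T: "norm_with ty nf G (Some T) = Some T'"
  show "tyeq (erase_ctx n G) (erase n T) (erase n T')"
  proof (cases "normal T")
    case True
    then show ?thesis using T by (simp add: tyeq_refl)
  next
    case False
    then have "nf G (guard (is_univ (ty G T)) (step T)) = Some T'" using T by simp
    from normer_soundD[OF nf c this] obtain S where S: "guard (is_univ (ty G T)) (step T) = Some S"
      "tyeq (erase_ctx n G) (erase n S) (erase n T')" .
    then have u: "is_univ (ty G T)" and e: "tyeq (erase_ctx n G) (erase n (step T)) (erase n T')"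
      by (auto simp: guard_eq)
    obtain i where "typed_step (erase_ctx n G) (erase n T) (erase n (step T)) (Univ i)"
      using typer_sound_univ[OF ty c u] .
    then have "tyeq (erase_ctx n G) (erase n T) (erase n (step T))" by
      (auto simp: tyeq_def typed_step_def)
    then show ?thesis using e by (rule tyeq_trans)
  qed
qed

lemma infer_0: "infer 0 = (\<lambda>_ _. None)" and norm_0: "norm 0 = (\<lambda>_ _. None)"
  and infer_Suc: "infer (Suc m) = infer_with (infer m) (norm m)"
  and norm_Suc: "norm (Suc m) = norm_with (infer m) (norm m)"
  by (simp_all add: fun_eq_iff)

lemma infer_norm_sound: "typer_sound n (infer m) \<and> normer_sound n (norm m)"
proof (induction m)
  case 0
  show ?case by (simp add: infer_0 norm_0 typer_sound_def normer_sound_def)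
next
  case (Suc m)
  then show ?case by (simp add: infer_Suc norm_Suc infer_with_sound norm_with_sound)
qed

lemma check_sound:
  assumes "check m [] t T"
  shows "[] \<turnstile> erase n t \<Colon> erase n T"
  using assms typer_normer_sound_opt_le[OF infer_norm_sound[THEN conjunct1]
    infer_norm_sound[THEN conjunct2], of n "[]" m t m T] ctx_emp
  by (auto simp: check_def dest: typed_step_type)

text \<open>The annotations of a pair do not count, as erasure removes them.\<close>

primrec closed :: "nat \<Rightarrow> atm \<Rightarrow> bool" where
  "closed k (AVar i) = (i < k)"
| "closed k (AUniv i) = True"
| "closed k (APi A B) = (closed k A \<and> closed (Suc k) B)"
| "closed k (ALam A b) = (closed k A \<and> closed (Suc k) b)"
| "closed k (AApp f a) = (closed k f \<and> closed k a)"
| "closed k (ASig A B) = (closed k A \<and> closed (Suc k) B)"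
| "closed k (APair A B a b) = (closed k a \<and> closed k b)"
| "closed k (AIndSig C g p) = (closed (Suc k) C \<and> closed (Suc (Suc k)) g \<and> closed k p)"
| "closed k (ASum A B) = (closed k A \<and> closed k B)"
| "closed k AEmpty = True"
| "closed k AOne = True"
| "closed k AStar = True"
| "closed k (AIndOne C g a) = (closed (Suc k) C \<and> closed k g \<and> closed k a)"
| "closed k (AId A a b) = (closed k A \<and> closed k a \<and> closed k b)"
| "closed k (ARefl a) = closed k a"
| "closed k (AIndId C g a b p) = (closed (Suc (Suc (Suc k))) C \<and> closed (Suc k) g \<and> closed k a \<and>
  closed k b \<and> closed k p)"
| "closed k (AFunext i) = True"

lemma ups_funpow_Var: "i < k \<Longrightarrow> (ups ^^ k) s i = Var i"
  by (induction k arbitrary: i) (auto simp: ups_def split: nat.splits)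

lemma ups_funpow_Suc: "ups ((ups ^^ k) s) = (ups ^^ Suc k) s"
  by simp

text \<open>Generalised to \<open>k\<close> liftings of the substitution so that the induction can
  pass binders.\<close>

lemma sub_closed_funpow: "closed k t \<Longrightarrow> sub (erase n t) ((ups ^^ k) s) = erase n t"
  by (induction t arbitrary: k) (simp_all add: ups_funpow_Var ups_funpow_Suc del: funpow.simps)

lemma sub_closed: "closed 0 t \<Longrightarrow> sub (erase n t) s = erase n t"
  using sub_closed_funpow[where k = 0] by simp

section \<open>Composition of derivations\<close>

text \<open>Only the existence of a term is kept, so later derivations depend on a proved type and
  never on its derivation.\<close>

definition provable :: "nat \<Rightarrow> ahterm \<Rightarrow> bool" where
  "provable n T \<longleftrightarrow> (\<exists>t. [] \<turnstile> t \<Colon> erase n (T 0))"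

lemma provable_check: "check m [] (t 0) (T 0) \<Longrightarrow> provable n T"
  unfolding provable_def using check_sound by blast

text \<open>In \<open>A \<mapsto> T\<close> the codomain sits under a binder and is therefore
  \<open>T 1\<close>, while \<open>provable\<close> speaks of \<open>T 0\<close>. The two
  conditions, decided by evaluation, identify these and make the codomain invariant under
  instantiation.\<close>

definition indep :: "ahterm \<Rightarrow> bool" where
  "indep T \<longleftrightarrow> T 1 = T 0 \<and> closed 0 (T 0)"

lemma provable_mp:
  assumes "provable n (A \<mapsto> B)" "provable n A" "indep B"
  shows "provable n B"
proof -
  obtain f a where "[] \<turnstile> f \<Colon> Pi (erase n (A 0)) (erase n (B 0))" and a: "[] \<turnstile> a \<Colon> erase n (A 0)"
    using assms by (auto simp: provable_def indep_def a_arr_def a_pi_def abind1_def)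
  then have "[] \<turnstile> App f a \<Colon> inst (erase n (B 0)) a" by (rule Pi_elim)
  then show ?thesis
    using assms(3) sub_closed[of "B 0"] by (auto simp: provable_def indep_def)
qed

text \<open>Proved results become antecedents of the type to be checked. Their derivations are then
  bound variables of the new term, which normalisation cannot unfold.\<close>

definition hyps :: "ahterm list \<Rightarrow> ahterm \<Rightarrow> ahterm" where
  "hyps As T = foldr a_arr As T"

primrec indep_hyps :: "ahterm list \<Rightarrow> ahterm \<Rightarrow> bool" where
  "indep_hyps [] T = True"
| "indep_hyps (A # As) T = (indep (hyps As T) \<and> indep_hyps As T)"

lemma provable_hyps:
  assumes "provable n (hyps As T)" "list_all (provable n) As" "indep_hyps As T"
  shows "provable n T"
  using assms
proof (induction As)
  case (Cons A As)
  have "provable n (hyps As T)"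
    using provable_mp[of n A "hyps As T"] Cons.prems by (simp add: hyps_def)
  then show ?case using Cons by simp
qed (simp add: hyps_def)

lemma provable_from:
  assumes "list_all (provable n) As" "check m [] (t 0) (hyps As T 0)" "indep_hyps As T"
  shows "provable n T"
  by (rule provable_hyps[OF provable_check[where t = t and T = "hyps As T", OF assms(2)] assms(1,3)])

text \<open>Elimination of \<open>Pi\<close> with the substitution carried out on the type. Only the
  argument is checked, so a concrete operation can replace a variable of a large statement
  cheaply.\<close>

lemma provable_inst:
  assumes "provable n (a_pi A B)" "check m [] (a 0) (A 0)" "asub 0 [a 0] 0 (abind1 B 0) = C 0"
  shows "provable n C"
proof -
  obtain f where "[] \<turnstile> f \<Colon> Pi (erase n (A 0)) (erase n (abind1 B 0))"
    using assms(1) by (auto simp: provable_def a_pi_def)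
  then have "[] \<turnstile> App f (erase n (a 0)) \<Colon> inst (erase n (abind1 B 0)) (erase n (a 0))"
    using check_sound[OF assms(2)] by (rule Pi_elim)
  then show ?thesis
    unfolding provable_def assms(3)[symmetric] by (auto simp: erase_subst)
qed

section \<open>Terms of the object theory\<close>

text \<open>\<open>t_x\<close> is a term of type \<open>T_x\<close>, possibly under hypotheses proved before. The relation \<open>e\<close> in
  \<open>univalent_wrt\<close> and \<open>embedding_wrt\<close> is \<open>is_equiv_fun\<close>, which applies the function directly, or the
  version of the theorem, which produces redexes.\<close>

definition "a_idfun A = a_lam A (\<lambda>x. x)"
definition "a_compose A g f = a_lam A (\<lambda>x. g \<bullet> (f \<bullet> x))"
definition "a_pr1 A p = a_ind_sig (\<lambda>_. A) (\<lambda>x y. x) p"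
definition "a_pr2 A B p = a_ind_sig (\<lambda>z. B (a_pr1 A z)) (\<lambda>x y. y) p"
definition "a_ap B f x y p = a_ind_id (\<lambda>x y _. a_id B (f x) (f y)) (\<lambda>x. a_refl (f x)) x y p"
definition "a_coe A B p = a_ind_id (\<lambda>X Y _. X \<mapsto> Y) (\<lambda>X. a_idfun X) A B p"
definition "a_transport P x y p = a_ind_id (\<lambda>x y _. P x \<mapsto> P y) (\<lambda>x. a_lam (P x) (\<lambda>z. z)) x y p"
definition "section_type A B f = a_sig (B \<mapsto> A) (\<lambda>g. a_pi B (\<lambda>y. a_id B (f (g \<bullet> y)) y))"
definition "retraction_type A B f = a_sig (B \<mapsto> A) (\<lambda>h. a_pi A (\<lambda>x. a_id A (h \<bullet> (f x)) x))"
definition "is_equiv_fun A B f = section_type A B f \<odot> retraction_type A B f"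
definition "equiv_type A B = a_sig (A \<mapsto> B) (\<lambda>f. is_equiv_fun A B (\<lambda>x. f \<bullet> x))"
text \<open>One inverse \<open>g\<close> serves as section and as retraction. \<open>f\<close> is
  the application of \<open>e\<close>, passed separately so that it can be given in reduced
  form.\<close>

definition "mk_equiv X Y e f g h1 h2 = a_pair (X \<mapsto> Y) (\<lambda>f. is_equiv_fun X Y (\<lambda>x. f \<bullet> x)) e
  (a_pair (section_type X Y f) (\<lambda>_. retraction_type X Y f)
  (a_pair (Y \<mapsto> X) (\<lambda>g. a_pi Y (\<lambda>y. a_id Y (f (g \<bullet> y)) y)) g h1)
  (a_pair (Y \<mapsto> X) (\<lambda>h. a_pi X (\<lambda>x. a_id X (h \<bullet> (f x)) x)) g h2))"
definition "identity_equiv A = mk_equiv A A (a_idfun A) (\<lambda>x. x) (a_idfun A) (a_lam A (\<lambda>x. a_refl x))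
  (a_lam A (\<lambda>x. a_refl x))"
definition "path_to_equiv A B p = a_ind_id (\<lambda>X Y _. equiv_type X Y) (\<lambda>X. identity_equiv X) A B p"
definition "univalent_wrt e = a_pi (a_univ 0)
  (\<lambda>A. a_pi (a_univ 0) (\<lambda>B. e (a_id (a_univ 0) A B) (equiv_type A B) (\<lambda>p. path_to_equiv A B p)))"
definition "univalent_type = univalent_wrt is_equiv_fun"
definition "embedding_wrt e A B f = a_pi A (\<lambda>x. a_pi A (\<lambda>y.
     e (a_id A x y) (a_id B (f \<bullet> x) (f \<bullet> y)) (\<lambda>p. a_ap B (\<lambda>z. f \<bullet> z) x y p)))"
definition "embedding_type = embedding_wrt is_equiv_fun"
definition "a_fib A B f b = a_sig A (\<lambda>a. a_id B (f \<bullet> a) b)"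
definition "a_closed_sig V El = a_pi V (\<lambda>E. a_pi (El \<bullet> E \<mapsto> V) (\<lambda>F.
     a_fib V (a_univ 0) El (a_sig (El \<bullet> E) (\<lambda>e. El \<bullet> (F \<bullet> e)))))"
definition "a_contains_unit V El = a_fib V (a_univ 0) El a_one"
definition "a_bang V El A = a_sig V (\<lambda>E. El \<bullet> E \<mapsto> A)"
definition "bang_pair V El A E p = a_pair V (\<lambda>E. El \<bullet> E \<mapsto> A) E p"
definition "a_bang_obj V El = a_lam (a_univ 0) (\<lambda>A. a_bang V El A)"
definition "a_bang_map V El =
     a_lam (a_univ 0) (\<lambda>A. a_lam (a_univ 0) (\<lambda>B. a_lam (A \<mapsto> B) (\<lambda>f. a_lam (a_bang V El A) (\<lambda>w.
       a_ind_sig (\<lambda>_. a_bang V El B) (\<lambda>E p. bang_pair V El B E (a_compose (El \<bullet> E) f p)) w))))"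
definition "a_bang_eta V El u =
     a_lam (a_univ 0) (\<lambda>A. a_lam A (\<lambda>a.
       bang_pair V El A (a_pr1 V u) (a_lam (El \<bullet> a_pr1 V u) (\<lambda>_. a))))"
definition "a_sig_code V c E F = a_pr1 V (c \<bullet> E \<bullet> F)"
definition "sig_code_path V El c E F = a_pr2 V
  (\<lambda>S. a_id (a_univ 0) (El \<bullet> S) (a_sig (El \<bullet> E) (\<lambda>e. El \<bullet> (F \<bullet> e)))) (c \<bullet> E \<bullet> F)"
definition "a_sig_decode V El c E F = a_coe (El \<bullet> a_sig_code V c E F)
  (a_sig (El \<bullet> E) (\<lambda>e. El \<bullet> (F \<bullet> e))) (sig_code_path V El c E F)"
definition "a_bang_mu V El c =
     a_lam (a_univ 0) (\<lambda>A. a_lam (a_bang V El (a_bang V El A)) (\<lambda>w.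
       a_ind_sig (\<lambda>_. a_bang V El A)
         (\<lambda>E p.
            let F = a_lam (El \<bullet> E) (\<lambda>e. a_pr1 V (p \<bullet> e));
                S = a_sig_code V c E F
            in bang_pair V El A S (a_lam (El \<bullet> S) (\<lambda>s.
                 a_ind_sig (\<lambda>_. A)
                   (\<lambda>e e'. a_pr2 V (\<lambda>E'. El \<bullet> E' \<mapsto> A) (p \<bullet> e) \<bullet> e')
                   (a_sig_decode V El c E F \<bullet> s))))
         w))"

text \<open>A property of the values of an equivalence holds everywhere. This is applied to the four
  equivalences at hand: function extensionality (at levels \<open>n\<close> and \<open>n + 1\<close>), univalence and the
  action of the embedding \<open>El\<close> on identifications.\<close>

definition "T_equiv_ind i k = a_pi (a_univ i)
  (\<lambda>P. a_pi (a_univ i) (\<lambda>Q. a_pi (P \<mapsto> Q) (\<lambda>F. is_equiv_fun P Q (\<lambda>x. F \<bullet> x) \<mapsto>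
   a_pi (Q \<mapsto> a_univ k) (\<lambda>M. a_pi P (\<lambda>p. M \<bullet> (F \<bullet> p)) \<mapsto> a_pi Q (\<lambda>y. M \<bullet> y)))))"
text \<open>Each \<open>y\<close> is identified with \<open>F \<bullet> (s \<bullet> y)\<close> by
  the homotopy of the section, and \<open>m\<close> provides the property there; transport
  finishes.\<close>

definition "t_equiv_ind i k = a_lam (a_univ i)
  (\<lambda>P. a_lam (a_univ i) (\<lambda>Q. a_lam (P \<mapsto> Q) (\<lambda>F. a_lam (is_equiv_fun P Q (\<lambda>x. F \<bullet> x)) (\<lambda>e.
   a_lam (Q \<mapsto> a_univ k) (\<lambda>M. a_lam (a_pi P (\<lambda>p. M \<bullet> (F \<bullet> p))) (\<lambda>m. a_lam Q (\<lambda>y.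
    a_ind_sig (\<lambda>_. M \<bullet> y) (\<lambda>a b. a_ind_sig (\<lambda>_. M \<bullet> y)
      (\<lambda>s h. a_transport (\<lambda>x. M \<bullet> x) (F \<bullet> (s \<bullet> y)) y (h \<bullet> y) \<bullet> (m \<bullet> (s \<bullet> y))) a) e)))))))"

definition "T_pointwise_eq = a_pi (a_univ 0) (\<lambda>A. a_pi (a_univ 0)
  (\<lambda>B. a_pi (A \<mapsto> B) (\<lambda>f. a_pi (A \<mapsto> B) (\<lambda>g.
   a_pi A (\<lambda>x. a_id B (f \<bullet> x) (g \<bullet> x)) \<mapsto> a_id (A \<mapsto> B) f g))))"
text \<open>Equivalence induction for \<open>happly\<close> with the constant motive
  \<open>f = g\<close>: on values of \<open>happly\<close> the claim is the identity
  function.\<close>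

definition "t_pointwise_eq = a_lam (T_equiv_ind 0 0)
  (\<lambda>ind. a_lam (a_univ 0) (\<lambda>A. a_lam (a_univ 0) (\<lambda>B. a_lam (A \<mapsto> B) (\<lambda>f. a_lam (A \<mapsto> B) (\<lambda>g.
   a_lam (a_pi A (\<lambda>x. a_id B (f \<bullet> x) (g \<bullet> x))) (\<lambda>h. ind \<bullet> (a_id (A \<mapsto> B) f g) \<bullet>
     (a_pi A (\<lambda>x. a_id B (f \<bullet> x) (g \<bullet> x)))
     \<bullet> a_lam (a_id (A \<mapsto> B) f g) (\<lambda>p. a_happly A (\<lambda>x. B) f g p)
     \<bullet> (a_funext 0 \<bullet> A \<bullet> a_lam A (\<lambda>_. B) \<bullet> f \<bullet> g)
     \<bullet> a_lam (a_pi A (\<lambda>x. a_id B (f \<bullet> x) (g \<bullet> x))) (\<lambda>_. a_id (A \<mapsto> B) f g)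
     \<bullet> a_lam (a_id (A \<mapsto> B) f g) (\<lambda>p. p) \<bullet> h))))))"

definition "homotopy_mot X Y0 = a_pi (X \<mapsto> a_univ 0)
  (\<lambda>Y. a_pi X (\<lambda>x. a_id (a_univ 0) (Y0 \<bullet> x) (Y \<bullet> x)) \<mapsto> a_univ 1)"
definition "T_homotopy_ind = a_pi (a_univ 0) (\<lambda>X. a_pi (X \<mapsto> a_univ 0) (\<lambda>Y0. a_pi (homotopy_mot X Y0) (\<lambda>P.
   P \<bullet> Y0 \<bullet> a_lam X (\<lambda>x. a_refl (Y0 \<bullet> x)) \<mapsto> a_pi (X \<mapsto> a_univ 0) (\<lambda>Y.
   a_pi (a_pi X (\<lambda>x. a_id (a_univ 0) (Y0 \<bullet> x) (Y \<bullet> x))) (\<lambda>j. P \<bullet> Y \<bullet> j)))))"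
text \<open>Function extensionality one level up, for families of types: a homotopy is a value of
  \<open>happly\<close> at some path, and path induction makes it the constant reflexivity. As in
  the induction principles below, the eliminator varies both endpoints, so its motive quantifies
  over \<open>P\<close>.\<close>

definition "t_homotopy_ind = a_lam (T_equiv_ind 1 1)
  (\<lambda>ind. a_lam (a_univ 0) (\<lambda>X. a_lam (X \<mapsto> a_univ 0) (\<lambda>Y0. a_lam (homotopy_mot X Y0) (\<lambda>P.
   a_lam (P \<bullet> Y0 \<bullet> a_lam X (\<lambda>x. a_refl (Y0 \<bullet> x))) (\<lambda>z. a_lam (X \<mapsto> a_univ 0) (\<lambda>Y.
   ind \<bullet> a_id (X \<mapsto> a_univ 0) Y0 Y \<bullet> a_pi X (\<lambda>x. a_id (a_univ 0) (Y0 \<bullet> x) (Y \<bullet> x))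
     \<bullet> a_lam (a_id (X \<mapsto> a_univ 0) Y0 Y) (\<lambda>p. a_happly X (\<lambda>x. a_univ 0) Y0 Y p)
     \<bullet> (a_funext 1 \<bullet> X \<bullet> a_lam X (\<lambda>_. a_univ 0) \<bullet> Y0 \<bullet> Y)
     \<bullet> (P \<bullet> Y)
     \<bullet> a_lam (a_id (X \<mapsto> a_univ 0) Y0 Y) (\<lambda>p.
        a_ind_id (\<lambda>Y0 Y p. a_pi (homotopy_mot X Y0) (\<lambda>P. P \<bullet> Y0 \<bullet> a_lam X (\<lambda>x. a_refl (Y0 \<bullet> x)) \<mapsto> P \<bullet>
          Y \<bullet> a_happly X (\<lambda>x. a_univ 0) Y0 Y p))
          (\<lambda>Y0. a_lam (homotopy_mot X Y0) (\<lambda>P. a_lam (P \<bullet> Y0 \<bullet> a_lam X (\<lambda>x. a_refl (Y0 \<bullet> x)))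
            (\<lambda>z. z))) Y0 Y p \<bullet> P \<bullet> z)))))))"

definition "path_mot k T a = a_pi T (\<lambda>b. a_id T a b \<mapsto> a_univ k)"
definition "T_path_ind i k = a_pi (a_univ i) (\<lambda>T. a_pi T
  (\<lambda>a. a_pi (path_mot k T a) (\<lambda>P. P \<bullet> a \<bullet> a_refl a \<mapsto>
   a_pi T (\<lambda>b. a_pi (a_id T a b) (\<lambda>p. P \<bullet> b \<bullet> p)))))"
text \<open>Based path induction obtained from the unbased eliminator. Quantifying over the
  predicate inside the motive frees the left endpoint.\<close>

definition "t_path_ind i k = a_lam (a_univ i)
  (\<lambda>T. a_lam T (\<lambda>a. a_lam (path_mot k T a) (\<lambda>P. a_lam (P \<bullet> a \<bullet> a_refl a) (\<lambda>z.
   a_lam T (\<lambda>b. a_lam (a_id T a b) (\<lambda>p.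
     a_ind_id (\<lambda>a b p. a_pi (path_mot k T a) (\<lambda>P. P \<bullet> a \<bullet> a_refl a \<mapsto> P \<bullet> b \<bullet> p))
       (\<lambda>a. a_lam (path_mot k T a) (\<lambda>P. a_lam (P \<bullet> a \<bullet> a_refl a) (\<lambda>z. z))) a b p \<bullet> P \<bullet> z))))))"

definition "T_join = a_pi (a_univ 0) (\<lambda>T. a_pi T (\<lambda>x. a_pi T (\<lambda>y. a_pi T (\<lambda>a. a_pi T (\<lambda>b.
   a_id T x a \<mapsto> a_id T y b \<mapsto> a_id T a b \<mapsto> a_id T x y)))))"
definition "t_join = a_lam (a_univ 0) (\<lambda>T. a_lam T (\<lambda>x. a_lam T (\<lambda>y. a_lam T (\<lambda>a. a_lam T (\<lambda>b.
   a_lam (a_id T x a) (\<lambda>p. a_lam (a_id T y b) (\<lambda>q.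
     a_ind_id (\<lambda>x a _. a_id T a b \<mapsto> a_id T x y) (\<lambda>x.
       a_ind_id (\<lambda>y b _. a_id T x b \<mapsto> a_id T x y) (\<lambda>y. a_lam (a_id T x y) (\<lambda>m. m)) y b q) x a p)))))))"

definition "inverse_mot X = a_pi (a_univ 0) (\<lambda>X'. (X \<mapsto> X') \<mapsto> a_univ 1)"
definition "T_inverse_ind = a_pi (a_univ 0) (\<lambda>X. a_pi (inverse_mot X) (\<lambda>P. P \<bullet> X \<bullet> a_idfun X \<mapsto>
   a_pi (a_univ 0) (\<lambda>X'. a_pi (X \<mapsto> X') (\<lambda>f. a_pi (X' \<mapsto> X) (\<lambda>g.
   a_pi X' (\<lambda>y. a_id X' (f \<bullet> (g \<bullet> y)) y) \<mapsto> a_pi X (\<lambda>x. a_id X (g \<bullet> (f \<bullet> x)) x) \<mapsto> P \<bullet> X' \<bullet> f)))))"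
text \<open>By univalence every equivalence comes from a path, and at reflexivity its function is
  the identity. The motive sees only the function, so a two-sided inverse suffices, and the
  projection from the pair built by \<open>mk_equiv\<close> reduces to \<open>f\<close>.\<close>

definition "t_inverse_ind = a_lam (T_equiv_ind 1 1)
  (\<lambda>ind. a_lam univalent_type (\<lambda>ua. a_lam (a_univ 0) (\<lambda>X. a_lam (inverse_mot X) (\<lambda>P.
   a_lam (P \<bullet> X \<bullet> a_idfun X) (\<lambda>z. a_lam (a_univ 0) (\<lambda>X'. a_lam (X \<mapsto> X') (\<lambda>f. a_lam (X' \<mapsto> X) (\<lambda>g.
   a_lam (a_pi X' (\<lambda>y. a_id X' (f \<bullet> (g \<bullet> y)) y)) (\<lambda>h1. a_lam (a_pi X (\<lambda>x. a_id X (g \<bullet> (f \<bullet> x)) x)) (\<lambda>h2.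
    ind \<bullet> a_id (a_univ 0) X X' \<bullet> equiv_type X X' \<bullet> a_lam (a_id (a_univ 0) X X')
      (\<lambda>p. path_to_equiv X X' p)
    \<bullet> (ua \<bullet> X \<bullet> X') \<bullet> a_lam (equiv_type X X') (\<lambda>e. P \<bullet> X' \<bullet> a_pr1 (X \<mapsto> X') e)
    \<bullet> a_lam (a_id (a_univ 0) X X') (\<lambda>p.
       a_ind_id (\<lambda>X X' p. a_pi (inverse_mot X) (\<lambda>P. P \<bullet> X \<bullet> a_idfun X \<mapsto> P \<bullet> X' \<bullet> a_pr1 (X \<mapsto> X')
         (path_to_equiv X X' p)))
         (\<lambda>X. a_lam (inverse_mot X) (\<lambda>P. a_lam (P \<bullet> X \<bullet> a_idfun X) (\<lambda>z. z))) X X' p \<bullet> P \<bullet> z)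
    \<bullet> mk_equiv X X' f (\<lambda>x. f \<bullet> x) g h1 h2))))))))))"

definition "embedding_mot V El S = a_pi V (\<lambda>S'. a_id (a_univ 0) (El \<bullet> S) (El \<bullet> S') \<mapsto> a_univ 0)"
definition "T_embedding_ind = a_pi (a_univ 0)
  (\<lambda>V. a_pi (V \<mapsto> a_univ 0) (\<lambda>El. embedding_type V (a_univ 0) El \<mapsto> a_pi V (\<lambda>S.
   a_pi (embedding_mot V El S) (\<lambda>P. P \<bullet> S \<bullet> a_refl (El \<bullet> S) \<mapsto> a_pi V (\<lambda>S'.
   a_pi (a_id (a_univ 0) (El \<bullet> S) (El \<bullet> S')) (\<lambda>i. P \<bullet> S' \<bullet> i))))))"
text \<open>The embedding makes \<open>i\<close> the action of \<open>El\<close> on a path between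
  codes; at reflexivity this action reduces to reflexivity.\<close>

definition "t_embedding_ind = a_lam (T_equiv_ind 1 0)
  (\<lambda>ind. a_lam (a_univ 0) (\<lambda>V. a_lam (V \<mapsto> a_univ 0) (\<lambda>El.
   a_lam (embedding_type V (a_univ 0) El) (\<lambda>emb. a_lam V (\<lambda>S. a_lam (embedding_mot V El S) (\<lambda>P.
   a_lam (P \<bullet> S \<bullet> a_refl (El \<bullet> S)) (\<lambda>z. a_lam V (\<lambda>S'.
    ind \<bullet> a_id V S S' \<bullet> a_id (a_univ 0) (El \<bullet> S) (El \<bullet> S')
      \<bullet> a_lam (a_id V S S') (\<lambda>p. a_ap (a_univ 0) (\<lambda>z. El \<bullet> z) S S' p)
      \<bullet> (emb \<bullet> S \<bullet> S') \<bullet> (P \<bullet> S')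
      \<bullet> a_lam (a_id V S S') (\<lambda>p.
        a_ind_id (\<lambda>S S' p. a_pi (embedding_mot V El S) (\<lambda>P. P \<bullet> S \<bullet> a_refl (El \<bullet> S) \<mapsto>
             P \<bullet> S' \<bullet> a_ap (a_univ 0) (\<lambda>z. El \<bullet> z) S S' p))
          (\<lambda>S. a_lam (embedding_mot V El S) (\<lambda>P. a_lam (P \<bullet> S \<bullet> a_refl (El \<bullet> S)) (\<lambda>z. z))) S S' p \<bullet> P
            \<bullet> z)))))))))"

section \<open>Representations of the elements of !A\<close>

definition "bang_via V El A S X i r = bang_pair V El A S
  (a_lam (El \<bullet> S) (\<lambda>s. r (a_coe (El \<bullet> S) X i \<bullet> s)))"
definition "T_code_irrelevant = a_pi (a_univ 0)
  (\<lambda>V. a_pi (V \<mapsto> a_univ 0) (\<lambda>El. embedding_type V (a_univ 0) El \<mapsto> a_pi (a_univ 0) (\<lambda>A.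
   a_pi V (\<lambda>S. a_pi V (\<lambda>S'. a_pi (a_univ 0) (\<lambda>X. a_pi (a_id (a_univ 0) (El \<bullet> S) X) (\<lambda>i.
   a_pi (a_id (a_univ 0) (El \<bullet> S') X) (\<lambda>i'. a_pi (X \<mapsto> A) (\<lambda>r.
     a_id (a_bang V El A) (bang_via V El A S X i (\<lambda>x. r \<bullet> x))
       (bang_via V El A S' X i' (\<lambda>x. r \<bullet> x)))))))))))"
text \<open>Path induction on \<open>i'\<close> turns \<open>X\<close> into the decoding of
  \<open>S'\<close>. What remains of \<open>i\<close> identifies the decodings of two codes, and
  \<open>T_embedding_ind\<close> contracts it to reflexivity, where both coercions
  disappear.\<close>

definition "t_code_irrelevant = a_lam (T_path_ind 1 1) (\<lambda>bj. a_lam T_embedding_ind (\<lambda>embind.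
   a_lam (a_univ 0) (\<lambda>V. a_lam (V \<mapsto> a_univ 0) (\<lambda>El. a_lam (embedding_type V (a_univ 0) El)
     (\<lambda>emb. a_lam (a_univ 0) (\<lambda>A.
   a_lam V (\<lambda>S. a_lam V (\<lambda>S'. a_lam (a_univ 0) (\<lambda>X. a_lam (a_id (a_univ 0) (El \<bullet> S) X) (\<lambda>i.
   a_lam (a_id (a_univ 0) (El \<bullet> S') X) (\<lambda>i'. a_lam (X \<mapsto> A) (\<lambda>r.
     bj \<bullet> a_univ 0 \<bullet> (El \<bullet> S')
       \<bullet> a_lam (a_univ 0) (\<lambda>X. a_lam (a_id (a_univ 0) (El \<bullet> S') X)
         (\<lambda>i'. a_pi (a_id (a_univ 0) (El \<bullet> S) X) (\<lambda>i. a_pi (X \<mapsto> A) (\<lambda>r.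
           a_id (a_bang V El A) (bang_via V El A S X i (\<lambda>x. r \<bullet> x))
             (bang_via V El A S' X i' (\<lambda>x. r \<bullet> x))))))
       \<bullet> a_lam (a_id (a_univ 0) (El \<bullet> S) (El \<bullet> S')) (\<lambda>i. embind \<bullet> V \<bullet> El \<bullet> emb \<bullet> S
            \<bullet> a_lam V (\<lambda>S'. a_lam (a_id (a_univ 0) (El \<bullet> S) (El \<bullet> S')) (\<lambda>i. a_pi (El \<bullet> S' \<mapsto> A) (\<lambda>r.
               a_id (a_bang V El A) (bang_via V El A S (El \<bullet> S') i (\<lambda>x. r \<bullet> x))
                 (bang_pair V El A S' (a_lam (El \<bullet> S') (\<lambda>s. r \<bullet> s))))))
            \<bullet> a_lam (El \<bullet> S \<mapsto> A) (\<lambda>r. a_refl (bang_pair V El A S (a_lam (El \<bullet> S) (\<lambda>s. r \<bullet> s))))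
            \<bullet> S' \<bullet> i)
       \<bullet> X \<bullet> i' \<bullet> i \<bullet> r))))))))))))"

definition "rep_at V El A w X r S = a_sig (a_id (a_univ 0) (El \<bullet> S) X)
  (\<lambda>i. a_id (a_bang V El A) w (bang_via V El A S X i r))"
definition "rep V El A w X r = a_sig V (\<lambda>S. rep_at V El A w X r S)"
definition "rep_intro V El A w X r S i q = a_pair V (\<lambda>S. rep_at V El A w X r S) S
   (a_pair (a_id (a_univ 0) (El \<bullet> S) X) (\<lambda>i. a_id (a_bang V El A) w (bang_via V El A S X i r)) i q)"

text \<open>\<open>T\<close> and \<open>R\<close> are functions of the metalanguage, so that the
  clause can be read both for ! with \<open>rep\<close> and for the variables of the abstract monad
  laws.\<close>

definition "uniq_clause T R A = a_pi (a_univ 0)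
  (\<lambda>X. a_pi (a_univ 0) (\<lambda>X'. a_pi (X \<mapsto> X') (\<lambda>f. a_pi (X' \<mapsto> X) (\<lambda>g.
   a_pi X' (\<lambda>y. a_id X' (f \<bullet> (g \<bullet> y)) y) \<mapsto> a_pi X (\<lambda>x. a_id X (g \<bullet> (f \<bullet> x)) x) \<mapsto>
   a_pi (X \<mapsto> A) (\<lambda>r. a_pi (X' \<mapsto> A) (\<lambda>r'. a_pi X (\<lambda>x. a_id A (r \<bullet> x) (r' \<bullet> (f \<bullet> x))) \<mapsto>
   a_pi (T A) (\<lambda>w. a_pi (T A) (\<lambda>w'. R A w X (\<lambda>x. r \<bullet> x) \<mapsto> R A w' X' (\<lambda>x. r' \<bullet> x) \<mapsto> a_id (T A) w
     w'))))))))"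

definition "T_rep_unique = a_pi (a_univ 0) (\<lambda>V. a_pi (V \<mapsto> a_univ 0)
  (\<lambda>El. embedding_type V (a_univ 0) El \<mapsto>
   a_pi (a_univ 0) (\<lambda>A. uniq_clause (a_bang V El) (rep V El) A)))"
text \<open>\<open>T_inverse_ind\<close> reduces the equivalence to the identity, function
  extensionality and path induction make the two labels equal, and the two codes that remain are
  compared by \<open>T_code_irrelevant\<close>.\<close>

definition "t_rep_unique = a_lam T_pointwise_eq
  (\<lambda>fe0. a_lam T_join (\<lambda>glue. a_lam T_code_irrelevant (\<lambda>mid. a_lam T_inverse_ind (\<lambda>qind.
   a_lam (a_univ 0) (\<lambda>V. a_lam (V \<mapsto> a_univ 0) (\<lambda>El. a_lam (embedding_type V (a_univ 0) El)
     (\<lambda>emb. a_lam (a_univ 0) (\<lambda>A.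
   a_lam (a_univ 0) (\<lambda>X.
    qind \<bullet> X
      \<bullet> a_lam (a_univ 0) (\<lambda>X'. a_lam (X \<mapsto> X') (\<lambda>f. a_pi (X \<mapsto> A) (\<lambda>r. a_pi (X' \<mapsto> A) (\<lambda>r'.
           a_pi X (\<lambda>x. a_id A (r \<bullet> x) (r' \<bullet> (f \<bullet> x))) \<mapsto>
             a_pi (a_bang V El A) (\<lambda>w. a_pi (a_bang V El A)
               (\<lambda>w'. rep V El A w X (\<lambda>x. r \<bullet> x) \<mapsto> rep V El A w' X' (\<lambda>x. r' \<bullet> x) \<mapsto> a_id (a_bang V El A)
               w w'))))))
      \<bullet> a_lam (X \<mapsto> A) (\<lambda>r. a_lam (X \<mapsto> A) (\<lambda>r'. a_lam (a_pi X (\<lambda>x. a_id A (r \<bullet> x) (r' \<bullet> x))) (\<lambda>h.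
          a_ind_id (\<lambda>r r' _. a_pi (a_bang V El A) (\<lambda>w. a_pi (a_bang V El A)
            (\<lambda>w'. rep V El A w X (\<lambda>x. r \<bullet> x) \<mapsto> rep V El A w' X (\<lambda>x. r' \<bullet> x) \<mapsto> a_id (a_bang V El A) w
            w')))
            (\<lambda>r. a_lam (a_bang V El A) (\<lambda>w. a_lam (a_bang V El A) (\<lambda>w'.
               a_lam (rep V El A w X (\<lambda>x. r \<bullet> x)) (\<lambda>R. a_lam (rep V El A w' X (\<lambda>x. r \<bullet> x)) (\<lambda>R'.
                a_ind_sig (\<lambda>_. a_id (a_bang V El A) w w') (\<lambda>S u. a_ind_sig
                  (\<lambda>_. a_id (a_bang V El A) w w') (\<lambda>i q.
                a_ind_sig (\<lambda>_. a_id (a_bang V El A) w w') (\<lambda>S' u'. a_ind_sig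
                  (\<lambda>_. a_id (a_bang V El A) w w') (\<lambda>i' q'.
                  glue \<bullet> a_bang V El A \<bullet> w \<bullet> w' \<bullet> bang_via V El A S X i (\<lambda>x. r \<bullet> x) \<bullet> bang_via V El A
                    S' X i' (\<lambda>x. r \<bullet> x) \<bullet> q \<bullet> q'
                   \<bullet> (mid \<bullet> V \<bullet> El \<bullet> emb \<bullet> A \<bullet> S \<bullet> S' \<bullet> X \<bullet> i \<bullet> i' \<bullet> r)) u') R') u) R)))))
            r r' (fe0 \<bullet> X \<bullet> A \<bullet> r \<bullet> r' \<bullet> h)))))))))))))"

section \<open>Representations under the operations of the monad\<close>

definition "map_clause T R mp A = a_pi (a_univ 0)
  (\<lambda>B. a_pi (A \<mapsto> B) (\<lambda>f. a_pi (T A) (\<lambda>w. a_pi (a_univ 0) (\<lambda>X. a_pi (X \<mapsto> A) (\<lambda>r.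
   R A w X (\<lambda>x. r \<bullet> x) \<mapsto> R B (mp \<bullet> A \<bullet> B \<bullet> f \<bullet> w) X (\<lambda>x. f \<bullet> (r \<bullet> x)))))))"
text \<open>Parametrised by the operation, so that it can be assumed of a variable and later be met
  by its literal instance, redexes included. The same holds for \<open>rep_eta_for\<close> and
  \<open>mu_eq_for\<close>.\<close>

definition "rep_map_for mp = a_pi (a_univ 0) (\<lambda>V. a_pi (V \<mapsto> a_univ 0)
  (\<lambda>El. a_pi (a_univ 0) (\<lambda>A. map_clause (a_bang V El) (rep V El) (mp \<bullet> V \<bullet> El) A)))"
definition "bang_map_term = a_lam (a_univ 0) (\<lambda>V. a_lam (V \<mapsto> a_univ 0) (\<lambda>El. a_bang_map V El))"
definition "T_rep_map = rep_map_for bang_map_term"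
text \<open>On a pair the functorial action computes, so its \<open>ap\<close> on the given
  identification already ends in the required form, with the code and \<open>i\<close>
  unchanged.\<close>

definition "t_rep_map = a_lam (a_univ 0) (\<lambda>V. a_lam (V \<mapsto> a_univ 0) (\<lambda>El. a_lam (a_univ 0) (\<lambda>A.
  a_lam (a_univ 0) (\<lambda>B. a_lam (A \<mapsto> B) (\<lambda>f. a_lam (a_bang V El A)
    (\<lambda>w. a_lam (a_univ 0) (\<lambda>X. a_lam (X \<mapsto> A) (\<lambda>r.
   a_lam (rep V El A w X (\<lambda>x. r \<bullet> x)) (\<lambda>R. let m = \<lambda>w. a_bang_map V El \<bullet> A \<bullet> B \<bullet> f \<bullet> w; r' =
     (\<lambda>x. f \<bullet> (r \<bullet> x)); G = rep V El B (m w) X r' in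
     a_ind_sig (\<lambda>_. G) (\<lambda>S u. a_ind_sig (\<lambda>_. G) (\<lambda>i q.
       rep_intro V El B (m w) X r' S i (a_ap (a_bang V El B) m w (bang_via V El A S X i (\<lambda>x. r \<bullet> x))
         q)) u) R)))))))))"

definition "rep_eta_for eta = a_pi (a_univ 0)
  (\<lambda>V. a_pi (V \<mapsto> a_univ 0) (\<lambda>El. a_pi (a_contains_unit V El) (\<lambda>u. a_pi (a_univ 0) (\<lambda>A. a_pi A (\<lambda>a.
   rep V El A (eta \<bullet> V \<bullet> El \<bullet> u \<bullet> A \<bullet> a) a_one (\<lambda>_. a))))))"
definition "bang_eta_term = a_lam (a_univ 0) (\<lambda>V. a_lam (V \<mapsto> a_univ 0)
  (\<lambda>El. a_lam (a_contains_unit V El) (\<lambda>u. a_bang_eta V El u)))"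
definition "T_rep_eta = rep_eta_for bang_eta_term"
definition "t_rep_eta = a_lam (a_univ 0) (\<lambda>V. a_lam (V \<mapsto> a_univ 0)
  (\<lambda>El. a_lam (a_contains_unit V El) (\<lambda>u. a_lam (a_univ 0) (\<lambda>A. a_lam A (\<lambda>a.
   rep_intro V El A (a_bang_eta V El u \<bullet> A \<bullet> a) a_one (\<lambda>_. a) (a_pr1 V u)
     (a_pr2 V (\<lambda>S. a_id (a_univ 0) (El \<bullet> S) a_one) u)
     (a_refl (a_bang_eta V El u \<bullet> A \<bullet> a)))))))"

definition "bang_car V El w = El \<bullet> a_pr1 V w"
definition "bang_lab V El A w = a_pr2 V (\<lambda>E. El \<bullet> E \<mapsto> A) w"
definition "T_rep_self = a_pi (a_univ 0) (\<lambda>V. a_pi (V \<mapsto> a_univ 0)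
  (\<lambda>El. a_pi (a_univ 0) (\<lambda>A. a_pi (a_bang V El A) (\<lambda>w.
   rep V El A w (bang_car V El w) (\<lambda>x. bang_lab V El A w \<bullet> x)))))"
text \<open>With the code itself and reflexivity, what is left is to identify \<open>p\<close> with
  its eta-expansion; pointwise reflexivities supply this, as the checker does not use the uniqueness
  rule.\<close>

definition "t_rep_self = a_lam T_pointwise_eq
  (\<lambda>fe0. a_lam (a_univ 0) (\<lambda>V. a_lam (V \<mapsto> a_univ 0)
  (\<lambda>El. a_lam (a_univ 0) (\<lambda>A. a_lam (a_bang V El A) (\<lambda>w.
   a_ind_sig (\<lambda>w. rep V El A w (bang_car V El w) (\<lambda>x. bang_lab V El A w \<bullet> x)) (\<lambda>E p.
      rep_intro V El A (bang_pair V El A E p) (El \<bullet> E) (\<lambda>x. p \<bullet> x) E (a_refl (El \<bullet> E))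
        (a_ap (a_bang V El A) (\<lambda>p. bang_pair V El A E p) p (a_lam (El \<bullet> E) (\<lambda>s. p \<bullet> s))
          (fe0 \<bullet> (El \<bullet> E) \<bullet> A \<bullet> p \<bullet> a_lam (El \<bullet> E) (\<lambda>s. p \<bullet> s) \<bullet> a_lam (El \<bullet> E)
            (\<lambda>s. a_refl (p \<bullet> s))))) w)))))"

definition "sig_label A q = (\<lambda>z. a_ind_sig (\<lambda>_. A) (\<lambda>x y. q \<bullet> x \<bullet> y) z)"
text \<open>The multiplication is a variable \<open>mu\<close> that satisfies \<open>mu_eq_clause\<close>; otherwise its definition
  would be unfolded in every type.\<close>

definition "ty_bang_mu V El = a_pi (a_univ 0) (\<lambda>A. a_bang V El (a_bang V El A) \<mapsto> a_bang V El A)"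
definition "mu_eq_clause V El c mu = a_pi (a_univ 0)
  (\<lambda>A. a_pi V (\<lambda>S. a_pi (El \<bullet> S \<mapsto> V) (\<lambda>H. a_pi (a_pi (El \<bullet> S) (\<lambda>x. El \<bullet> (H \<bullet> x) \<mapsto> A)) (\<lambda>q.
   a_id (a_bang V El A)
    (mu \<bullet> A \<bullet> bang_pair V El (a_bang V El A) S (a_lam (El \<bullet> S)
      (\<lambda>x. bang_pair V El A (H \<bullet> x) (a_lam (El \<bullet> (H \<bullet> x)) (\<lambda>s. q \<bullet> x \<bullet> s)))))
    (bang_via V El A (a_sig_code V c S (a_lam (El \<bullet> S) (\<lambda>x. H \<bullet> x))) (a_sig (El \<bullet> S) (\<lambda>x. El \<bullet> (H \<bullet> x)))
       (sig_code_path V El c S (a_lam (El \<bullet> S) (\<lambda>x. H \<bullet> x))) (sig_label A q))))))"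
definition "mu_eq_for mu = a_pi (a_univ 0) (\<lambda>V. a_pi (V \<mapsto> a_univ 0)
  (\<lambda>El. a_pi (a_closed_sig V El) (\<lambda>c. mu_eq_clause V El c (mu \<bullet> V \<bullet> El \<bullet> c))))"
definition "bang_mu_term = a_lam (a_univ 0) (\<lambda>V. a_lam (V \<mapsto> a_univ 0)
  (\<lambda>El. a_lam (a_closed_sig V El) (\<lambda>c. a_bang_mu V El c)))"
definition "T_mu_eq = mu_eq_for bang_mu_term"
text \<open>Reflexivity suffices, since the concrete multiplication computes on such pairs. The code
  family \<open>H\<close> appears eta-expanded because that is the form it takes in the
  reduct.\<close>

definition "t_mu_eq = a_lam (a_univ 0) (\<lambda>V. a_lam (V \<mapsto> a_univ 0) (\<lambda>El. a_lam (a_closed_sig V El) (\<lambda>c.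
   a_lam (a_univ 0) (\<lambda>A. a_lam V (\<lambda>S. a_lam (El \<bullet> S \<mapsto> V)
     (\<lambda>H. a_lam (a_pi (El \<bullet> S) (\<lambda>x. El \<bullet> (H \<bullet> x) \<mapsto> A)) (\<lambda>q.
    a_refl (bang_pair V El A (a_sig_code V c S (a_lam (El \<bullet> S) (\<lambda>x. H \<bullet> x)))
     (a_lam (El \<bullet> a_sig_code V c S (a_lam (El \<bullet> S) (\<lambda>x. H \<bullet> x)))
       (\<lambda>s. a_ind_sig (\<lambda>_. A) (\<lambda>x y. q \<bullet> x \<bullet> y) (a_coe
         (El \<bullet> a_sig_code V c S (a_lam (El \<bullet> S) (\<lambda>x. H \<bullet> x))) (a_sig (El \<bullet> S) (\<lambda>x. El \<bullet> (H \<bullet> x)))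
         (sig_code_path V El c S (a_lam (El \<bullet> S) (\<lambda>x. H \<bullet> x))) \<bullet> s)))))))))))"
definition "mu_family_rep V El A mu S H Y j q =
   rep V El A (mu \<bullet> A \<bullet> (bang_pair V El (a_bang V El A) S
     (a_lam (El \<bullet> S) (\<lambda>x. bang_via V El A (H \<bullet> x) (Y \<bullet> x) (j \<bullet> x) (\<lambda>y. q \<bullet> x \<bullet> y)))))
      (a_sig (El \<bullet> S) (\<lambda>x. Y \<bullet> x)) (sig_label A q)"
definition "mu_family_clause V El mu = a_pi (a_univ 0) (\<lambda>A.
   a_pi V (\<lambda>S. a_pi (El \<bullet> S \<mapsto> V) (\<lambda>H. a_pi (El \<bullet> S \<mapsto> a_univ 0) (\<lambda>Y.
   a_pi (a_pi (El \<bullet> S) (\<lambda>x. a_id (a_univ 0) (El \<bullet> (H \<bullet> x)) (Y \<bullet> x))) (\<lambda>j.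
   a_pi (a_pi (El \<bullet> S) (\<lambda>x. Y \<bullet> x \<mapsto> A)) (\<lambda>q. mu_family_rep V El A mu S H Y j q))))))"
definition "T_mu_family = a_pi (a_univ 0) (\<lambda>V. a_pi (V \<mapsto> a_univ 0)
  (\<lambda>El. a_pi (a_closed_sig V El) (\<lambda>c. a_pi (ty_bang_mu V El)
  (\<lambda>mu. mu_eq_clause V El c mu \<mapsto> mu_family_clause V El mu))))"
text \<open>Homotopy induction replaces all \<open>j \<bullet> x\<close> by reflexivities at once.
  The inner coercions then vanish, and the assumed equation for \<open>mu\<close> gives the
  representation.\<close>

definition "t_mu_family = a_lam T_homotopy_ind
  (\<lambda>fe1. a_lam (a_univ 0) (\<lambda>V. a_lam (V \<mapsto> a_univ 0)
  (\<lambda>El. a_lam (a_closed_sig V El) (\<lambda>c. a_lam (ty_bang_mu V El) (\<lambda>mu.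
   a_lam (mu_eq_clause V El c mu) (\<lambda>mueq. a_lam (a_univ 0) (\<lambda>A.
   a_lam V (\<lambda>S. a_lam (El \<bullet> S \<mapsto> V) (\<lambda>H.
    fe1 \<bullet> (El \<bullet> S) \<bullet> a_lam (El \<bullet> S) (\<lambda>x. El \<bullet> (H \<bullet> x))
     \<bullet> a_lam (El \<bullet> S \<mapsto> a_univ 0) (\<lambda>Y. a_lam (a_pi (El \<bullet> S)
       (\<lambda>x. a_id (a_univ 0) (El \<bullet> (H \<bullet> x)) (Y \<bullet> x))) (\<lambda>j.
        a_pi (a_pi (El \<bullet> S) (\<lambda>x. Y \<bullet> x \<mapsto> A)) (\<lambda>q. mu_family_rep V El A mu S H Y j q)))
     \<bullet> a_lam (a_pi (El \<bullet> S) (\<lambda>x. El \<bullet> (H \<bullet> x) \<mapsto> A)) (\<lambda>q.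
         let H' = a_lam (El \<bullet> S) (\<lambda>x. H \<bullet> x); Y = (\<lambda>x. El \<bullet> (H \<bullet> x));
          w = mu \<bullet> A \<bullet> (bang_pair V El (a_bang V El A) S
            (a_lam (El \<bullet> S) (\<lambda>x. bang_pair V El A (H \<bullet> x) (a_lam (El \<bullet> (H \<bullet> x)) (\<lambda>s. q \<bullet> x \<bullet> s))))) in
         rep_intro V El A w (a_sig (El \<bullet> S) (\<lambda>x. Y x)) (sig_label A q)
            (a_sig_code V c S H') (sig_code_path V El c S H') (mueq \<bullet> A \<bullet> S \<bullet> H \<bullet> q)))))))))))"

definition "mu_clause T R mu A = a_pi (T (T A))
  (\<lambda>W. a_pi (a_univ 0) (\<lambda>X. a_pi (X \<mapsto> T A) (\<lambda>P. R (T A) W X (\<lambda>x. P \<bullet> x) \<mapsto>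
   a_pi (X \<mapsto> a_univ 0) (\<lambda>Y. a_pi (a_pi X (\<lambda>x. Y \<bullet> x \<mapsto> A))
     (\<lambda>q. a_pi X (\<lambda>x. R A (P \<bullet> x) (Y \<bullet> x) (\<lambda>y. q \<bullet> x \<bullet> y)) \<mapsto>
   R A (mu \<bullet> A \<bullet> W) (a_sig X (\<lambda>x. Y \<bullet> x)) (sig_label A q))))))"
definition "T_rep_mu = a_pi (a_univ 0) (\<lambda>V. a_pi (V \<mapsto> a_univ 0)
  (\<lambda>El. a_pi (ty_bang_mu V El) (\<lambda>mu. mu_family_clause V El mu \<mapsto> a_pi (a_univ 0) (\<lambda>A.
   mu_clause (a_bang V El) (rep V El) mu A))))"
definition "T_transport = a_pi (a_univ 0) (\<lambda>T. a_pi (T \<mapsto> a_univ 1)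
  (\<lambda>D. a_pi T (\<lambda>x. a_pi T (\<lambda>y. a_id T x y \<mapsto> D \<bullet> y \<mapsto> D \<bullet> x))))"
definition "t_transport = a_lam (a_univ 0) (\<lambda>T. a_lam (T \<mapsto> a_univ 1)
  (\<lambda>D. a_lam T (\<lambda>x. a_lam T (\<lambda>y. a_lam (a_id T x y) (\<lambda>p.
   a_ind_id (\<lambda>x y _. D \<bullet> y \<mapsto> D \<bullet> x) (\<lambda>x. a_idfun (D \<bullet> x)) x y p)))))"
definition "ac_C X V B = a_pi X (\<lambda>x. a_pi V (\<lambda>S. B \<bullet> x \<bullet> S \<mapsto> a_univ 0))"
definition "ac_s V B C x = a_sig V (\<lambda>S. a_sig (B \<bullet> x \<bullet> S) (\<lambda>i. C \<bullet> x \<bullet> S \<bullet> i))"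
definition "ac_k X V B C K = a_pi (X \<mapsto> V) (\<lambda>H. a_pi (a_pi X (\<lambda>x. B \<bullet> x \<bullet> (H \<bullet> x)))
  (\<lambda>j. a_pi X (\<lambda>x. C \<bullet> x \<bullet> (H \<bullet> x) \<bullet> (j \<bullet> x)) \<mapsto> K))"
text \<open>Type-theoretic choice for two nested sums in continuation form: the three functions
  reach the goal \<open>K\<close> as variables and not as projections, which keeps the types in
  \<open>t_rep_mu\<close> small.\<close>

definition "T_choice = a_pi (a_univ 0) (\<lambda>X. a_pi (a_univ 0)
  (\<lambda>V. a_pi (X \<mapsto> V \<mapsto> a_univ 1) (\<lambda>B. a_pi (ac_C X V B) (\<lambda>C. a_pi (a_univ 1) (\<lambda>K.
   a_pi X (ac_s V B C) \<mapsto> ac_k X V B C K \<mapsto> K)))))"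
definition "t_choice = a_lam (a_univ 0) (\<lambda>X. a_lam (a_univ 0)
  (\<lambda>V. a_lam (X \<mapsto> V \<mapsto> a_univ 1) (\<lambda>B. a_lam (ac_C X V B) (\<lambda>C. a_lam (a_univ 1) (\<lambda>K.
   a_lam (a_pi X (ac_s V B C)) (\<lambda>g. a_lam (ac_k X V B C K) (\<lambda>k.
     let H = (\<lambda>x. a_pr1 V (g \<bullet> x)); u = (\<lambda>x. a_pr2 V (\<lambda>S. a_sig (B \<bullet> x \<bullet> S) (\<lambda>i. C \<bullet> x \<bullet> S \<bullet> i))
       (g \<bullet> x)) in
     k \<bullet> a_lam X H \<bullet> a_lam X (\<lambda>x. a_pr1 (B \<bullet> x \<bullet> H x) (u x)) \<bullet> a_lam X
       (\<lambda>x. a_pr2 (B \<bullet> x \<bullet> H x) (\<lambda>i. C \<bullet> x \<bullet> H x \<bullet> i) (u x)))))))))"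
text \<open>Path induction makes the index type the decoding of \<open>S\<close>. Choice splits the
  representations of the values of \<open>P\<close> into codes, identifications and equations; the
  equations identify \<open>P\<close> with the family \<open>P'\<close> treated by
  \<open>mu_family_clause\<close>. Two transports, along this path and along \<open>Q\<close>,
  finish.\<close>

definition "t_rep_mu = a_lam T_pointwise_eq (\<lambda>fe0. a_lam (T_path_ind 1 1)
  (\<lambda>bj. a_lam T_transport (\<lambda>tr. a_lam T_choice (\<lambda>ac.
   a_lam (a_univ 0) (\<lambda>V. a_lam (V \<mapsto> a_univ 0) (\<lambda>El. a_lam (ty_bang_mu V El)
     (\<lambda>mu. a_lam (mu_family_clause V El mu) (\<lambda>mufam. a_lam (a_univ 0) (\<lambda>A.
   a_lam (a_bang V El (a_bang V El A)) (\<lambda>W. a_lam (a_univ 0)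
     (\<lambda>X. a_lam (X \<mapsto> a_bang V El A) (\<lambda>P. a_lam (rep V El (a_bang V El A) W X (\<lambda>x. P \<bullet> x)) (\<lambda>R.
    let G = (\<lambda>X P. a_pi (X \<mapsto> a_univ 0) (\<lambda>Y. a_pi (a_pi X (\<lambda>x. Y \<bullet> x \<mapsto> A))
      (\<lambda>q. a_pi X (\<lambda>x. rep V El A (P \<bullet> x) (Y \<bullet> x) (\<lambda>y. q \<bullet> x \<bullet> y)) \<mapsto>
        rep V El A (mu \<bullet> A \<bullet> W) (a_sig X (\<lambda>x. Y \<bullet> x)) (sig_label A q)))) in
    a_ind_sig (\<lambda>_. G X P) (\<lambda>S u. a_ind_sig (\<lambda>_. G X P) (\<lambda>i Q.
     bj \<bullet> a_univ 0 \<bullet> (El \<bullet> S) \<bullet> a_lam (a_univ 0) (\<lambda>X. a_lam (a_id (a_univ 0) (El \<bullet> S) X)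
       (\<lambda>i. a_pi (X \<mapsto> a_bang V El A) (\<lambda>P.
        a_id (a_bang V El (a_bang V El A)) W (bang_via V El (a_bang V El A) S X i (\<lambda>x. P \<bullet> x)) \<mapsto> G X P)))
      \<bullet> a_lam (El \<bullet> S \<mapsto> a_bang V El A) (\<lambda>P. a_lam (a_id (a_bang V El (a_bang V El A)) W
        (bang_pair V El (a_bang V El A) S (a_lam (El \<bullet> S) (\<lambda>s. P \<bullet> s)))) (\<lambda>Q.
        a_lam (El \<bullet> S \<mapsto> a_univ 0) (\<lambda>Y. a_lam (a_pi (El \<bullet> S) (\<lambda>x. Y \<bullet> x \<mapsto> A)) (\<lambda>q.
        let D = (\<lambda>W. rep V El A (mu \<bullet> A \<bullet> W) (a_sig (El \<bullet> S) (\<lambda>x. Y \<bullet> x)) (sig_label A q));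
            E = (\<lambda>P. bang_pair V El (a_bang V El A) S (a_lam (El \<bullet> S) (\<lambda>s. P \<bullet> s)));
            B = (\<lambda>x S'. a_id (a_univ 0) (El \<bullet> S') (Y \<bullet> x));
            C = (\<lambda>x S' i. a_id (a_bang V El A) (P \<bullet> x) (bang_via V El A S' (Y \<bullet> x) i (\<lambda>y. q \<bullet> x \<bullet> y)))
        in
        a_lam (a_pi (El \<bullet> S) (\<lambda>x. rep V El A (P \<bullet> x) (Y \<bullet> x) (\<lambda>y. q \<bullet> x \<bullet> y))) (\<lambda>RR.
         ac \<bullet> (El \<bullet> S) \<bullet> V \<bullet> a_lam (El \<bullet> S) (\<lambda>x. a_lam V (\<lambda>S'. B x S'))
          \<bullet> a_lam (El \<bullet> S) (\<lambda>x. a_lam V (\<lambda>S'. a_lam (B x S') (\<lambda>i. C x S' i)))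
          \<bullet> D W \<bullet> RR
          \<bullet> a_lam (El \<bullet> S \<mapsto> V) (\<lambda>H. a_lam (a_pi (El \<bullet> S) (\<lambda>x. B x (H \<bullet> x))) (\<lambda>j.
            a_lam (a_pi (El \<bullet> S) (\<lambda>x. C x (H \<bullet> x) (j \<bullet> x))) (\<lambda>k.
            let P' = a_lam (El \<bullet> S) (\<lambda>x. bang_via V El A (H \<bullet> x) (Y \<bullet> x) (j \<bullet> x) (\<lambda>y. q \<bullet> x \<bullet> y)) in
            tr \<bullet> a_bang V El (a_bang V El A) \<bullet> a_lam (a_bang V El (a_bang V El A)) (\<lambda>W. D W) \<bullet> W \<bullet> E P
              \<bullet> Q
             \<bullet> (tr \<bullet> (El \<bullet> S \<mapsto> a_bang V El A) \<bullet> a_lam (El \<bullet> S \<mapsto> a_bang V El A) (\<lambda>P. D (E P)) \<bullet> P \<bullet> P'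
                 \<bullet> (fe0 \<bullet> (El \<bullet> S) \<bullet> a_bang V El A \<bullet> P \<bullet> P' \<bullet> k)
                 \<bullet> (mufam \<bullet> A \<bullet> S \<bullet> H \<bullet> Y \<bullet> j \<bullet> q))))))))))
      \<bullet> X \<bullet> i \<bullet> P \<bullet> Q) u) R)))))))))))))"

section \<open>The monad laws from representations\<close>

text \<open>Here \<open>T\<close>, \<open>mp\<close>, \<open>mu\<close>, \<open>eta\<close> and the relation \<open>R A w X r\<close> of being represented are variables. The
  last argument of \<open>R\<close> is eta-expanded throughout, since the checker has no eta rule.\<close>

definition "uniq_on T0 R0 A = uniq_clause (\<lambda>_. T0) (\<lambda>_ w X r. R0 \<bullet> w \<bullet> X \<bullet> a_lam X r) A"
text \<open>The relation takes values one universe up because \<open>rep\<close> contains an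
  identification between types.\<close>

definition "rep_on T0 A = (T0 \<mapsto> a_pi (a_univ 0) (\<lambda>X. (X \<mapsto> A) \<mapsto> a_univ 1))"
definition "pi_uniq k = a_pi (a_univ 0) (\<lambda>A. a_pi (a_univ 0)
  (\<lambda>T0. a_pi (rep_on T0 A) (\<lambda>R0. uniq_on T0 R0 A \<mapsto> k A T0 R0)))"
definition "lam_uniq k = a_lam (a_univ 0) (\<lambda>A. a_lam (a_univ 0)
  (\<lambda>T0. a_lam (rep_on T0 A) (\<lambda>R0. a_lam (uniq_on T0 R0 A) (\<lambda>u. k A T0 R0 u))))"
definition "uniq_concl T0 R0 X r X' r' = a_pi T0
  (\<lambda>w. a_pi T0 (\<lambda>w'. R0 \<bullet> w \<bullet> X \<bullet> a_lam X (\<lambda>x. r \<bullet> x) \<mapsto> R0 \<bullet> w' \<bullet> X' \<bullet> a_lam X' (\<lambda>x. r' \<bullet> x) \<mapsto> a_id T0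
  w w'))"

section \<open>Uniqueness along canonical equivalences\<close>

definition "T_unique_same = pi_uniq (\<lambda>A T0 R0. a_pi (a_univ 0) (\<lambda>X. a_pi (X \<mapsto> A) (\<lambda>r. a_pi (X \<mapsto> A) (\<lambda>r'.
   a_pi X (\<lambda>x. a_id A (r \<bullet> x) (r' \<bullet> x)) \<mapsto> uniq_concl T0 R0 X r X r'))))"
definition "t_unique_same = lam_uniq (\<lambda>A T0 R0 u. a_lam (a_univ 0)
  (\<lambda>X. u \<bullet> X \<bullet> X \<bullet> a_idfun X \<bullet> a_idfun X \<bullet> a_lam X (\<lambda>x. a_refl x) \<bullet> a_lam X (\<lambda>x. a_refl x)))"

definition "T_unique_right_unit = pi_uniq (\<lambda>A T0 R0. a_pi (a_univ 0)
  (\<lambda>X. a_pi (X \<odot> a_one \<mapsto> A) (\<lambda>r. a_pi (X \<mapsto> A) (\<lambda>r'.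
   a_pi X (\<lambda>x. a_id A (r \<bullet> a_pair X (\<lambda>_. a_one) x a_star) (r' \<bullet> x)) \<mapsto> uniq_concl T0 R0 (X \<odot> a_one) r X
     r'))))"
text \<open>Projection and pairing with \<open>a_star\<close> are inverse by induction on pairs and
  on the unit type; the comparison of labels needs the same two inductions.\<close>

definition "t_unique_right_unit = lam_uniq (\<lambda>A T0 R0 u. a_lam (a_univ 0)
  (\<lambda>X. a_lam (X \<odot> a_one \<mapsto> A) (\<lambda>r. a_lam (X \<mapsto> A) (\<lambda>r'.
   a_lam (a_pi X (\<lambda>x. a_id A (r \<bullet> a_pair X (\<lambda>_. a_one) x a_star) (r' \<bullet> x))) (\<lambda>h.
    let pr = (\<lambda>x y. a_pair X (\<lambda>_. a_one) x y); f = a_lam (X \<odot> a_one)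
      (\<lambda>z. a_ind_sig (\<lambda>_. X) (\<lambda>x y. x) z); g = a_lam X (\<lambda>x. pr x a_star) in
    u \<bullet> (X \<odot> a_one) \<bullet> X \<bullet> f \<bullet> g
     \<bullet> a_lam X (\<lambda>x. a_refl x)
     \<bullet> a_lam (X \<odot> a_one) (\<lambda>z. a_ind_sig (\<lambda>z. a_id (X \<odot> a_one) (g \<bullet> (f \<bullet> z)) z)
          (\<lambda>x y. a_ind_one (\<lambda>y. a_id (X \<odot> a_one) (pr x a_star) (pr x y)) (a_refl (pr x a_star)) y) z)
     \<bullet> r \<bullet> r'
     \<bullet> a_lam (X \<odot> a_one) (\<lambda>z. a_ind_sig (\<lambda>z. a_id A (r \<bullet> z) (r' \<bullet> (f \<bullet> z)))
          (\<lambda>x y. a_ind_one (\<lambda>y. a_id A (r \<bullet> pr x y) (r' \<bullet> x)) (h \<bullet> x) y) z))))))"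

definition "T_unique_left_unit = pi_uniq (\<lambda>A T0 R0. a_pi (a_univ 0)
  (\<lambda>X. a_pi (a_one \<odot> X \<mapsto> A) (\<lambda>r. a_pi (X \<mapsto> A) (\<lambda>r'.
   a_pi X (\<lambda>x. a_id A (r \<bullet> a_pair a_one (\<lambda>_. X) a_star x) (r' \<bullet> x)) \<mapsto> uniq_concl T0 R0 (a_one \<odot> X) r X
     r'))))"
definition "t_unique_left_unit = lam_uniq (\<lambda>A T0 R0 u. a_lam (a_univ 0)
  (\<lambda>X. a_lam (a_one \<odot> X \<mapsto> A) (\<lambda>r. a_lam (X \<mapsto> A) (\<lambda>r'.
   a_lam (a_pi X (\<lambda>x. a_id A (r \<bullet> a_pair a_one (\<lambda>_. X) a_star x) (r' \<bullet> x))) (\<lambda>h.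
    let pr = (\<lambda>y x. a_pair a_one (\<lambda>_. X) y x); f = a_lam (a_one \<odot> X)
      (\<lambda>z. a_ind_sig (\<lambda>_. X) (\<lambda>y x. x) z); g = a_lam X (\<lambda>x. pr a_star x) in
    u \<bullet> (a_one \<odot> X) \<bullet> X \<bullet> f \<bullet> g
     \<bullet> a_lam X (\<lambda>x. a_refl x)
     \<bullet> a_lam (a_one \<odot> X) (\<lambda>z. a_ind_sig (\<lambda>z. a_id (a_one \<odot> X) (g \<bullet> (f \<bullet> z)) z)
          (\<lambda>y x. a_ind_one (\<lambda>y. a_id (a_one \<odot> X) (pr a_star x) (pr y x)) (a_refl (pr a_star x)) y) z)
     \<bullet> r \<bullet> r'
     \<bullet> a_lam (a_one \<odot> X) (\<lambda>z. a_ind_sig (\<lambda>z. a_id A (r \<bullet> z) (r' \<bullet> (f \<bullet> z)))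
          (\<lambda>y x. a_ind_one (\<lambda>y. a_id A (r \<bullet> pr y x) (r' \<bullet> x)) (h \<bullet> x) y) z))))))"

definition "assoc_pair X Y x y = a_pair X (\<lambda>x. Y \<bullet> x) x y"
definition "assoc_inner X Y C x = a_sig (Y \<bullet> x) (\<lambda>y. C \<bullet> assoc_pair X Y x y)"
definition "assoc_left X Y C = a_sig X (\<lambda>x. assoc_inner X Y C x)"
definition "assoc_base X Y = a_sig X (\<lambda>x. Y \<bullet> x)"
definition "assoc_right X Y C = a_sig (assoc_base X Y) (\<lambda>z. C \<bullet> z)"
definition "assoc_left_pair X Y C x y c = a_pair X (\<lambda>x. assoc_inner X Y C x) x
  (a_pair (Y \<bullet> x) (\<lambda>y. C \<bullet> assoc_pair X Y x y) y c)"
definition "assoc_right_pair X Y C z c = a_pair (assoc_base X Y) (\<lambda>z. C \<bullet> z) z c"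
definition "T_unique_assoc = pi_uniq (\<lambda>A T0 R0. a_pi (a_univ 0)
  (\<lambda>X. a_pi (X \<mapsto> a_univ 0) (\<lambda>Y. a_pi (assoc_base X Y \<mapsto> a_univ 0) (\<lambda>C.
   a_pi (assoc_left X Y C \<mapsto> A) (\<lambda>r. a_pi (assoc_right X Y C \<mapsto> A) (\<lambda>r'.
    a_pi X (\<lambda>x. a_pi (Y \<bullet> x) (\<lambda>y. a_pi (C \<bullet> assoc_pair X Y x y)
      (\<lambda>c. a_id A (r \<bullet> assoc_left_pair X Y C x y c)
      (r' \<bullet> assoc_right_pair X Y C (assoc_pair X Y x y) c))))
      \<mapsto> uniq_concl T0 R0 (assoc_left X Y C) r (assoc_right X Y C) r'))))))"
text \<open>When the pair \<open>z\<close> is split, the component \<open>c\<close> of type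
  \<open>C \<bullet> z\<close> changes type with it. The inner motives therefore abstract over
  \<open>c\<close> and the result is applied to it.\<close>

definition "t_unique_assoc = lam_uniq (\<lambda>A T0 R0 u. a_lam (a_univ 0)
  (\<lambda>X. a_lam (X \<mapsto> a_univ 0) (\<lambda>Y. a_lam (assoc_base X Y \<mapsto> a_univ 0) (\<lambda>C.
   a_lam (assoc_left X Y C \<mapsto> A) (\<lambda>r. a_lam (assoc_right X Y C \<mapsto> A) (\<lambda>r'.
   a_lam (a_pi X (\<lambda>x. a_pi (Y \<bullet> x) (\<lambda>y. a_pi (C \<bullet> assoc_pair X Y x y)
     (\<lambda>c. a_id A (r \<bullet> assoc_left_pair X Y C x y c)
     (r' \<bullet> assoc_right_pair X Y C (assoc_pair X Y x y) c)))))
   (\<lambda>h. let D = assoc_left X Y C; E = assoc_right X Y C;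
        f = a_lam D (\<lambda>u. a_ind_sig (\<lambda>_. E) (\<lambda>x v. a_ind_sig (\<lambda>_. E)
          (\<lambda>y c. assoc_right_pair X Y C (assoc_pair X Y x y) c) v) u);
        g = a_lam E (\<lambda>u. a_ind_sig (\<lambda>_. D) (\<lambda>z c. a_ind_sig (\<lambda>z. C \<bullet> z \<mapsto> D)
          (\<lambda>x y. a_lam (C \<bullet> assoc_pair X Y x y) (\<lambda>c. assoc_left_pair X Y C x y c)) z \<bullet> c) u) in
     u \<bullet> D \<bullet> E \<bullet> f \<bullet> g
     \<bullet> a_lam E (\<lambda>u. a_ind_sig (\<lambda>u. a_id E (f \<bullet> (g \<bullet> u)) u) (\<lambda>z c.
          a_ind_sig (\<lambda>z. a_pi (C \<bullet> z) (\<lambda>c. a_id E (f \<bullet> (g \<bullet> assoc_right_pair X Y C z c))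
            (assoc_right_pair X Y C z c)))
            (\<lambda>x y. a_lam (C \<bullet> assoc_pair X Y x y) (\<lambda>c. a_refl
              (assoc_right_pair X Y C (assoc_pair X Y x y) c))) z \<bullet> c) u)
     \<bullet> a_lam D (\<lambda>u. a_ind_sig (\<lambda>u. a_id D (g \<bullet> (f \<bullet> u)) u) (\<lambda>x v.
          a_ind_sig (\<lambda>v. let w = a_pair X (\<lambda>x. assoc_inner X Y C x) x v in a_id D (g \<bullet> (f \<bullet> w)) w)
            (\<lambda>y c. a_refl (assoc_left_pair X Y C x y c)) v) u)
     \<bullet> r \<bullet> r'
     \<bullet> a_lam D (\<lambda>u. a_ind_sig (\<lambda>u. a_id A (r \<bullet> u) (r' \<bullet> (f \<bullet> u))) (\<lambda>x v.
          a_ind_sig (\<lambda>v. let w = a_pair X (\<lambda>x. assoc_inner X Y C x) x v in a_id A (r \<bullet> w)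
            (r' \<bullet> (f \<bullet> w))) (\<lambda>y c. h \<bullet> x \<bullet> y \<bullet> c) v) u))))))))"

section \<open>The abstract structure: operations with a relation of representation\<close>

definition "ty_T = (a_univ 0 \<mapsto> a_univ 0)"
definition "ty_map T = a_pi (a_univ 0) (\<lambda>A. a_pi (a_univ 0) (\<lambda>B. (A \<mapsto> B) \<mapsto> (T \<bullet> A \<mapsto> T \<bullet> B)))"
definition "ty_mu T = a_pi (a_univ 0) (\<lambda>A. T \<bullet> (T \<bullet> A) \<mapsto> T \<bullet> A)"
definition "ty_eta T = a_pi (a_univ 0) (\<lambda>A. A \<mapsto> T \<bullet> A)"
definition "ty_R T = a_pi (a_univ 0) (\<lambda>A. rep_on (T \<bullet> A) A)"
text \<open>That every element is represented is given by functions: carrier \<open>car\<close>,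
  label \<open>lab\<close> and proof \<open>tot\<close>. Representations of a family of elements are
  then obtained by composition, with no choice.\<close>

definition "ty_car T = a_pi (a_univ 0) (\<lambda>A. T \<bullet> A \<mapsto> a_univ 0)"
definition "ty_lab T car = a_pi (a_univ 0) (\<lambda>A. a_pi (T \<bullet> A) (\<lambda>w. car \<bullet> A \<bullet> w \<mapsto> A))"
definition "ty_tot T R car lab = a_pi (a_univ 0)
  (\<lambda>A. a_pi (T \<bullet> A) (\<lambda>w. R \<bullet> A \<bullet> w \<bullet> (car \<bullet> A \<bullet> w) \<bullet> a_lam (car \<bullet> A \<bullet> w) (\<lambda>x. lab \<bullet> A \<bullet> w \<bullet> x)))"
definition "ty_uniq T R = a_pi (a_univ 0) (\<lambda>A. uniq_clause (\<lambda>A. T \<bullet> A)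
  (\<lambda>A w X r. R \<bullet> A \<bullet> w \<bullet> X \<bullet> a_lam X r) A)"
definition "ty_rmap T R mp = a_pi (a_univ 0) (\<lambda>A. map_clause (\<lambda>A. T \<bullet> A)
  (\<lambda>A w X r. R \<bullet> A \<bullet> w \<bullet> X \<bullet> a_lam X r) mp A)"
definition "ty_reta R eta = a_pi (a_univ 0) (\<lambda>A. a_pi A
  (\<lambda>a. R \<bullet> A \<bullet> (eta \<bullet> A \<bullet> a) \<bullet> a_one \<bullet> a_lam a_one (\<lambda>_. a)))"
definition "ty_rmu T R mu = a_pi (a_univ 0) (\<lambda>A. mu_clause (\<lambda>A. T \<bullet> A)
  (\<lambda>A w X r. R \<bullet> A \<bullet> w \<bullet> X \<bullet> a_lam X r) mu A)"

definition "pi_rep_structure k = a_pi ty_T (\<lambda>T. a_pi (ty_map T)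
  (\<lambda>mp. a_pi (ty_mu T) (\<lambda>mu. a_pi (ty_eta T) (\<lambda>eta.
   a_pi (ty_R T) (\<lambda>R. a_pi (ty_car T) (\<lambda>car. a_pi (ty_lab T car) (\<lambda>lab. a_pi (ty_tot T R car lab) (\<lambda>tot.
   a_pi (ty_uniq T R) (\<lambda>uniq. a_pi (ty_rmap T R mp)
     (\<lambda>rmap. a_pi (ty_reta R eta) (\<lambda>reta. a_pi (ty_rmu T R mu) (\<lambda>rmu.
    k T mp mu eta))))))))))))"
definition "lam_rep_structure k = a_lam ty_T (\<lambda>T. a_lam (ty_map T)
  (\<lambda>mp. a_lam (ty_mu T) (\<lambda>mu. a_lam (ty_eta T) (\<lambda>eta.
   a_lam (ty_R T) (\<lambda>R. a_lam (ty_car T) (\<lambda>car. a_lam (ty_lab T car)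
     (\<lambda>lab. a_lam (ty_tot T R car lab) (\<lambda>tot.
   a_lam (ty_uniq T R) (\<lambda>uniq. a_lam (ty_rmap T R mp)
     (\<lambda>rmap. a_lam (ty_reta R eta) (\<lambda>reta. a_lam (ty_rmu T R mu) (\<lambda>rmu.
    k T mp mu eta R car lab tot uniq rmap reta rmu))))))))))))"

definition "law_map_id T mp mu eta = a_pi (a_univ 0)
  (\<lambda>A. a_id (T \<bullet> A \<mapsto> T \<bullet> A) (mp \<bullet> A \<bullet> A \<bullet> a_idfun A) (a_idfun (T \<bullet> A)))"
definition "law_map_comp T mp mu eta = a_pi (a_univ 0)
  (\<lambda>A. a_pi (a_univ 0) (\<lambda>B. a_pi (a_univ 0) (\<lambda>C. a_pi (A \<mapsto> B) (\<lambda>f. a_pi (B \<mapsto> C) (\<lambda>g.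
         a_id (T \<bullet> A \<mapsto> T \<bullet> C) (mp \<bullet> A \<bullet> C \<bullet> a_compose A g f)
           (a_compose (T \<bullet> A) (mp \<bullet> B \<bullet> C \<bullet> g) (mp \<bullet> A \<bullet> B \<bullet> f)))))))"
definition "law_mu_nat T mp mu eta = a_pi (a_univ 0) (\<lambda>A. a_pi (a_univ 0) (\<lambda>B. a_pi (A \<mapsto> B) (\<lambda>f.
         a_id (T \<bullet> (T \<bullet> A) \<mapsto> T \<bullet> B)
           (a_compose (T \<bullet> (T \<bullet> A)) (mu \<bullet> B) (mp \<bullet> (T \<bullet> A) \<bullet> (T \<bullet> B) \<bullet> (mp \<bullet> A \<bullet> B \<bullet> f)))
           (a_compose (T \<bullet> (T \<bullet> A)) (mp \<bullet> A \<bullet> B \<bullet> f) (mu \<bullet> A)))))"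
definition "law_eta_nat T mp mu eta = a_pi (a_univ 0) (\<lambda>A. a_pi (a_univ 0) (\<lambda>B. a_pi (A \<mapsto> B) (\<lambda>f.
         a_id (A \<mapsto> T \<bullet> B) (a_compose A (eta \<bullet> B) f) (a_compose A (mp \<bullet> A \<bullet> B \<bullet> f) (eta \<bullet> A)))))"
definition "law_mu_assoc T mp mu eta = a_pi (a_univ 0) (\<lambda>A.
         a_id (T \<bullet> (T \<bullet> (T \<bullet> A)) \<mapsto> T \<bullet> A)
           (a_compose (T \<bullet> (T \<bullet> (T \<bullet> A))) (mu \<bullet> A) (mp \<bullet> (T \<bullet> (T \<bullet> A)) \<bullet> (T \<bullet> A) \<bullet> (mu \<bullet> A)))
           (a_compose (T \<bullet> (T \<bullet> (T \<bullet> A))) (mu \<bullet> A) (mu \<bullet> (T \<bullet> A))))"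
definition "law_mu_map_eta T mp mu eta = a_pi (a_univ 0) (\<lambda>A.
         a_id (T \<bullet> A \<mapsto> T \<bullet> A) (a_compose (T \<bullet> A) (mu \<bullet> A) (mp \<bullet> A \<bullet> (T \<bullet> A) \<bullet> (eta \<bullet> A)))
           (a_idfun (T \<bullet> A)))"
definition "law_mu_eta T mp mu eta = a_pi (a_univ 0) (\<lambda>A.
         a_id (T \<bullet> A \<mapsto> T \<bullet> A) (a_compose (T \<bullet> A) (mu \<bullet> A) (eta \<bullet> (T \<bullet> A))) (a_idfun (T \<bullet> A)))"

section \<open>Derivations of the seven laws\<close>

definition "by_pointwise fe0 S T f g k = fe0 \<bullet> S \<bullet> T \<bullet> f \<bullet> g \<bullet> a_lam S k"
definition "t_map_id = a_lam T_pointwise_eq (\<lambda>fe0. a_lam T_unique_same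
  (\<lambda>uq. lam_rep_structure (\<lambda>T mp mu eta R car lab tot uniq rmap reta rmu.
   a_lam (a_univ 0) (\<lambda>A. by_pointwise fe0 (T \<bullet> A) (T \<bullet> A) (mp \<bullet> A \<bullet> A \<bullet> a_idfun A) (a_idfun (T \<bullet> A)) (\<lambda>w.
     let X = car \<bullet> A \<bullet> w; l = lab \<bullet> A \<bullet> w in
     uq \<bullet> A \<bullet> (T \<bullet> A) \<bullet> (R \<bullet> A) \<bullet> (uniq \<bullet> A) \<bullet> X \<bullet> a_lam X (\<lambda>x. l \<bullet> x) \<bullet> l \<bullet> a_lam X (\<lambda>x. a_refl (l \<bullet> x))
       \<bullet> (mp \<bullet> A \<bullet> A \<bullet> a_idfun A \<bullet> w) \<bullet> w \<bullet> (rmap \<bullet> A \<bullet> A \<bullet> a_idfun A \<bullet> w \<bullet> X \<bullet> l \<bullet> (tot \<bullet> A \<bullet> w)) \<bullet>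
         (tot \<bullet> A \<bullet> w))))))"
definition "t_map_comp = a_lam T_pointwise_eq
  (\<lambda>fe0. a_lam T_unique_same (\<lambda>uq. lam_rep_structure (\<lambda>T mp mu eta R car lab tot uniq rmap reta rmu.
   a_lam (a_univ 0) (\<lambda>A. a_lam (a_univ 0) (\<lambda>B. a_lam (a_univ 0)
     (\<lambda>C. a_lam (A \<mapsto> B) (\<lambda>f. a_lam (B \<mapsto> C) (\<lambda>g.
     let c = a_lam A (\<lambda>x. g \<bullet> (f \<bullet> x)) in
     by_pointwise fe0 (T \<bullet> A) (T \<bullet> C) (mp \<bullet> A \<bullet> C \<bullet> c)
       (a_lam (T \<bullet> A) (\<lambda>w. mp \<bullet> B \<bullet> C \<bullet> g \<bullet> (mp \<bullet> A \<bullet> B \<bullet> f \<bullet> w))) (\<lambda>w.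
     let X = car \<bullet> A \<bullet> w; l = lab \<bullet> A \<bullet> w; r = a_lam X (\<lambda>x. g \<bullet> (f \<bullet> (l \<bullet> x))) in
     uq \<bullet> C \<bullet> (T \<bullet> C) \<bullet> (R \<bullet> C) \<bullet> (uniq \<bullet> C) \<bullet> X \<bullet> r \<bullet> r \<bullet> a_lam X (\<lambda>x. a_refl (g \<bullet> (f \<bullet> (l \<bullet> x))))
       \<bullet> (mp \<bullet> A \<bullet> C \<bullet> c \<bullet> w) \<bullet> (mp \<bullet> B \<bullet> C \<bullet> g \<bullet> (mp \<bullet> A \<bullet> B \<bullet> f \<bullet> w))
       \<bullet> (rmap \<bullet> A \<bullet> C \<bullet> c \<bullet> w \<bullet> X \<bullet> l \<bullet> (tot \<bullet> A \<bullet> w))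
       \<bullet> (rmap \<bullet> B \<bullet> C \<bullet> g \<bullet> (mp \<bullet> A \<bullet> B \<bullet> f \<bullet> w) \<bullet> X \<bullet> a_lam X (\<lambda>x. f \<bullet> (l \<bullet> x)) \<bullet>
         (rmap \<bullet> A \<bullet> B \<bullet> f \<bullet> w \<bullet> X \<bullet> l \<bullet> (tot \<bullet> A \<bullet> w))))))))))))"
text \<open>Both sides are represented on the same sum. The labels differ only in whether
  \<open>f\<close> is applied inside or outside the eliminator, which is not a judgemental equality
  and is settled by splitting the pair.\<close>

definition "t_mu_nat = a_lam T_pointwise_eq (\<lambda>fe0. a_lam T_unique_same
  (\<lambda>uq. lam_rep_structure (\<lambda>T mp mu eta R car lab tot uniq rmap reta rmu.
   a_lam (a_univ 0) (\<lambda>A. a_lam (a_univ 0) (\<lambda>B. a_lam (A \<mapsto> B) (\<lambda>f.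
     let F = mp \<bullet> A \<bullet> B \<bullet> f in
     by_pointwise fe0 (T \<bullet> (T \<bullet> A)) (T \<bullet> B) (a_lam (T \<bullet> (T \<bullet> A))
       (\<lambda>W. mu \<bullet> B \<bullet> (mp \<bullet> (T \<bullet> A) \<bullet> (T \<bullet> B) \<bullet> F \<bullet> W)))
       (a_lam (T \<bullet> (T \<bullet> A)) (\<lambda>W. F \<bullet> (mu \<bullet> A \<bullet> W))) (\<lambda>W.
     let X = car \<bullet> (T \<bullet> A) \<bullet> W; P = lab \<bullet> (T \<bullet> A) \<bullet> W; Y = (\<lambda>x. car \<bullet> A \<bullet> (P \<bullet> x)); q =
       (\<lambda>x. lab \<bullet> A \<bullet> (P \<bullet> x)); S = a_sig X Y;
      W1 = mp \<bullet> (T \<bullet> A) \<bullet> (T \<bullet> B) \<bullet> F \<bullet> W;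
      L1 = rmap \<bullet> (T \<bullet> A) \<bullet> (T \<bullet> B) \<bullet> F \<bullet> W \<bullet> X \<bullet> P \<bullet> (tot \<bullet> (T \<bullet> A) \<bullet> W);
      L2 = rmu \<bullet> B \<bullet> W1 \<bullet> X \<bullet> a_lam X (\<lambda>x. F \<bullet> (P \<bullet> x)) \<bullet> L1 \<bullet> a_lam X Y \<bullet> a_lam X
        (\<lambda>x. a_lam (Y x) (\<lambda>y. f \<bullet> (q x \<bullet> y)))
         \<bullet> a_lam X (\<lambda>x. rmap \<bullet> A \<bullet> B \<bullet> f \<bullet> (P \<bullet> x) \<bullet> Y x \<bullet> q x \<bullet> (tot \<bullet> A \<bullet> (P \<bullet> x)));
      R1 = rmu \<bullet> A \<bullet> W \<bullet> X \<bullet> P \<bullet> (tot \<bullet> (T \<bullet> A) \<bullet> W) \<bullet> a_lam X Y \<bullet> a_lam X q \<bullet> a_lam X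
        (\<lambda>x. tot \<bullet> A \<bullet> (P \<bullet> x));
      rl = a_lam S (\<lambda>z. a_ind_sig (\<lambda>_. B) (\<lambda>x y. f \<bullet> (q x \<bullet> y)) z);
      r0 = a_lam S (\<lambda>z. a_ind_sig (\<lambda>_. A) (\<lambda>x y. q x \<bullet> y) z);
      R2 = rmap \<bullet> A \<bullet> B \<bullet> f \<bullet> (mu \<bullet> A \<bullet> W) \<bullet> S \<bullet> r0 \<bullet> R1;
      rr = a_lam S (\<lambda>z. f \<bullet> a_ind_sig (\<lambda>_. A) (\<lambda>x y. q x \<bullet> y) z)
     in
     uq \<bullet> B \<bullet> (T \<bullet> B) \<bullet> (R \<bullet> B) \<bullet> (uniq \<bullet> B) \<bullet> S \<bullet> rl \<bullet> rr
       \<bullet> a_lam S (\<lambda>z. a_ind_sig (\<lambda>z. a_id B (a_ind_sig (\<lambda>_. B) (\<lambda>x y. f \<bullet> (q x \<bullet> y)) z)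
         (f \<bullet> a_ind_sig (\<lambda>_. A) (\<lambda>x y. q x \<bullet> y) z)) (\<lambda>x y. a_refl (f \<bullet> (q x \<bullet> y))) z)
       \<bullet> (mu \<bullet> B \<bullet> W1) \<bullet> (F \<bullet> (mu \<bullet> A \<bullet> W)) \<bullet> L2 \<bullet> R2)))))))"
definition "t_eta_nat = a_lam T_pointwise_eq (\<lambda>fe0. a_lam T_unique_same
  (\<lambda>uq. lam_rep_structure (\<lambda>T mp mu eta R car lab tot uniq rmap reta rmu.
   a_lam (a_univ 0) (\<lambda>A. a_lam (a_univ 0) (\<lambda>B. a_lam (A \<mapsto> B) (\<lambda>f.
     by_pointwise fe0 A (T \<bullet> B) (a_lam A (\<lambda>a. eta \<bullet> B \<bullet> (f \<bullet> a)))
       (a_lam A (\<lambda>a. mp \<bullet> A \<bullet> B \<bullet> f \<bullet> (eta \<bullet> A \<bullet> a))) (\<lambda>a.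
     let r = a_lam a_one (\<lambda>_. f \<bullet> a) in
     uq \<bullet> B \<bullet> (T \<bullet> B) \<bullet> (R \<bullet> B) \<bullet> (uniq \<bullet> B) \<bullet> a_one \<bullet> r \<bullet> r \<bullet> a_lam a_one (\<lambda>_. a_refl (f \<bullet> a))
       \<bullet> (eta \<bullet> B \<bullet> (f \<bullet> a)) \<bullet> (mp \<bullet> A \<bullet> B \<bullet> f \<bullet> (eta \<bullet> A \<bullet> a)) \<bullet> (reta \<bullet> B \<bullet> (f \<bullet> a))
       \<bullet> (rmap \<bullet> A \<bullet> B \<bullet> f \<bullet> (eta \<bullet> A \<bullet> a) \<bullet> a_one \<bullet> a_lam a_one (\<lambda>_. a) \<bullet> (reta \<bullet> A \<bullet> a)))))))))"
text \<open>One side is represented on the sum over \<open>X\<close> of the sums of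
  \<open>Z x\<close> over \<open>Y x\<close>, the other on a sum over pairs. The family
  \<open>C\<close> over pairs is defined through \<open>P'\<close>, which reduces to
  \<open>P x y\<close> on a pair, so the labels agree by reflexivity.\<close>

definition "t_mu_assoc = a_lam T_pointwise_eq
  (\<lambda>fe0. a_lam T_unique_assoc (\<lambda>uq. lam_rep_structure (\<lambda>T mp mu eta R car lab tot uniq rmap reta rmu.
   a_lam (a_univ 0) (\<lambda>A. let TA = T \<bullet> A; TTA = T \<bullet> TA; TTTA = T \<bullet> TTA in
     by_pointwise fe0 TTTA TA (a_lam TTTA (\<lambda>W. mu \<bullet> A \<bullet> (mp \<bullet> TTA \<bullet> TA \<bullet> (mu \<bullet> A) \<bullet> W)))
       (a_lam TTTA (\<lambda>W. mu \<bullet> A \<bullet> (mu \<bullet> TA \<bullet> W))) (\<lambda>W.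
     let X = car \<bullet> TTA \<bullet> W; p = (\<lambda>x. lab \<bullet> TTA \<bullet> W \<bullet> x); Y = (\<lambda>x. car \<bullet> TA \<bullet> p x); P =
       (\<lambda>x y. lab \<bullet> TA \<bullet> p x \<bullet> y);
       Z = (\<lambda>x y. car \<bullet> A \<bullet> P x y); q = (\<lambda>x y z. lab \<bullet> A \<bullet> P x y \<bullet> z);
       W1 = mp \<bullet> TTA \<bullet> TA \<bullet> (mu \<bullet> A) \<bullet> W;
       L1 = rmap \<bullet> TTA \<bullet> TA \<bullet> (mu \<bullet> A) \<bullet> W \<bullet> X \<bullet> (lab \<bullet> TTA \<bullet> W) \<bullet> (tot \<bullet> TTA \<bullet> W);
       L2 = (\<lambda>x. rmu \<bullet> A \<bullet> p x \<bullet> Y x \<bullet> (lab \<bullet> TA \<bullet> p x) \<bullet> (tot \<bullet> TA \<bullet> p x) \<bullet> a_lam (Y x) (Z x) \<bullet> a_lam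
         (Y x) (\<lambda>y. lab \<bullet> A \<bullet> P x y)
              \<bullet> a_lam (Y x) (\<lambda>y. tot \<bullet> A \<bullet> P x y));
       l2 = (\<lambda>x. a_lam (a_sig (Y x) (Z x)) (\<lambda>v. a_ind_sig (\<lambda>_. A) (\<lambda>y z. q x y z) v));
       L3 = rmu \<bullet> A \<bullet> W1 \<bullet> X \<bullet> a_lam X (\<lambda>x. mu \<bullet> A \<bullet> p x) \<bullet> L1 \<bullet> a_lam X (\<lambda>x. a_sig (Y x) (Z x)) \<bullet>
         a_lam X l2 \<bullet> a_lam X L2;
       rl = a_lam (a_sig X (\<lambda>x. a_sig (Y x) (Z x))) (\<lambda>u. a_ind_sig (\<lambda>_. A)
         (\<lambda>x v. a_ind_sig (\<lambda>_. A) (\<lambda>y z. q x y z) v) u);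
       S = a_sig X Y; P' = (\<lambda>z. a_ind_sig (\<lambda>_. TA) (\<lambda>x y. P x y) z);
       R1 = rmu \<bullet> TA \<bullet> W \<bullet> X \<bullet> (lab \<bullet> TTA \<bullet> W) \<bullet> (tot \<bullet> TTA \<bullet> W) \<bullet> a_lam X Y \<bullet> a_lam X
         (\<lambda>x. lab \<bullet> TA \<bullet> p x) \<bullet> a_lam X (\<lambda>x. tot \<bullet> TA \<bullet> p x);
       C = a_lam S (\<lambda>z. car \<bullet> A \<bullet> P' z);
       R2 = rmu \<bullet> A \<bullet> (mu \<bullet> TA \<bullet> W) \<bullet> S \<bullet> a_lam S P' \<bullet> R1 \<bullet> C \<bullet> a_lam S (\<lambda>z. lab \<bullet> A \<bullet> P' z) \<bullet> a_lam S
         (\<lambda>z. tot \<bullet> A \<bullet> P' z);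
       rr = a_lam (a_sig S (\<lambda>z. car \<bullet> A \<bullet> P' z)) (\<lambda>u. a_ind_sig (\<lambda>_. A) (\<lambda>z c. lab \<bullet> A \<bullet> P' z \<bullet> c) u)
     in
     uq \<bullet> A \<bullet> TA \<bullet> (R \<bullet> A) \<bullet> (uniq \<bullet> A) \<bullet> X \<bullet> a_lam X Y \<bullet> C \<bullet> rl \<bullet> rr
       \<bullet> a_lam X (\<lambda>x. a_lam (Y x) (\<lambda>y. a_lam (Z x y) (\<lambda>c. a_refl (q x y c))))
       \<bullet> (mu \<bullet> A \<bullet> W1) \<bullet> (mu \<bullet> A \<bullet> (mu \<bullet> TA \<bullet> W)) \<bullet> L3 \<bullet> R2)))))"
text \<open>Here the multiplication is represented on the sum of copies of the unit type over
  \<open>X\<close>, with the unit type as second factor.\<close>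

definition "t_mu_map_eta = a_lam T_pointwise_eq
  (\<lambda>fe0. a_lam T_unique_right_unit (\<lambda>uq. lam_rep_structure
  (\<lambda>T mp mu eta R car lab tot uniq rmap reta rmu.
   a_lam (a_univ 0) (\<lambda>A. by_pointwise fe0 (T \<bullet> A) (T \<bullet> A)
     (a_lam (T \<bullet> A) (\<lambda>w. mu \<bullet> A \<bullet> (mp \<bullet> A \<bullet> (T \<bullet> A) \<bullet> (eta \<bullet> A) \<bullet> w))) (a_idfun (T \<bullet> A)) (\<lambda>w.
     let X = car \<bullet> A \<bullet> w; l = lab \<bullet> A \<bullet> w; w1 = mp \<bullet> A \<bullet> (T \<bullet> A) \<bullet> (eta \<bullet> A) \<bullet> w in
     uq \<bullet> A \<bullet> (T \<bullet> A) \<bullet> (R \<bullet> A) \<bullet> (uniq \<bullet> A) \<bullet> X \<bullet> a_lam (X \<odot> a_one)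
       (\<lambda>z. a_ind_sig (\<lambda>_. A) (\<lambda>x y. l \<bullet> x) z) \<bullet> l \<bullet> a_lam X (\<lambda>x. a_refl (l \<bullet> x))
       \<bullet> (mu \<bullet> A \<bullet> w1) \<bullet> w
       \<bullet> (rmu \<bullet> A \<bullet> w1 \<bullet> X \<bullet> a_lam X (\<lambda>x. eta \<bullet> A \<bullet> (l \<bullet> x)) \<bullet>
         (rmap \<bullet> A \<bullet> (T \<bullet> A) \<bullet> (eta \<bullet> A) \<bullet> w \<bullet> X \<bullet> l \<bullet> (tot \<bullet> A \<bullet> w))
           \<bullet> a_lam X (\<lambda>_. a_one) \<bullet> a_lam X (\<lambda>x. a_lam a_one (\<lambda>_. l \<bullet> x)) \<bullet> a_lam X
             (\<lambda>x. reta \<bullet> A \<bullet> (l \<bullet> x)))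
       \<bullet> (tot \<bullet> A \<bullet> w))))))"
text \<open>Now the unit type is the index: \<open>eta\<close> at \<open>w\<close> is represented by
  the constant family \<open>w\<close>, so the total space is a product with the unit type on the
  left.\<close>

definition "t_mu_eta = a_lam T_pointwise_eq (\<lambda>fe0. a_lam T_unique_left_unit
  (\<lambda>uq. lam_rep_structure (\<lambda>T mp mu eta R car lab tot uniq rmap reta rmu.
   a_lam (a_univ 0) (\<lambda>A. by_pointwise fe0 (T \<bullet> A) (T \<bullet> A)
     (a_lam (T \<bullet> A) (\<lambda>w. mu \<bullet> A \<bullet> (eta \<bullet> (T \<bullet> A) \<bullet> w))) (a_idfun (T \<bullet> A)) (\<lambda>w.
     let X = car \<bullet> A \<bullet> w; l = lab \<bullet> A \<bullet> w; w1 = eta \<bullet> (T \<bullet> A) \<bullet> w in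
     uq \<bullet> A \<bullet> (T \<bullet> A) \<bullet> (R \<bullet> A) \<bullet> (uniq \<bullet> A) \<bullet> X \<bullet> a_lam (a_one \<odot> X)
       (\<lambda>z. a_ind_sig (\<lambda>_. A) (\<lambda>y x. l \<bullet> x) z) \<bullet> l \<bullet> a_lam X (\<lambda>x. a_refl (l \<bullet> x))
       \<bullet> (mu \<bullet> A \<bullet> w1) \<bullet> w
       \<bullet> (rmu \<bullet> A \<bullet> w1 \<bullet> a_one \<bullet> a_lam a_one (\<lambda>_. w) \<bullet> (reta \<bullet> (T \<bullet> A) \<bullet> w)
           \<bullet> a_lam a_one (\<lambda>_. X) \<bullet> a_lam a_one (\<lambda>_. l) \<bullet> a_lam a_one (\<lambda>_. tot \<bullet> A \<bullet> w))
       \<bullet> (tot \<bullet> A \<bullet> w))))))"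
definition "T_map_id = pi_rep_structure law_map_id"
definition "T_map_comp = pi_rep_structure law_map_comp"
definition "T_mu_nat = pi_rep_structure law_mu_nat"
definition "T_eta_nat = pi_rep_structure law_eta_nat"
definition "T_mu_assoc = pi_rep_structure law_mu_assoc"
definition "T_mu_map_eta = pi_rep_structure law_mu_map_eta"
definition "T_mu_eta = pi_rep_structure law_mu_eta"

section \<open>From the laws to the statement about !\<close>

definition "all_laws T mp mu eta = law_map_id T mp mu eta \<odot> law_map_comp T mp mu eta \<odot> law_mu_nat T mp
  mu eta \<odot> law_eta_nat T mp mu eta \<odot>
   law_mu_assoc T mp mu eta \<odot> law_mu_map_eta T mp mu eta \<odot> law_mu_eta T mp mu eta"
definition "a_is_monad = a_lam ty_T (\<lambda>T. a_lam (ty_map T)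
  (\<lambda>mp. a_lam (ty_mu T) (\<lambda>mu. a_lam (ty_eta T) (\<lambda>eta. all_laws T mp mu eta))))"
definition "laws_for M = pi_rep_structure (\<lambda>T mp mu eta. M \<bullet> T \<bullet> mp \<bullet> mu \<bullet> eta)"
definition "T_laws = laws_for a_is_monad"
definition "nd_pair A B x y = a_pair A (\<lambda>_. B) x y"
definition "t_laws = a_lam T_map_id (\<lambda>l1. a_lam T_map_comp
  (\<lambda>l2. a_lam T_mu_nat (\<lambda>l3. a_lam T_eta_nat (\<lambda>l4. a_lam T_mu_assoc
  (\<lambda>l5. a_lam T_mu_map_eta (\<lambda>l6. a_lam T_mu_eta (\<lambda>l7.
   lam_rep_structure (\<lambda>T mp mu eta R car lab tot uniq rmap reta rmu.
    let ap = (\<lambda>l. l \<bullet> T \<bullet> mp \<bullet> mu \<bullet> eta \<bullet> R \<bullet> car \<bullet> lab \<bullet> tot \<bullet> uniq \<bullet> rmap \<bullet> reta \<bullet> rmu);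
      k1 = law_map_id T mp mu eta; k2 = law_map_comp T mp mu eta; k3 = law_mu_nat T mp mu eta; k4 =
        law_eta_nat T mp mu eta; k5 = law_mu_assoc T mp mu eta;
      k6 = law_mu_map_eta T mp mu eta; k7 = law_mu_eta T mp mu eta in
     nd_pair k1 (k2 \<odot> k3 \<odot> k4 \<odot> k5 \<odot> k6 \<odot> k7) (ap l1)
       (nd_pair k2 (k3 \<odot> k4 \<odot> k5 \<odot> k6 \<odot> k7) (ap l2) (nd_pair k3 (k4 \<odot> k5 \<odot> k6 \<odot> k7) (ap l3)
      (nd_pair k4 (k5 \<odot> k6 \<odot> k7) (ap l4) (nd_pair k5 (k6 \<odot> k7) (ap l5)
        (nd_pair k6 k7 (ap l6) (ap l7)))))))))))))) "
text \<open>\<open>M\<close> takes the place of the predicate of being a monad, so that it is not unfolded when applied to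
  the concrete triple.\<close>

definition "ty_monad_pred = a_pi ty_T (\<lambda>T. a_pi (ty_map T)
  (\<lambda>mp. a_pi (ty_mu T) (\<lambda>mu. a_pi (ty_eta T) (\<lambda>eta. a_univ 1))))"
definition "ty_bang_map V El = a_pi (a_univ 0)
  (\<lambda>A. a_pi (a_univ 0) (\<lambda>B. (A \<mapsto> B) \<mapsto> (a_bang V El A \<mapsto> a_bang V El B)))"
definition "ty_bang_eta V El = a_pi (a_univ 0) (\<lambda>A. A \<mapsto> a_bang V El A)"
definition "ty_bang_uniq V El = a_pi (a_univ 0) (\<lambda>A. uniq_clause (a_bang V El) (rep V El) A)"
definition "ty_bang_rmap V El mp = a_pi (a_univ 0) (\<lambda>A. map_clause (a_bang V El) (rep V El) mp A)"
definition "ty_bang_reta V El eta = a_pi (a_univ 0)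
  (\<lambda>A. a_pi A (\<lambda>a. rep V El A (eta \<bullet> A \<bullet> a) a_one (\<lambda>_. a)))"
definition "ty_bang_rmu V El mu = a_pi (a_univ 0) (\<lambda>A. mu_clause (a_bang V El) (rep V El) mu A)"
definition "T_from_rep = a_pi ty_monad_pred (\<lambda>M. laws_for M \<mapsto> a_pi (a_univ 0)
  (\<lambda>V. a_pi (V \<mapsto> a_univ 0) (\<lambda>El. a_pi (ty_bang_map V El) (\<lambda>mp. a_pi (ty_bang_mu V El) (\<lambda>mu.
   a_pi (ty_bang_eta V El) (\<lambda>eta. ty_bang_uniq V El \<mapsto> ty_bang_rmap V El mp \<mapsto> ty_bang_reta V El eta \<mapsto>
     ty_bang_rmu V El mu \<mapsto> M \<bullet> a_bang_obj V El \<bullet> mp \<bullet> mu \<bullet> eta)))))) "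
definition "t_from_rep = a_lam T_rep_self (\<lambda>rtot. a_lam ty_monad_pred
  (\<lambda>M. a_lam (laws_for M) (\<lambda>mon. a_lam (a_univ 0) (\<lambda>V. a_lam (V \<mapsto> a_univ 0) (\<lambda>El.
   a_lam (ty_bang_map V El) (\<lambda>mp. a_lam (ty_bang_mu V El) (\<lambda>mu.
   a_lam (ty_bang_eta V El) (\<lambda>eta. a_lam (ty_bang_uniq V El)
     (\<lambda>uniq. a_lam (ty_bang_rmap V El mp) (\<lambda>rmap. a_lam (ty_bang_reta V El eta)
     (\<lambda>reta. a_lam (ty_bang_rmu V El mu) (\<lambda>rmu.
     mon \<bullet> a_bang_obj V El \<bullet> mp \<bullet> mu \<bullet> eta
      \<bullet> a_lam (a_univ 0) (\<lambda>A. a_lam (a_bang V El A)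
        (\<lambda>w. a_lam (a_univ 0) (\<lambda>X. a_lam (X \<mapsto> A) (\<lambda>r. rep V El A w X (\<lambda>x. r \<bullet> x)))))
      \<bullet> a_lam (a_univ 0) (\<lambda>A. a_lam (a_bang V El A) (\<lambda>w. bang_car V El w))
      \<bullet> a_lam (a_univ 0) (\<lambda>A. a_lam (a_bang V El A) (\<lambda>w. bang_lab V El A w))
      \<bullet> (rtot \<bullet> V \<bullet> El) \<bullet> uniq \<bullet> rmap \<bullet> reta \<bullet> rmu))))))))))))"
definition "a_closed_coprod V El = a_fib V (a_univ 0) El (\<lambda>_. AEmpty) \<odot>
     a_pi V (\<lambda>E. a_pi V (\<lambda>F. a_fib V (a_univ 0) El (\<lambda>d. ASum ((El \<bullet> E) d) ((El \<bullet> F) d))))"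
definition "goal_wrt e B = a_pi (univalent_wrt e)
  (\<lambda>ua. a_pi (a_univ 0) (\<lambda>V. a_pi (V \<mapsto> a_univ 0)
  (\<lambda>El. a_pi (embedding_wrt e V (a_univ 0) El) (\<lambda>emb. a_pi (a_closed_sig V El) (\<lambda>c.
   a_pi (a_closed_coprod V El) (\<lambda>_. a_pi (a_contains_unit V El) (\<lambda>u. B V El c u)))))))"
definition "goal M = goal_wrt (\<lambda>A B f. a_is_equiv A B (a_lam A f))
  (\<lambda>V El c u. M \<bullet> a_bang_obj V El \<bullet> a_bang_map V El \<bullet> a_bang_mu V El c \<bullet> a_bang_eta V El u)"
definition "goal_for M mp mu eta = goal_wrt is_equiv_fun
  (\<lambda>V El c u. M \<bullet> a_bang_obj V El \<bullet> (mp \<bullet> V \<bullet> El) \<bullet> (mu \<bullet> V \<bullet> El \<bullet> c) \<bullet> (eta \<bullet> V \<bullet> El \<bullet> u))"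
definition "ty_bang_map_term = a_pi (a_univ 0) (\<lambda>V. a_pi (V \<mapsto> a_univ 0) (\<lambda>El. ty_bang_map V El))"
definition "ty_bang_mu_term = a_pi (a_univ 0)
  (\<lambda>V. a_pi (V \<mapsto> a_univ 0) (\<lambda>El. a_pi (a_closed_sig V El) (\<lambda>c. ty_bang_mu V El)))"
definition "ty_bang_eta_term = a_pi (a_univ 0)
  (\<lambda>V. a_pi (V \<mapsto> a_univ 0) (\<lambda>El. a_pi (a_contains_unit V El) (\<lambda>u. ty_bang_eta V El)))"
definition "bang_laws_body mp mu eta M = rep_map_for mp \<mapsto> mu_eq_for mu \<mapsto> rep_eta_for eta \<mapsto> laws_for M
  \<mapsto> goal_for M mp mu eta"
definition "T_bang_laws = a_pi ty_bang_map_term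
  (\<lambda>mp. a_pi ty_bang_mu_term (\<lambda>mu. a_pi ty_bang_eta_term
  (\<lambda>eta. a_pi ty_monad_pred (bang_laws_body mp mu eta))))"
text \<open>Univalence is a hypothesis of the theorem and has no closed proof, so
  \<open>T_inverse_ind\<close> cannot be discharged like other results. It stays an antecedent until
  \<open>t_bang_laws\<close> obtains it from the variable \<open>ua\<close>.\<close>

definition "T_univalence = (univalent_type \<mapsto> T_inverse_ind)"
definition "T_rep_unique_of_ind = (T_inverse_ind \<mapsto> T_rep_unique)"
definition "t_bang_laws = a_lam T_univalence (\<lambda>qind. a_lam T_rep_unique_of_ind
  (\<lambda>uniq. a_lam T_mu_family (\<lambda>mufam.
   a_lam T_rep_mu (\<lambda>rmu. a_lam T_from_rep (\<lambda>fin0.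
   a_lam ty_bang_map_term (\<lambda>mp. a_lam ty_bang_mu_term
     (\<lambda>mu. a_lam ty_bang_eta_term (\<lambda>eta. a_lam ty_monad_pred (\<lambda>M.
   a_lam (rep_map_for mp) (\<lambda>rmap. a_lam (mu_eq_for mu)
     (\<lambda>mueq. a_lam (rep_eta_for eta) (\<lambda>reta. a_lam (laws_for M) (\<lambda>mon.
   a_lam univalent_type (\<lambda>ua. a_lam (a_univ 0) (\<lambda>V. a_lam (V \<mapsto> a_univ 0)
     (\<lambda>El. a_lam (embedding_type V (a_univ 0) El) (\<lambda>emb. a_lam (a_closed_sig V El) (\<lambda>c.
   a_lam (a_closed_coprod V El) (\<lambda>_. a_lam (a_contains_unit V El) (\<lambda>u.
    let mu' = mu \<bullet> V \<bullet> El \<bullet> c in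
    fin0 \<bullet> M \<bullet> mon \<bullet> V \<bullet> El \<bullet> (mp \<bullet> V \<bullet> El) \<bullet> mu' \<bullet> (eta \<bullet> V \<bullet> El \<bullet> u)
     \<bullet> (uniq \<bullet> (qind \<bullet> ua) \<bullet> V \<bullet> El \<bullet> emb) \<bullet> (rmap \<bullet> V \<bullet> El) \<bullet> (reta \<bullet> V \<bullet> El \<bullet> u)
     \<bullet> (rmu \<bullet> V \<bullet> El \<bullet> mu' \<bullet> (mufam \<bullet> V \<bullet> El \<bullet> c \<bullet> mu' \<bullet> (mueq \<bullet> V \<bullet> El \<bullet> c)))))))))))))))))))))))"
definition "T_unfold_goal = a_pi ty_monad_pred
  (\<lambda>M. goal_for M bang_map_term bang_mu_term bang_eta_term \<mapsto> goal M)"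
text \<open>Both goals have the same normal form, hence the identity function. \<open>M\<close> is
  still a variable, so the monad laws take no part in this comparison.\<close>

definition "t_unfold_goal = a_lam ty_monad_pred
  (\<lambda>M. a_lam (goal_for M bang_map_term bang_mu_term bang_eta_term) (\<lambda>x. x))"

section \<open>Assembling the proof\<close>

text \<open>The fuel \<open>m\<close> bounds the depth of nested calls. Of the two indices the first
  is the level of the equivalence and the second that of the motive: 0 0 serves functions, 1 1
  families of types and univalence, 1 0 the embedding.\<close>

lemma equiv_ind_00_provable: "provable n (T_equiv_ind 0 0)"
  by (rule provable_check[where t = "t_equiv_ind 0 0" and m = 100]) code_simp

lemma equiv_ind_11_provable: "provable n (T_equiv_ind 1 1)"
  by (rule provable_check[where t = "t_equiv_ind 1 1" and m = 100]) code_simp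

lemma equiv_ind_10_provable: "provable n (T_equiv_ind 1 0)"
  by (rule provable_check[where t = "t_equiv_ind 1 0" and m = 100]) code_simp

lemma pointwise_eq_provable: "provable n T_pointwise_eq"
  by (rule provable_from[where As = "[T_equiv_ind 0 0]" and t = t_pointwise_eq and m = 100])
    (simp only: list.pred_inject simp_thms equiv_ind_00_provable, code_simp, code_simp)

lemma homotopy_ind_provable: "provable n T_homotopy_ind"
  by (rule provable_from[where As = "[T_equiv_ind 1 1]" and t = t_homotopy_ind and m = 100])
    (simp only: list.pred_inject simp_thms equiv_ind_11_provable, code_simp, code_simp)

lemma path_ind_11_provable: "provable n (T_path_ind 1 1)"
  by (rule provable_check[where t = "t_path_ind 1 1" and m = 100]) code_simp

lemma join_provable: "provable n T_join"
  by (rule provable_check[where t = t_join and m = 100]) code_simp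

lemma univalence_provable: "provable n T_univalence"
  by (rule provable_from[where As = "[T_equiv_ind 1 1]" and t = t_inverse_ind and m = 100])
    (simp only: list.pred_inject simp_thms equiv_ind_11_provable, code_simp, code_simp)

lemma embedding_ind_provable: "provable n T_embedding_ind"
  by (rule provable_from[where As = "[T_equiv_ind 1 0]" and t = t_embedding_ind and m = 100])
    (simp only: list.pred_inject simp_thms equiv_ind_10_provable, code_simp, code_simp)

lemma code_irrelevant_provable: "provable n T_code_irrelevant"
  by (rule provable_from[where As = "[T_path_ind 1 1, T_embedding_ind]" and t = t_code_irrelevant and
    m = 100])
    (simp only: list.pred_inject simp_thms path_ind_11_provable embedding_ind_provable, code_simp,
      code_simp)

lemma rep_unique_of_ind_provable: "provable n T_rep_unique_of_ind"
  by (rule provable_from[where As = "[T_pointwise_eq, T_join, T_code_irrelevant]" and t = t_rep_unique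
    and m = 100])
    (simp only: list.pred_inject simp_thms pointwise_eq_provable join_provable
      code_irrelevant_provable, code_simp, code_simp)

lemma rep_map_provable: "provable n T_rep_map"
  by (rule provable_check[where t = t_rep_map and m = 100]) code_simp

lemma rep_eta_provable: "provable n T_rep_eta"
  by (rule provable_check[where t = t_rep_eta and m = 100]) code_simp

lemma rep_self_provable: "provable n T_rep_self"
  by (rule provable_from[where As = "[T_pointwise_eq]" and t = t_rep_self and m = 100])
    (simp only: list.pred_inject simp_thms pointwise_eq_provable, code_simp, code_simp)

lemma mu_eq_provable: "provable n T_mu_eq"
  by (rule provable_check[where t = t_mu_eq and m = 100]) code_simp

lemma mu_family_provable: "provable n T_mu_family"
  by (rule provable_from[where As = "[T_homotopy_ind]" and t = t_mu_family and m = 100])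
    (simp only: list.pred_inject simp_thms homotopy_ind_provable, code_simp, code_simp)

lemma transport_provable: "provable n T_transport"
  by (rule provable_check[where t = t_transport and m = 100]) code_simp

lemma choice_provable: "provable n T_choice"
  by (rule provable_check[where t = t_choice and m = 100]) code_simp

lemma rep_mu_provable: "provable n T_rep_mu"
  by (rule provable_from[where As = "[T_pointwise_eq, T_path_ind 1 1, T_transport, T_choice]" and t =
    t_rep_mu and m = 100])
    (simp only: list.pred_inject simp_thms pointwise_eq_provable path_ind_11_provable
      transport_provable choice_provable, code_simp, code_simp)

lemma unique_same_provable: "provable n T_unique_same"
  by (rule provable_check[where t = t_unique_same and m = 100]) code_simp

lemma unique_right_unit_provable: "provable n T_unique_right_unit"
  by (rule provable_check[where t = t_unique_right_unit and m = 100]) code_simp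

lemma unique_left_unit_provable: "provable n T_unique_left_unit"
  by (rule provable_check[where t = t_unique_left_unit and m = 100]) code_simp

lemma unique_assoc_provable: "provable n T_unique_assoc"
  by (rule provable_check[where t = t_unique_assoc and m = 100]) code_simp

lemma map_id_provable: "provable n T_map_id"
  by (rule provable_from[where As = "[T_pointwise_eq, T_unique_same]" and t = t_map_id and m = 100])
    (simp only: list.pred_inject simp_thms pointwise_eq_provable unique_same_provable, code_simp,
      code_simp)

lemma map_comp_provable: "provable n T_map_comp"
  by (rule provable_from[where As = "[T_pointwise_eq, T_unique_same]" and t = t_map_comp and m = 100])
    (simp only: list.pred_inject simp_thms pointwise_eq_provable unique_same_provable, code_simp,
      code_simp)

lemma mu_nat_provable: "provable n T_mu_nat"
  by (rule provable_from[where As = "[T_pointwise_eq, T_unique_same]" and t = t_mu_nat and m = 100])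
    (simp only: list.pred_inject simp_thms pointwise_eq_provable unique_same_provable, code_simp,
      code_simp)

lemma eta_nat_provable: "provable n T_eta_nat"
  by (rule provable_from[where As = "[T_pointwise_eq, T_unique_same]" and t = t_eta_nat and m = 100])
    (simp only: list.pred_inject simp_thms pointwise_eq_provable unique_same_provable, code_simp,
      code_simp)

lemma mu_assoc_provable: "provable n T_mu_assoc"
  by (rule provable_from[where As = "[T_pointwise_eq, T_unique_assoc]" and t = t_mu_assoc and m = 100])
    (simp only: list.pred_inject simp_thms pointwise_eq_provable unique_assoc_provable, code_simp,
      code_simp)

lemma mu_map_eta_provable: "provable n T_mu_map_eta"
  by (rule provable_from[where As = "[T_pointwise_eq, T_unique_right_unit]" and t = t_mu_map_eta and m
    = 100])
    (simp only: list.pred_inject simp_thms pointwise_eq_provable unique_right_unit_provable,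
      code_simp, code_simp)

lemma mu_eta_provable: "provable n T_mu_eta"
  by (rule provable_from[where As = "[T_pointwise_eq, T_unique_left_unit]" and t = t_mu_eta and m = 100])
    (simp only: list.pred_inject simp_thms pointwise_eq_provable unique_left_unit_provable, code_simp,
      code_simp)

lemma laws_provable: "provable n T_laws"
  by (rule provable_from[where As = "[T_map_id, T_map_comp, T_mu_nat, T_eta_nat, T_mu_assoc,
    T_mu_map_eta, T_mu_eta]" and t = t_laws and m = 100])
    (simp only: list.pred_inject simp_thms map_id_provable map_comp_provable mu_nat_provable
      eta_nat_provable mu_assoc_provable mu_map_eta_provable mu_eta_provable, code_simp, code_simp)

lemma from_rep_provable: "provable n T_from_rep"
  by (rule provable_from[where As = "[T_rep_self]" and t = t_from_rep and m = 100])
    (simp only: list.pred_inject simp_thms rep_self_provable, code_simp, code_simp)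

lemma bang_laws_provable: "provable n T_bang_laws"
  by (rule provable_from[where As = "[T_univalence, T_rep_unique_of_ind, T_mu_family, T_rep_mu,
    T_from_rep]" and t = t_bang_laws and m = 100])
    (simp only: list.pred_inject simp_thms univalence_provable rep_unique_of_ind_provable
      mu_family_provable rep_mu_provable from_rep_provable, code_simp, code_simp)

lemma unfold_goal_provable: "provable n T_unfold_goal"
  by (rule provable_check[where t = t_unfold_goal and m = 100]) code_simp

text \<open>The operations replace their variables one at a time by \<open>provable_inst\<close>,
  each checked against its own type only, and \<open>a_is_monad\<close> comes last.\<close>

lemma bang_laws: "provable n (goal_for a_is_monad bang_map_term bang_mu_term bang_eta_term)"
proof -
  have 1: "provable n (a_pi ty_bang_mu_term (\<lambda>mu. a_pi ty_bang_eta_term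
    (\<lambda>eta. a_pi ty_monad_pred (bang_laws_body bang_map_term mu eta))))"
    by (rule provable_inst[OF bang_laws_provable[unfolded T_bang_laws_def], where m = 100 and a =
      bang_map_term]; code_simp)
  have 2: "provable n (a_pi ty_bang_eta_term (\<lambda>eta. a_pi ty_monad_pred
    (bang_laws_body bang_map_term bang_mu_term eta)))"
    by (rule provable_inst[OF 1, where m = 100 and a = bang_mu_term]; code_simp)
  have 3: "provable n (a_pi ty_monad_pred (bang_laws_body bang_map_term bang_mu_term bang_eta_term))"
    by (rule provable_inst[OF 2, where m = 100 and a = bang_eta_term]; code_simp)
  have "provable n (bang_laws_body bang_map_term bang_mu_term bang_eta_term a_is_monad)"
    by (rule provable_inst[OF 3, where m = 100 and a = a_is_monad]; code_simp)
  then have "provable n (hyps [rep_map_for bang_map_term, mu_eq_for bang_mu_term, rep_eta_for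
    bang_eta_term, laws_for a_is_monad]
      (goal_for a_is_monad bang_map_term bang_mu_term bang_eta_term))"
    by (simp add: bang_laws_body_def hyps_def)
  \<comment> \<open>The antecedents are literally the types proved before for the concrete terms, so
    matching them requires no normalisation.\<close>
  then show ?thesis
    by (rule provable_hyps) (simp only: list.pred_inject simp_thms
      rep_map_provable[unfolded T_rep_map_def]
      mu_eq_provable[unfolded T_mu_eq_def] rep_eta_provable[unfolded T_rep_eta_def]
        laws_provable[unfolded T_laws_def], code_simp)
qed

lemma bang_is_monad: "provable n (goal a_is_monad)"
proof -
  have "provable n (goal_for a_is_monad bang_map_term bang_mu_term bang_eta_term \<mapsto> goal a_is_monad)"
    by (rule provable_inst[OF unfold_goal_provable[unfolded T_unfold_goal_def], where m = 100 and a =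
      a_is_monad]; code_simp)
  then show ?thesis by (rule provable_mp[OF _ bang_laws]) code_simp
qed

text \<open>A syntactic identity: both notations unfold to one raw term. In the statement
  \<open>is_equiv\<close> is applied to a lambda abstraction, and \<open>goal\<close> was set up
  with that redex for this purpose.\<close>

lemma erase_goal: "erase n (goal a_is_monad 0) =
    (pi (univalent n) (\<lambda>ua.
     pi (\<U> n) (\<lambda>V.
     pi (V \<rightarrow> \<U> n) (\<lambda>El.
     pi (is_embedding V (\<U> n) El) (\<lambda>emb.
     pi (closed_sig n V El) (\<lambda>sig_in_V.
     pi (closed_coprod n V El) (\<lambda>coprod_in_V.
     pi (contains_unit n V El) (\<lambda>unit_in_V.
       is_monad n
         \<cdot> bang_obj n V El
         \<cdot> bang_map n V El
         \<cdot> bang_mu n V El sig_in_V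
         \<cdot> bang_eta n V El unit_in_V)))))))) 0"
  by (simp add: goal_def goal_wrt_def univalent_wrt_def embedding_wrt_def a_is_monad_def
      all_laws_def law_map_id_def law_map_comp_def law_mu_nat_def law_eta_nat_def law_mu_assoc_def
      law_mu_map_eta_def law_mu_eta_def ty_T_def ty_map_def ty_mu_def ty_eta_def a_compose_def
      a_closed_sig_def a_closed_coprod_def a_contains_unit_def a_fib_def a_bang_obj_def
      a_bang_map_def a_bang_mu_def a_bang_eta_def a_bang_def bang_pair_def a_sig_code_def
      a_sig_decode_def sig_code_path_def a_pr1_def a_pr2_def a_coe_def a_idfun_def a_ap_def
      path_to_equiv_def identity_equiv_def equiv_type_def mk_equiv_def is_equiv_fun_def
      section_type_def retraction_type_def a_pi_def abind1_def abind2_def abind3_def alevel_def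
      a_univ_def a_arr_def a_app_def a_is_equiv_def a_prod_def a_sig_def a_id_def a_lam_def
      a_happly_def a_ind_id_def a_refl_def a_pair_def a_ind_sig_def a_one_def Let_def,
    simp add: pi_def bind1_def bind2_def bind3_def level_def \<U>_def arr_def app_def is_equiv_def
      prod_type_def sig_def ident_def lam_def happly_def ind_id_def rfl_def pair_def ind_sig_def
      coprod_def empty_type_def unit_type_def idfun_def compose_def pr1_def pr2_def ap_def coe_def
      equiv_def id_equiv_def id_to_equiv_def univalent_def is_embedding_def fib_def is_monad_def
      closed_sig_def contains_unit_def closed_coprod_def bang_def bang_obj_def bang_map_def
      unit_code_def bang_eta_def sig_code_def sig_decode_def bang_mu_def Let_def)

theorem proposition4p8:
  fixes n :: nat
  shows "\<exists>t. [] \<turnstile> t \<Colon>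
    (pi (univalent n) (\<lambda>ua.
     pi (\<U> n) (\<lambda>V.
     pi (V \<rightarrow> \<U> n) (\<lambda>El.
     pi (is_embedding V (\<U> n) El) (\<lambda>emb.
     pi (closed_sig n V El) (\<lambda>sig_in_V.
     pi (closed_coprod n V El) (\<lambda>coprod_in_V.
     pi (contains_unit n V El) (\<lambda>unit_in_V.
       is_monad n
         \<cdot> bang_obj n V El
         \<cdot> bang_map n V El
         \<cdot> bang_mu n V El sig_in_V
         \<cdot> bang_eta n V El unit_in_V)))))))) 0"
  using bang_is_monad[of n] by (auto simp only: provable_def erase_goal)

end
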